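(* Let $\pi:(\mathcal G,\mu)\to(\mathcal H,\nu)$ be a pmp class-bijective extension of discrete pmp groupoids, $\mathbb P=\{\mathbb P_j\}_{j\in J}$ a sofic approximation to $(\mathcal H,\nu)$, $\beta$ a bias for $J$ and $p\in[1,\infty]$. If $\mathcal F\subset\mathcal B(\mathcal G^0)$ is a $\pi$-generating sub-algebra, then $h_{\mathbb P,\mu}(\pi)=h_{\mathbb P,\mu}(\pi,\mathcal F)$.
   Context: **Groupoids.** A groupoid $\mathcal H$ is a small category in which every morphism is invertible; it is identified with its set of morphisms, $\mathcal H^0\subset\mathcal H$ denotes the units (objects), $\mathfrak s,\mathfrak r:\mathcal H\to\mathcal H^0$ are source and range, and $fg$ is defined iff $\mathfrak s(f)=\mathfrak r(g)$. It is discrete if $\mathfrak s^{-1}(x),\mathfrak r^{-1}(x)$ are countable for all $x\in\mathcal H^0$. A measurable groupoid carries a standard Borel structure for which $\mathcal H^0$ and the set of composable pairs are Borel and source, range, composition and inversion are Borel. A discrete measurable groupoid with a Borel probability measure $\nu$ on $\mathcal H^0$ is pmp if the measures $\nu_{\mathfrak s}(B)=\int|\mathfrak s^{-1}(x)\cap B|\,d\nu(x)$ and $\nu_{\mathfrak r}(B)=\int|\mathfrak r^{-1}(x)\cap B|\,d\nu(x)$ on $\mathcal H$ coincide; the common measure is again denoted $\nu$. $[[\mathcal H]]$ is the set of Borel $f\subset\mathcal H$ such that $\mathfrak s|_f,\mathfrak r|_f$ are Borel isomorphisms onto their images, with $fg=\{f'g':f'\in f,g'\in g \text{ composable}\}$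 and $f^{-1}=\{h^{-1}:h\in f\}$. Put $\mathrm{tr}_{\mathcal H}(f)=\nu(f\cap\mathcal H^0)$. For $d\in\mathbb N$, $\Delta_d=\{1,\dots,d\}^2$ is the groupoid with $\mathfrak s(i,j)=(j,j)$, $\mathfrak r(i,j)=(i,i)$, $(i,j)(j,k)=(i,k)$; its unit set $\Delta_d^0$ is identified with $\{1,\dots,d\}$. $[[d]]:=[[\Delta_d]]$, $|f|_d=|f|/d$, $\mathrm{tr}_d(f)=|f\cap\Delta_d^0|/d$. For $f\in[[d]]$ and $A\subset\Delta_d^0$, $f\cdot A=\{i:(i,j)\in f\text{ for some }j\in A\}$. **Sofic approximations.** For finite $F\subset[[\mathcal H]]$ and $\delta>0$, $\sigma:[[\mathcal H]]\to[[d]]$ is $(F,\delta)$-multiplicative if $|\sigma(st)\vartriangle\sigma(s)\sigma(t)|_d<\delta$ for all $s,t\in F$, and $(F,\delta)$-trace-preserving if $|\mathrm{tr}_d(\sigma(s))-\mathrm{tr}_{\mathcal H}(s)|<\delta$ for all $s\in F$. $\mathrm{Map}([[\mathcal H]],[[d]])$ is the set of all maps, with the Borel structure generated by the sets $\{\sigma':\sigma'|_F=\sigma|_F\}$, $F$ finite. A sofic approximation to $(\mathcal H,\nu)$ is a family $\{\mathbb P_j\}_{j\in J}$ ($J$ a directed set) of Borel probability measures on $\mathrm{Map}([[\mathcal H]],[[d_j]])$, $d_j\in\mathbb N$, such that: (1) for all finite $F$ and $\delta>0$, $\lim_{j\to J}\mathbb P_j(\sigma\text{ is }(F,\delta)\text{-trace-preserving})=1$;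 (2) for all finite $F$ and $\delta>0$ there is $j$ such that for $j'\ge j$, $\mathbb P_{j'}$-a.e. $\sigma$ is $(F,\delta)$-multiplicative; (3) $\lim_{j\to J} d_j=\infty$; (4) if $\nu(f\vartriangle f')=0$ then $\sigma(f)=\sigma(f')$ for $\mathbb P_j$-a.e. $\sigma$. **Bias.** A bias $\beta$ for $J$ is an element of $\{-,+\}$ or an ultrafilter on $J$ containing $\{j'\in J:j'\ge j\}$ for each $j$. $\lim_{j\to\beta}\Phi(j)$ means $\liminf_{j\to J}$ if $\beta=-$, $\limsup_{j\to J}$ if $\beta=+$, and the ultralimit otherwise. $\|\cdot\|_{p,\mathbb P_j}$ is the $L^p$-norm with respect to $\mathbb P_j$. **Extensions.** A (Borel) groupoid morphism $\pi:\mathcal G\to\mathcal H$ (preserving products, inverses, units) is class-bijective if for every $a\in\mathcal G^0$ it restricts to bijections $\mathfrak s^{-1}(a)\to\mathfrak s^{-1}(\pi(a))$ and $\mathfrak r^{-1}(a)\to\mathfrak r^{-1}(\pi(a))$; a class-bijective extension is a surjective class-bijective morphism. It is pmp if $(\mathcal G,\mu),(\mathcal H,\nu)$ are pmp and $\pi_*\mu=\nu$. For $f\in[[\mathcal H]]$ and $x\in\mathcal G^0$ with $\pi(x)\in\mathfrak s(f)$, $f\cdot x$ is the range of the unique element of $\pi^{-1}(f)$ with source $x$; for $P\subset\mathcal G^0$, $f\cdot P=\{f\cdot x:x\in P,\pi(x)\in\mathfrak s(f)\}$. **Measure entropy.** For a finite partition $\mathcal P$ of $\mathcal G^0$ and finite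 $F\subset[[\mathcal H]]$, $\mathcal P^F$ is the coarsest partition of $\mathcal G^0$ such that each $f\cdot P$ ($f\in F,P\in\mathcal P$) is a union of its atoms, and $\Sigma(\mathcal P)$ is the sigma-algebra generated by $\mathcal P$. $\mathcal B(\Delta_d^0)$ is the set of all subsets of $\Delta_d^0$. A homomorphism $\phi:\Sigma(\mathcal P)\to\mathcal B(\Delta_d^0)$ is a map preserving unions and intersections with $\phi(\emptyset)=\emptyset$, $\phi(\mathcal G^0)=\Delta_d^0$. For $\sigma:[[\mathcal H]]\to[[d]]$, $\delta>0$ and finite $F\ni\mathcal H^0$, $\mathrm{Hom}(\pi,\sigma,\mathcal P,F,\delta)$ is the set of homomorphisms $\phi:\Sigma(\mathcal P^F)\to\mathcal B(\Delta_d^0)$ with $\sum_{P\in\mathcal P}|\sigma(f)\cdot\phi(P)\vartriangle\phi(f\cdot P)|d^{-1}<\delta$ for all $f\in F$ and $\sum_{P\in\mathcal P^F}\big||\phi(P)|d^{-1}-\mu(P)\big|<\delta$. For $\mathcal Q\le\mathcal P$ (meaning $\mathcal P$ refines $\mathcal Q$), $|\mathrm{Hom}(\pi,\sigma,\mathcal P,F,\delta)|_{\mathcal Q}$ is the number of distinct restrictions to $\Sigma(\mathcal Q)$ of elements of $\mathrm{Hom}(\pi,\sigma,\mathcal P,F,\delta)$. For finite Borel partitions $\mathcal Q\le\mathcal P$ let $$h_{\mathbb P,\mu}(\pi,\mathcal Q,\mathcal P)=\inf_F\inf_{\delta>0}\lim_{j\to\beta}\frac1{d_j}\log\big\||\mathrm{Hom}(\pi,\cdot,\mathcal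 P,F,\delta)|_{\mathcal Q}\big\|_{p,\mathbb P_j},$$ $F$ over finite subsets of $[[\mathcal H]]$ containing $\mathcal H^0$. For a sub-algebra $\mathcal F$ of the Borel sigma-algebra $\mathcal B(\mathcal G^0)$, $h_{\mathbb P,\mu}(\pi,\mathcal F)=\sup_{\mathcal Q\subset\mathcal F}\inf_{\mathcal Q\le\mathcal P\subset\mathcal F}h_{\mathbb P,\mu}(\pi,\mathcal Q,\mathcal P)$ over finite partitions, and $h_{\mathbb P,\mu}(\pi):=h_{\mathbb P,\mu}(\pi,\mathcal B(\mathcal G^0))$ (dependence on $p,\beta$ is suppressed). **$\pi$-generating.** For a sub-algebra $\mathcal F$, $\Sigma_\pi(\mathcal F)$ is the smallest sigma-algebra with $f\cdot P\in\Sigma_\pi(\mathcal F)$ for all $P\in\mathcal F$, $f\in[[\mathcal H]]$. $\mathcal F$ is $\pi$-generating if $\Sigma_\pi(\mathcal F)=\mathcal B(\mathcal G^0)$ up to sets of $\mu$-measure zero. *)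

theory Defs
  imports "HOL-Probability.Probability"
begin

section \<open>Groupoids\<close>

record 'a groupoid_data =
  arrows :: "'a set"
  units :: "'a set"
  src :: "'a \<Rightarrow> 'a"
  rng :: "'a \<Rightarrow> 'a"
  gmult :: "'a \<Rightarrow> 'a \<Rightarrow> 'a"
  ginv :: "'a \<Rightarrow> 'a"

text \<open>The field \<open>borel_str\<close> carries the Borel structure; its measure component is irrelevant.\<close>

record 'a borel_groupoid = "'a groupoid_data" +
  borel_str :: "'a measure"

text \<open>\<open>gmult H f g\<close> is meaningful only if \<open>src H f = rng H g\<close>; objects are identified
  with their identity arrows.\<close>

locale groupoid =
  fixes H :: "('a, 'm) groupoid_data_scheme"
  assumes units_subset: "units H \<subseteq> arrows H"
    and src_in: "f \<in> arrows H \<Longrightarrow> src H f \<in> units H"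
    and rng_in: "f \<in> arrows H \<Longrightarrow> rng H f \<in> units H"
    and src_unit: "x \<in> units H \<Longrightarrow> src H x = x"
    and rng_unit: "x \<in> units H \<Longrightarrow> rng H x = x"
    and mult_in: "\<lbrakk>f \<in> arrows H; g \<in> arrows H; src H f = rng H g\<rbrakk> \<Longrightarrow> gmult H f g \<in> arrows H"
    and src_mult: "\<lbrakk>f \<in> arrows H; g \<in> arrows H; src H f = rng H g\<rbrakk> \<Longrightarrow> src H (gmult H f g) = src H g"
    and rng_mult: "\<lbrakk>f \<in> arrows H; g \<in> arrows H; src H f = rng H g\<rbrakk> \<Longrightarrow> rng H (gmult H f g) = rng H f"
    and mult_assoc: "\<lbrakk>f \<in> arrows H; g \<in> arrows H; h \<in> arrows H; src H f = rng H g; src H g = rng H h\<rbrakk>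
        \<Longrightarrow> gmult H (gmult H f g) h = gmult H f (gmult H g h)"
    and mult_src: "f \<in> arrows H \<Longrightarrow> gmult H f (src H f) = f"
    and mult_rng: "f \<in> arrows H \<Longrightarrow> gmult H (rng H f) f = f"
    and inv_in: "f \<in> arrows H \<Longrightarrow> ginv H f \<in> arrows H"
    and src_inv: "f \<in> arrows H \<Longrightarrow> src H (ginv H f) = rng H f"
    and rng_inv: "f \<in> arrows H \<Longrightarrow> rng H (ginv H f) = src H f"
    and inv_mult: "f \<in> arrows H \<Longrightarrow> gmult H (ginv H f) f = src H f"
    and mult_inv: "f \<in> arrows H \<Longrightarrow> gmult H f (ginv H f) = rng H f"

definition composable :: "('a, 'm) groupoid_data_scheme \<Rightarrow> ('a \<times> 'a) set" where
  "composable H = {(f, g). f \<in> arrows H \<and> g \<in> arrows H \<and> src H f = rng H g}"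

definition discrete_groupoid :: "('a, 'm) groupoid_data_scheme \<Rightarrow> bool" where
  "discrete_groupoid H \<longleftrightarrow> (\<forall>x\<in>units H.
     countable {h \<in> arrows H. src H h = x} \<and> countable {h \<in> arrows H. rng H h = x})"

definition standard_borel :: "'a measure \<Rightarrow> bool" where
  "standard_borel M \<longleftrightarrow> (\<exists>T. completely_metrizable_space T \<and> second_countable T \<and>
     topspace T = space M \<and> sets M = sigma_sets (space M) {U. openin T U})"

definition unit_space :: "'a borel_groupoid \<Rightarrow> 'a measure" where
  "unit_space H = restrict_space (borel_str H) (units H)"

locale measurable_groupoid = groupoid H for H :: "'a borel_groupoid" +
  assumes space_borel_str: "space (borel_str H) = arrows H"
    and standard: "standard_borel (borel_str H)"
    and units_sets: "units H \<in> sets (borel_str H)"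
    and composable_sets: "composable H \<in> sets (borel_str H \<Otimes>\<^sub>M borel_str H)"
    and src_measurable: "src H \<in> measurable (borel_str H) (unit_space H)"
    and rng_measurable: "rng H \<in> measurable (borel_str H) (unit_space H)"
    and mult_measurable: "(\<lambda>(f, g). gmult H f g) \<in>
        measurable (restrict_space (borel_str H \<Otimes>\<^sub>M borel_str H) (composable H)) (borel_str H)"
    and inv_measurable: "ginv H \<in> measurable (borel_str H) (borel_str H)"

definition src_measure :: "'a borel_groupoid \<Rightarrow> 'a measure \<Rightarrow> 'a set \<Rightarrow> ennreal" where
  "src_measure H \<nu> B =
     (\<integral>\<^sup>+ x. emeasure (count_space UNIV) {h \<in> arrows H. src H h = x \<and> h \<in> B} \<partial>\<nu>)"

definition rng_measure :: "'a borel_groupoid \<Rightarrow> 'a measure \<Rightarrow> 'a set \<Rightarrow> ennreal" where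
  "rng_measure H \<nu> B =
     (\<integral>\<^sup>+ x. emeasure (count_space UNIV) {h \<in> arrows H. rng H h = x \<and> h \<in> B} \<partial>\<nu>)"

definition discrete_pmp_groupoid :: "'a borel_groupoid \<Rightarrow> 'a measure \<Rightarrow> bool" where
  "discrete_pmp_groupoid H \<nu> \<longleftrightarrow> measurable_groupoid H \<and> discrete_groupoid H \<and>
     prob_space \<nu> \<and> sets \<nu> = sets (unit_space H) \<and>
     (\<forall>B\<in>sets (borel_str H). src_measure H \<nu> B = rng_measure H \<nu> B)"

section \<open>The full inverse semigroup\<close>

definition borel_iso_onto_image :: "'a measure \<Rightarrow> 'b measure \<Rightarrow> 'a set \<Rightarrow> ('a \<Rightarrow> 'b) \<Rightarrow> bool" where
  "borel_iso_onto_image M N A \<phi> \<longleftrightarrow> inj_on \<phi> A \<and>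
     \<phi> \<in> measurable (restrict_space M A) (restrict_space N (\<phi> ` A)) \<and>
     inv_into A \<phi> \<in> measurable (restrict_space N (\<phi> ` A)) (restrict_space M A)"

definition full_semigroup :: "'a borel_groupoid \<Rightarrow> 'a set set" where
  "full_semigroup H = {f \<in> sets (borel_str H).
     borel_iso_onto_image (borel_str H) (unit_space H) f (src H) \<and>
     borel_iso_onto_image (borel_str H) (unit_space H) f (rng H)}"

definition set_mult :: "('a, 'm) groupoid_data_scheme \<Rightarrow> 'a set \<Rightarrow> 'a set \<Rightarrow> 'a set" where
  "set_mult H f g = {gmult H f' g' | f' g'. f' \<in> f \<and> g' \<in> g \<and> src H f' = rng H g'}"

definition groupoid_trace :: "'a borel_groupoid \<Rightarrow> 'a measure \<Rightarrow> 'a set \<Rightarrow> real" where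
  "groupoid_trace H \<nu> f = measure \<nu> (f \<inter> units H)"

definition Delta :: "nat \<Rightarrow> (nat \<times> nat) borel_groupoid" where
  "Delta d = \<lparr> arrows = {1..d} \<times> {1..d}, units = {(i, i) | i. i \<in> {1..d}},
     src = (\<lambda>(i, j). (j, j)), rng = (\<lambda>(i, j). (i, i)),
     gmult = (\<lambda>(i, j) (k, l). (i, l)), ginv = (\<lambda>(i, j). (j, i)),
     borel_str = count_space ({1..d} \<times> {1..d}) \<rparr>"

definition card_norm :: "nat \<Rightarrow> 'a set \<Rightarrow> real" where
  "card_norm d A = real (card A) / real d"

definition trace_d :: "nat \<Rightarrow> (nat \<times> nat) set \<Rightarrow> real" where
  "trace_d d f = card_norm d (f \<inter> units (Delta d))"

text \<open>Subsets of the unit set of \<open>Delta d\<close> are written as subsets of \<open>{1..d}\<close>.\<close>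

definition act_d :: "(nat \<times> nat) set \<Rightarrow> nat set \<Rightarrow> nat set" where
  "act_d f A = {i. \<exists>j\<in>A. (i, j) \<in> f}"

section \<open>Directed sets and biases\<close>

definition directed_set :: "'j set \<Rightarrow> ('j \<Rightarrow> 'j \<Rightarrow> bool) \<Rightarrow> bool" where
  "directed_set J le \<longleftrightarrow> J \<noteq> {} \<and> (\<forall>i\<in>J. le i i) \<and>
     (\<forall>i\<in>J. \<forall>j\<in>J. \<forall>k\<in>J. le i j \<longrightarrow> le j k \<longrightarrow> le i k) \<and>
     (\<forall>i\<in>J. \<forall>j\<in>J. \<exists>k\<in>J. le i k \<and> le j k)"

text \<open>Convergence along this filter is convergence of nets indexed by \<open>J\<close>.\<close>

definition tails :: "'j set \<Rightarrow> ('j \<Rightarrow> 'j \<Rightarrow> bool) \<Rightarrow> 'j filter" where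
  "tails J le = (INF j\<in>J. principal {j' \<in> J. le j j'})"

lemma eventually_tails:
  assumes "directed_set J le"
  shows "eventually P (tails J le) \<longleftrightarrow> (\<exists>j\<in>J. \<forall>j'\<in>J. le j j' \<longrightarrow> P j')"
proof -
  have "eventually P (tails J le) \<longleftrightarrow> (\<exists>j\<in>J. eventually P (principal {j' \<in> J. le j j'}))"
    unfolding tails_def
  proof (rule eventually_INF_base)
    show "J \<noteq> {}" using assms by (simp add: directed_set_def)
    fix a b assume ab: "a \<in> J" "b \<in> J"
    then obtain k where "k \<in> J" "le a k" "le b k"
      using assms unfolding directed_set_def by blast
    moreover from this have "{j' \<in> J. le k j'} \<subseteq> {j' \<in> J. le a j'} \<inter> {j' \<in> J. le b j'}"
      using ab assms unfolding directed_set_def by blast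
    ultimately show "\<exists>x\<in>J. principal {j' \<in> J. le x j'} \<le>
        inf (principal {j' \<in> J. le a j'}) (principal {j' \<in> J. le b j'})"
      by auto
  qed
  then show ?thesis by (auto simp: eventually_principal)
qed

text \<open>An ultrafilter on \<open>J\<close> is encoded as a filter on the type \<open>'j\<close> that contains \<open>J\<close>.\<close>

datatype 'j bias = Minus | Plus | Ultra "'j filter"

definition ultrafilter_on :: "'j set \<Rightarrow> 'j filter \<Rightarrow> bool" where
  "ultrafilter_on J U \<longleftrightarrow> U \<noteq> bot \<and> eventually (\<lambda>j. j \<in> J) U \<and>
     (\<forall>P. eventually P U \<or> eventually (\<lambda>j. \<not> P j) U)"

definition bias_for :: "'j set \<Rightarrow> ('j \<Rightarrow> 'j \<Rightarrow> bool) \<Rightarrow> 'j bias \<Rightarrow> bool" where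
  "bias_for J le \<beta> \<longleftrightarrow> (case \<beta> of Minus \<Rightarrow> True | Plus \<Rightarrow> True
     | Ultra U \<Rightarrow> ultrafilter_on J U \<and> (\<forall>j\<in>J. eventually (\<lambda>j'. j' \<in> J \<and> le j j') U))"

definition bias_lim :: "'j set \<Rightarrow> ('j \<Rightarrow> 'j \<Rightarrow> bool) \<Rightarrow> 'j bias \<Rightarrow> ('j \<Rightarrow> ereal) \<Rightarrow> ereal" where
  "bias_lim J le \<beta> \<Phi> = (case \<beta> of Minus \<Rightarrow> Liminf (tails J le) \<Phi>
     | Plus \<Rightarrow> Limsup (tails J le) \<Phi> | Ultra U \<Rightarrow> Lim U \<Phi>)"

section \<open>Sofic approximations\<close>

definition multiplicative ::
    "'h borel_groupoid \<Rightarrow> nat \<Rightarrow> 'h set set \<Rightarrow> real \<Rightarrow> ('h set \<Rightarrow> (nat \<times> nat) set) \<Rightarrow> bool" where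
  "multiplicative H d F \<delta> \<sigma> \<longleftrightarrow> (\<forall>s\<in>F. \<forall>t\<in>F.
     card_norm d (sym_diff (\<sigma> (set_mult H s t)) (set_mult (Delta d) (\<sigma> s) (\<sigma> t))) < \<delta>)"

definition trace_preserving :: "'h borel_groupoid \<Rightarrow> 'h measure \<Rightarrow> nat \<Rightarrow>
    'h set set \<Rightarrow> real \<Rightarrow> ('h set \<Rightarrow> (nat \<times> nat) set) \<Rightarrow> bool" where
  "trace_preserving H \<nu> d F \<delta> \<sigma> \<longleftrightarrow>
     (\<forall>s\<in>F. \<bar>trace_d d (\<sigma> s) - groupoid_trace H \<nu> s\<bar> < \<delta>)"

definition Map_set :: "'h borel_groupoid \<Rightarrow> nat \<Rightarrow> ('h set \<Rightarrow> (nat \<times> nat) set) set" where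
  "Map_set H d = full_semigroup H \<rightarrow>\<^sub>E full_semigroup (Delta d)"

text \<open>The cylinders generate the sigma-algebra; for uncountable \<open>full_semigroup H\<close> it is
  smaller than the Borel sigma-algebra of the product topology.\<close>

definition Map_space :: "'h borel_groupoid \<Rightarrow> nat \<Rightarrow> ('h set \<Rightarrow> (nat \<times> nat) set) measure" where
  "Map_space H d = sigma (Map_set H d)
     {{\<sigma>' \<in> Map_set H d. \<forall>f\<in>F. \<sigma>' f = \<sigma> f} | \<sigma> F.
        \<sigma> \<in> Map_set H d \<and> finite F \<and> F \<subseteq> full_semigroup H}"

text \<open>Null sets of arrows refer to \<open>src_measure\<close>, which agrees with \<open>rng_measure\<close>
  on a pmp groupoid and restricts to \<open>\<nu>\<close> on the units.\<close>

definition sofic_approximation :: "'h borel_groupoid \<Rightarrow> 'h measure \<Rightarrow> 'j set \<Rightarrow>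
    ('j \<Rightarrow> 'j \<Rightarrow> bool) \<Rightarrow> ('j \<Rightarrow> nat) \<Rightarrow> ('j \<Rightarrow> ('h set \<Rightarrow> (nat \<times> nat) set) measure) \<Rightarrow> bool" where
  "sofic_approximation H \<nu> J le d \<P> \<longleftrightarrow> directed_set J le \<and>
     (\<forall>j\<in>J. 0 < d j \<and> prob_space (\<P> j) \<and> sets (\<P> j) = sets (Map_space H (d j))) \<and>
     (\<forall>F \<delta>. finite F \<and> F \<subseteq> full_semigroup H \<and> 0 < \<delta> \<longrightarrow>
        ((\<lambda>j. measure (\<P> j) {\<sigma> \<in> space (\<P> j). trace_preserving H \<nu> (d j) F \<delta> \<sigma>}) \<longlongrightarrow> 1)
          (tails J le)) \<and>
     (\<forall>F \<delta>. finite F \<and> F \<subseteq> full_semigroup H \<and> 0 < \<delta> \<longrightarrow>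
        (\<exists>j\<in>J. \<forall>j'\<in>J. le j j' \<longrightarrow> (AE \<sigma> in \<P> j'. multiplicative H (d j') F \<delta> \<sigma>))) \<and>
     filterlim d at_top (tails J le) \<and>
     (\<forall>j\<in>J. \<forall>f\<in>full_semigroup H. \<forall>f'\<in>full_semigroup H.
        src_measure H \<nu> (sym_diff f f') = 0 \<longrightarrow> (AE \<sigma> in \<P> j. \<sigma> f = \<sigma> f'))"

section \<open>Class-bijective extensions\<close>

definition groupoid_morphism ::
    "('g, 'm) groupoid_data_scheme \<Rightarrow> ('h, 'n) groupoid_data_scheme \<Rightarrow> ('g \<Rightarrow> 'h) \<Rightarrow> bool" where
  "groupoid_morphism G H \<pi> \<longleftrightarrow>
     (\<forall>g\<in>arrows G. \<pi> g \<in> arrows H \<and> src H (\<pi> g) = \<pi> (src G g) \<and> rng H (\<pi> g) = \<pi> (rng G g) \<and>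
        \<pi> (ginv G g) = ginv H (\<pi> g)) \<and>
     (\<forall>x\<in>units G. \<pi> x \<in> units H) \<and>
     (\<forall>f\<in>arrows G. \<forall>g\<in>arrows G. src G f = rng G g \<longrightarrow> \<pi> (gmult G f g) = gmult H (\<pi> f) (\<pi> g))"

definition class_bijective ::
    "('g, 'm) groupoid_data_scheme \<Rightarrow> ('h, 'n) groupoid_data_scheme \<Rightarrow> ('g \<Rightarrow> 'h) \<Rightarrow> bool" where
  "class_bijective G H \<pi> \<longleftrightarrow> (\<forall>a\<in>units G.
     bij_betw \<pi> {g \<in> arrows G. src G g = a} {h \<in> arrows H. src H h = \<pi> a} \<and>
     bij_betw \<pi> {g \<in> arrows G. rng G g = a} {h \<in> arrows H. rng H h = \<pi> a})"

definition pmp_class_bijective_extension :: "'g borel_groupoid \<Rightarrow> 'g measure \<Rightarrow>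
    'h borel_groupoid \<Rightarrow> 'h measure \<Rightarrow> ('g \<Rightarrow> 'h) \<Rightarrow> bool" where
  "pmp_class_bijective_extension G \<mu> H \<nu> \<pi> \<longleftrightarrow>
     discrete_pmp_groupoid G \<mu> \<and> discrete_pmp_groupoid H \<nu> \<and>
     groupoid_morphism G H \<pi> \<and> \<pi> \<in> measurable (borel_str G) (borel_str H) \<and>
     class_bijective G H \<pi> \<and> \<pi> ` arrows G = arrows H \<and> distr \<mu> \<nu> \<pi> = \<nu>"

definition ext_act_point :: "'g borel_groupoid \<Rightarrow> ('g \<Rightarrow> 'h) \<Rightarrow> 'h set \<Rightarrow> 'g \<Rightarrow> 'g" where
  "ext_act_point G \<pi> f x = rng G (THE g. g \<in> arrows G \<and> \<pi> g \<in> f \<and> src G g = x)"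

definition ext_act :: "'g borel_groupoid \<Rightarrow> 'h borel_groupoid \<Rightarrow> ('g \<Rightarrow> 'h) \<Rightarrow>
    'h set \<Rightarrow> 'g set \<Rightarrow> 'g set" where
  "ext_act G H \<pi> f P = {ext_act_point G \<pi> f x | x. x \<in> P \<and> \<pi> x \<in> src H ` f}"

section \<open>Partitions and measure entropy\<close>

definition finite_partitions :: "'a set \<Rightarrow> 'a set set \<Rightarrow> 'a set set set" where
  "finite_partitions X \<A> = {\<P>. partition_on X \<P> \<and> finite \<P> \<and> \<P> \<subseteq> \<A>}"

text \<open>\<open>refines X \<R> \<Q>\<close> says that \<open>\<R>\<close> is finer than \<open>\<Q>\<close>.\<close>

definition coarsest_partition :: "'a set \<Rightarrow> 'a set set \<Rightarrow> 'a set set" where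
  "coarsest_partition X \<S> = (THE \<Q>. partition_on X \<Q> \<and> (\<forall>S\<in>\<S>. \<exists>C\<subseteq>\<Q>. S = \<Union>C) \<and>
     (\<forall>\<R>. partition_on X \<R> \<and> (\<forall>S\<in>\<S>. \<exists>C\<subseteq>\<R>. S = \<Union>C) \<longrightarrow> refines X \<R> \<Q>))"

lemma coarsest_partition_eq:
  assumes "\<And>S. S \<in> \<S> \<Longrightarrow> S \<subseteq> X"
  shows "coarsest_partition X \<S> = X // {(x, y). x \<in> X \<and> y \<in> X \<and> (\<forall>S\<in>\<S>. x \<in> S \<longleftrightarrow> y \<in> S)}"
proof -
  define r where "r = {(x, y). x \<in> X \<and> y \<in> X \<and> (\<forall>S\<in>\<S>. x \<in> S \<longleftrightarrow> y \<in> S)}"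
  have eq: "equiv X r"
    by (rule equivI) (auto simp: r_def refl_on_def sym_def trans_def)
  have part: "partition_on X (X // r)" by (rule partition_on_quotient[OF eq])
  have union: "\<exists>C\<subseteq>X // r. S = \<Union>C" if "S \<in> \<S>" for S
  proof (intro exI conjI)
    show "{r `` {x} | x. x \<in> S} \<subseteq> X // r" using assms[OF that] by (auto simp: quotient_def)
    show "S = \<Union>{r `` {x} | x. x \<in> S}" using assms[OF that] that by (auto simp: r_def)
  qed
  have finer: "refines X \<R> (X // r)"
    if R: "partition_on X \<R>" and U: "\<forall>S\<in>\<S>. \<exists>C\<subseteq>\<R>. S = \<Union>C" for \<R>
    unfolding refines_def
  proof (intro conjI ballI R part)
    fix A assume A: "A \<in> \<R>"
    then obtain x where x: "x \<in> A" using R by (metis partition_onD3 ex_in_conv)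
    have "(x, y) \<in> r" if y: "y \<in> A" for y
    proof -
      have "x \<in> S \<longleftrightarrow> y \<in> S" if "S \<in> \<S>" for S
      proof -
        obtain C where C: "C \<subseteq> \<R>" and S: "S = \<Union>C" using bspec[OF U \<open>S \<in> \<S>\<close>] by (elim exE conjE)
        have "A \<in> C" if z: "z \<in> A" "z \<in> S" for z
        proof -
          obtain B where B: "B \<in> C" "z \<in> B" using z(2) unfolding S by (rule UnionE)
          have "A = B"
            using disjointD[OF partition_onD2[OF R] A subsetD[OF C B(1)]] z(1) B(2) by blast
          with B show ?thesis by simp
        qed
        then show ?thesis using S x y by (meson UnionI)
      qed
      moreover have "x \<in> X" "y \<in> X" using A x y partition_onD1[OF R] by auto
      ultimately show ?thesis by (simp add: r_def)
    qed
    then have "A \<subseteq> r `` {x}" by blast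
    moreover have "x \<in> X" using A x partition_onD1[OF R] by auto
    ultimately show "\<exists>Y\<in>X // r. A \<subseteq> Y" by (meson quotientI)
  qed
  show ?thesis
    unfolding coarsest_partition_def r_def[symmetric]
  proof (rule the_equality)
    show "partition_on X (X // r) \<and> (\<forall>S\<in>\<S>. \<exists>C\<subseteq>X // r. S = \<Union>C) \<and>
       (\<forall>\<R>. partition_on X \<R> \<and> (\<forall>S\<in>\<S>. \<exists>C\<subseteq>\<R>. S = \<Union>C) \<longrightarrow> refines X \<R> (X // r))"
      by (intro conjI ballI allI impI part union finer) simp_all
    fix \<Q> assume Q: "partition_on X \<Q> \<and> (\<forall>S\<in>\<S>. \<exists>C\<subseteq>\<Q>. S = \<Union>C) \<and>
       (\<forall>\<R>. partition_on X \<R> \<and> (\<forall>S\<in>\<S>. \<exists>C\<subseteq>\<R>. S = \<Union>C) \<longrightarrow> refines X \<R> \<Q>)"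
    have "refines X (X // r) \<Q>"
      by (rule Q[THEN conjunct2, THEN conjunct2, THEN spec, THEN mp])
        (intro conjI ballI part union)
    moreover have "refines X \<Q> (X // r)"
      by (rule finer[OF Q[THEN conjunct1] Q[THEN conjunct2, THEN conjunct1]])
    ultimately show "\<Q> = X // r" by (metis refines_asym)
  qed
qed

definition join_partition :: "'g borel_groupoid \<Rightarrow> 'h borel_groupoid \<Rightarrow> ('g \<Rightarrow> 'h) \<Rightarrow>
    'g set set \<Rightarrow> 'h set set \<Rightarrow> 'g set set" where
  "join_partition G H \<pi> \<P> F =
     coarsest_partition (units G) {ext_act G H \<pi> f P | f P. f \<in> F \<and> P \<in> \<P>}"

definition set_homs :: "'a set \<Rightarrow> 'a set set \<Rightarrow> 'b set \<Rightarrow> ('a set \<Rightarrow> 'b set) set" where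
  "set_homs X \<A> Y = {\<phi> \<in> \<A> \<rightarrow>\<^sub>E Pow Y. \<phi> {} = {} \<and> \<phi> X = Y \<and>
     (\<forall>A\<in>\<A>. \<forall>B\<in>\<A>. \<phi> (A \<union> B) = \<phi> A \<union> \<phi> B \<and> \<phi> (A \<inter> B) = \<phi> A \<inter> \<phi> B)}"

definition Hom :: "'g borel_groupoid \<Rightarrow> 'g measure \<Rightarrow> 'h borel_groupoid \<Rightarrow> ('g \<Rightarrow> 'h) \<Rightarrow> nat \<Rightarrow>
    ('h set \<Rightarrow> (nat \<times> nat) set) \<Rightarrow> 'g set set \<Rightarrow> 'h set set \<Rightarrow> real \<Rightarrow> ('g set \<Rightarrow> nat set) set" where
  "Hom G \<mu> H \<pi> d \<sigma> \<P> F \<delta> =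
     {\<phi> \<in> set_homs (units G) (sigma_sets (units G) (join_partition G H \<pi> \<P> F)) {1..d}.
        (\<forall>f\<in>F. (\<Sum>P\<in>\<P>. card_norm d (sym_diff (act_d (\<sigma> f) (\<phi> P)) (\<phi> (ext_act G H \<pi> f P)))) < \<delta>) \<and>
        (\<Sum>P\<in>join_partition G H \<pi> \<P> F. \<bar>card_norm d (\<phi> P) - measure \<mu> P\<bar>) < \<delta>}"

definition Hom_count :: "'g borel_groupoid \<Rightarrow> 'g measure \<Rightarrow> 'h borel_groupoid \<Rightarrow> ('g \<Rightarrow> 'h) \<Rightarrow> nat \<Rightarrow>
    ('h set \<Rightarrow> (nat \<times> nat) set) \<Rightarrow> 'g set set \<Rightarrow> 'g set set \<Rightarrow> 'h set set \<Rightarrow> real \<Rightarrow> nat" where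
  "Hom_count G \<mu> H \<pi> d \<sigma> \<Q> \<P> F \<delta> =
     card ((\<lambda>\<phi>. restrict \<phi> (sigma_sets (units G) \<Q>)) ` Hom G \<mu> H \<pi> d \<sigma> \<P> F \<delta>)"

definition Lp_norm :: "ennreal \<Rightarrow> 'a measure \<Rightarrow> ('a \<Rightarrow> real) \<Rightarrow> ennreal" where
  "Lp_norm p M f =
     (if p = \<infinity> then esssup M (\<lambda>x. ennreal \<bar>f x\<bar>)
      else let I = (\<integral>\<^sup>+ x. ennreal (\<bar>f x\<bar> powr enn2real p) \<partial>M)
           in if I = \<infinity> then \<infinity> else ennreal (enn2real I powr (1 / enn2real p)))"

text \<open>Natural logarithm with \<open>log 0 = -\<infinity>\<close>: there may be no homomorphisms at all.\<close>

definition log_ennreal :: "ennreal \<Rightarrow> ereal" where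
  "log_ennreal x = (if x = 0 then - \<infinity> else if x = \<infinity> then \<infinity> else ereal (ln (enn2real x)))"

definition entropy_QP :: "'g borel_groupoid \<Rightarrow> 'g measure \<Rightarrow> 'h borel_groupoid \<Rightarrow> ('g \<Rightarrow> 'h) \<Rightarrow>
    'j set \<Rightarrow> ('j \<Rightarrow> 'j \<Rightarrow> bool) \<Rightarrow> ('j \<Rightarrow> nat) \<Rightarrow> ('j \<Rightarrow> ('h set \<Rightarrow> (nat \<times> nat) set) measure) \<Rightarrow>
    'j bias \<Rightarrow> ennreal \<Rightarrow> 'g set set \<Rightarrow> 'g set set \<Rightarrow> ereal" where
  "entropy_QP G \<mu> H \<pi> J le d \<PP> \<beta> p \<Q> \<P> =
     (INF F \<in> {F. finite F \<and> F \<subseteq> full_semigroup H \<and> units H \<in> F}. INF \<delta> \<in> {0<..}.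
        bias_lim J le \<beta> (\<lambda>j. ereal (1 / real (d j)) *
          log_ennreal (Lp_norm p (\<PP> j) (\<lambda>\<sigma>. real (Hom_count G \<mu> H \<pi> (d j) \<sigma> \<Q> \<P> F \<delta>)))))"

definition entropy_alg :: "'g borel_groupoid \<Rightarrow> 'g measure \<Rightarrow> 'h borel_groupoid \<Rightarrow> ('g \<Rightarrow> 'h) \<Rightarrow>
    'j set \<Rightarrow> ('j \<Rightarrow> 'j \<Rightarrow> bool) \<Rightarrow> ('j \<Rightarrow> nat) \<Rightarrow> ('j \<Rightarrow> ('h set \<Rightarrow> (nat \<times> nat) set) measure) \<Rightarrow>
    'j bias \<Rightarrow> ennreal \<Rightarrow> 'g set set \<Rightarrow> ereal" where
  "entropy_alg G \<mu> H \<pi> J le d \<PP> \<beta> p \<F> =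
     (SUP \<Q> \<in> finite_partitions (units G) \<F>.
        INF \<P> \<in> {\<P> \<in> finite_partitions (units G) \<F>. refines (units G) \<P> \<Q>}.
          entropy_QP G \<mu> H \<pi> J le d \<PP> \<beta> p \<Q> \<P>)"

definition measure_entropy :: "'g borel_groupoid \<Rightarrow> 'g measure \<Rightarrow> 'h borel_groupoid \<Rightarrow> ('g \<Rightarrow> 'h) \<Rightarrow>
    'j set \<Rightarrow> ('j \<Rightarrow> 'j \<Rightarrow> bool) \<Rightarrow> ('j \<Rightarrow> nat) \<Rightarrow> ('j \<Rightarrow> ('h set \<Rightarrow> (nat \<times> nat) set) measure) \<Rightarrow>
    'j bias \<Rightarrow> ennreal \<Rightarrow> ereal" where
  "measure_entropy G \<mu> H \<pi> J le d \<PP> \<beta> p =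
     entropy_alg G \<mu> H \<pi> J le d \<PP> \<beta> p (sets (unit_space G))"

definition Sigma_pi :: "'g borel_groupoid \<Rightarrow> 'h borel_groupoid \<Rightarrow> ('g \<Rightarrow> 'h) \<Rightarrow> 'g set set \<Rightarrow> 'g set set" where
  "Sigma_pi G H \<pi> \<F> =
     sigma_sets (units G) {ext_act G H \<pi> f P | f P. f \<in> full_semigroup H \<and> P \<in> \<F>}"

text \<open>Equality of the two sigma-algebras modulo null sets, stated in both directions.\<close>

definition pi_generating :: "'g borel_groupoid \<Rightarrow> 'g measure \<Rightarrow> 'h borel_groupoid \<Rightarrow> ('g \<Rightarrow> 'h) \<Rightarrow>
    'g set set \<Rightarrow> bool" where
  "pi_generating G \<mu> H \<pi> \<F> \<longleftrightarrow>
     (\<forall>B\<in>sets (unit_space G). \<exists>A\<in>Sigma_pi G H \<pi> \<F>. sym_diff A B \<in> null_sets \<mu>) \<and>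
     (\<forall>A\<in>Sigma_pi G H \<pi> \<F>. \<exists>B\<in>sets (unit_space G). sym_diff A B \<in> null_sets \<mu>)"

end

theory Submission
  imports Defs
begin

text \<open>Restricting homomorphisms to coarser data makes their number monotone in \<open>\<P>\<close>, \<open>F\<close> and \<open>\<delta>\<close>. Write
  \<open>\<A>\<close> for the algebra of all sets in some \<open>\<Sigma>(\<P>'\<^sup>F)\<close>, with \<open>\<P>' \<subseteq> \<F>\<close>; as \<open>\<F>\<close> is \<open>\<pi>\<close>-generating, \<open>\<A>\<close>
  is dense in measure in the Borel algebra.

  If \<open>\<Q> \<subseteq> \<F>\<close> and \<open>\<P>\<close> is Borel, the atoms of \<open>\<P>\<^sup>F\<close> are approximated by members of \<open>\<A>\<close> that respect
  \<open>\<Q>\<close>. This gives a point map \<open>\<kappa>\<close> such that \<open>\<phi> \<mapsto> \<phi> \<circ> \<kappa>\<^sup>-\<^sup>1\<close> turns homomorphisms that are good for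
  some \<open>\<P>' \<subseteq> \<F>\<close> into homomorphisms that are good for \<open>\<P>\<close>, with the same restriction to \<open>\<Q>\<close>; here
  the almost multiplicativity of the sofic approximation enters.

  Conversely, a Borel partition \<open>\<Q>\<close> is \<open>\<eta>\<close>-close to sets in \<open>\<Sigma>(\<Q>'\<^sup>K)\<close> with \<open>\<Q>' \<subseteq> \<F>\<close>. The
  restriction of a homomorphism to \<open>\<Q>'\<close> therefore determines its restriction to \<open>\<Q>\<close> up to a subset of
  \<open>{1..d}\<close> of size \<open>O(\<eta> d)\<close> for each atom, which leaves at most \<open>exp (\<epsilon> d)\<close> possibilities.

  All this needs that translates \<open>f \<cdot> P\<close> of Borel sets are Borel. They are injective Borel images, so this
  is the Lusin--Souslin theorem.\<close>

section \<open>Injective Borel images\<close>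

text \<open>What is counted are restrictions to \<open>\<Q>\<close>, so the first comparison must
  preserve them exactly although the atoms are only approximated. Approximants of disjoint sets may
  overlap and leave gaps, and changing a homomorphism set by set would destroy its Boolean
  identities. Preimages under a point map keep these identities however crude the approximation is,
  and a map that moves points only inside their cells of \<open>\<Q>\<close> leaves
  \<open>\<Q>\<close> alone. Translates by \<open>F\<close> of sets in
  \<open>\<Sigma>(\<P>'^F')\<close> may leave this algebra. The homomorphisms to be transferred are
  therefore taken over a set \<open>F''\<close> that also contains the products of elements of
  \<open>F\<close> and \<open>F'\<close>; multiplicativity is spent on the identity
  \<open>f (g A) = (f g) A\<close>. In the second comparison \<open>\<Q>\<close> need not lie in
  \<open>\<F>\<close>, so restrictions cannot be matched one to one. The loss is a factor
  exponential in \<open>d\<close>, that is an additive \<open>\<epsilon>\<close> after the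
  normalized logarithm; for fixed \<open>\<Q>\<close> it is then sent to zero.\<close>

abbreviation baire :: "(nat \<Rightarrow> 'a) measure" where
  "baire \<equiv> Pi\<^sub>M UNIV (\<lambda>_. count_space UNIV)"

text \<open>Closedness in the product of discrete topologies, phrased with finite prefixes.\<close>

definition tree_closed :: "(nat \<Rightarrow> 'a) set \<Rightarrow> bool" where
  "tree_closed C \<longleftrightarrow> (\<forall>w. (\<forall>n. \<exists>v\<in>C. \<forall>i<n. v i = w i) \<longrightarrow> w \<in> C)"

lemma tree_closedD: "tree_closed C \<Longrightarrow> (\<And>n. \<exists>v\<in>C. \<forall>i<n. v i = w i) \<Longrightarrow> w \<in> C"
  unfolding tree_closed_def by blast

section \<open>Borel separation of images of closed sets\<close>

definition cyl :: "(nat \<Rightarrow> 'a) set \<Rightarrow> (nat \<Rightarrow> 'a) \<Rightarrow> nat \<Rightarrow> (nat \<Rightarrow> 'a) set" where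
  "cyl C w n = {v \<in> C. \<forall>i<n. v i = w i}"

definition separated :: "(nat \<Rightarrow> nat) set \<Rightarrow> (nat \<Rightarrow> nat) set \<Rightarrow> bool" where
  "separated X Y \<longleftrightarrow> (\<exists>B\<in>sets baire. X \<subseteq> B \<and> B \<inter> Y = {})"

lemma baire_coordinate_measurable [measurable]: "(\<lambda>w. w n) \<in> baire \<rightarrow>\<^sub>M count_space UNIV"
  by (rule measurable_component_singleton) simp

lemma baire_UNIV [simp]: "UNIV \<in> sets (baire :: (nat \<Rightarrow> 'a) measure)"
  using sets.top[of "baire :: (nat \<Rightarrow> 'a) measure"] by (simp add: space_PiM)

lemma baire_coordinate_sets: "{w. P (w n)} \<in> sets (baire :: (nat \<Rightarrow> 'a) measure)"
proof -
  have "(\<lambda>w. w n) -` Collect P \<inter> space (baire :: (nat \<Rightarrow> 'a) measure) \<in> sets baire"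
    by (rule measurable_sets[OF baire_coordinate_measurable]) simp
  then show ?thesis by (simp add: space_PiM vimage_def)
qed

text \<open>The union over \<open>a\<close> of the intersections over \<open>b\<close> of the
  separators is Borel because the indices are countable. Contrapositively, two inseparable unions
  have an inseparable pair of members.\<close>

lemma separated_UN:
  fixes X Y :: "'a::countable \<Rightarrow> (nat \<Rightarrow> nat) set"
  assumes "\<And>a b. separated (X a) (Y b)"
  shows "separated (\<Union>a. X a) (\<Union>b. Y b)"
proof -
  obtain B where B: "\<And>a b. B a b \<in> sets baire" "\<And>a b. X a \<subseteq> B a b" "\<And>a b. B a b \<inter> Y b = {}"
    using assms unfolding separated_def by metis
  have "(\<Union>a. \<Inter>b. B a b) \<in> sets baire"
    using B(1) by (intro sets.countable_UN'' sets.countable_INT'') auto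
  moreover have "(\<Union>a. X a) \<subseteq> (\<Union>a. \<Inter>b. B a b)" using B(2) by blast
  moreover have "(\<Union>a. \<Inter>b. B a b) \<inter> (\<Union>b. Y b) = {}" using B(3) by blast
  ultimately show ?thesis unfolding separated_def by blast
qed

text \<open>Inseparability of two pieces passes to sub-pieces on the next level, and so down to two branches
  of \<open>C\<close>, whose images are separated by a coordinate.\<close>

lemma separated_cyl:
  fixes C :: "(nat \<Rightarrow> 'a::countable) set" and e :: "'a \<Rightarrow> nat"
  assumes C: "tree_closed C" and inj: "inj_on (\<lambda>w n. e (w n)) C"
    and ne: "\<exists>i<m. w i \<noteq> w' i"
  shows "separated ((\<lambda>w n. e (w n)) ` cyl C w m) ((\<lambda>w n. e (w n)) ` cyl C w' m)" (is "separated (?p ` _) _")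
proof (rule ccontr)
  assume ns: "\<not> separated (?p ` cyl C w m) (?p ` cyl C w' m)"
  let ?P = "\<lambda>n x. \<not> separated (?p ` cyl C (fst x) (m + n)) (?p ` cyl C (snd x) (m + n)) \<and>
     (\<forall>i<m. fst x i = w i \<and> snd x i = w' i)"
  let ?Q = "\<lambda>n x y. \<forall>i<m + n. fst y i = fst x i \<and> snd y i = snd x i"
  have "\<exists>f. \<forall>n. ?P n (f n) \<and> ?Q n (f n) (f (Suc n))"
  proof (rule dependent_nat_choice)
    show "\<exists>x. ?P 0 x" by (rule exI[of _ "(w, w')"]) (use ns in simp)
    fix x n assume x: "?P n x"
    have 1: "cyl C v (m + n) = (\<Union>a. cyl C (v(m + n := a)) (m + Suc n))" for v :: "nat \<Rightarrow> 'a"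
      by (auto simp: cyl_def less_Suc_eq)
    have "\<exists>a b. \<not> separated (?p ` cyl C ((fst x)(m + n := a)) (m + Suc n))
                 (?p ` cyl C ((snd x)(m + n := b)) (m + Suc n))"
    proof (rule ccontr)
      assume "\<not> ?thesis"
      then have "separated (\<Union>a. ?p ` cyl C ((fst x)(m + n := a)) (m + Suc n))
                 (\<Union>b. ?p ` cyl C ((snd x)(m + n := b)) (m + Suc n))"
        by (intro separated_UN) blast
      then show False using x unfolding 1[of "fst x"] 1[of "snd x"] image_UN by blast
    qed
    then obtain a b where "\<not> separated (?p ` cyl C ((fst x)(m + n := a)) (m + Suc n))
                 (?p ` cyl C ((snd x)(m + n := b)) (m + Suc n))" by blast
    then show "\<exists>y. ?P (Suc n) y \<and> ?Q n x y"
      using x by (intro exI[of _ "((fst x)(m + n := a), (snd x)(m + n := b))"]) simp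
  qed
  then obtain f where P: "\<And>n. ?P n (f n)" and Q: "\<And>n. ?Q n (f n) (f (Suc n))" by blast
  have mono: "fst (f k) i = fst (f n) i \<and> snd (f k) i = snd (f n) i" if "n \<le> k" "i < m + n" for n k i
    using that(1) by (induction k rule: dec_induct) (use Q that(2) in auto)
  define W W' where "W = (\<lambda>i. fst (f (Suc i)) i)" and "W' = (\<lambda>i. snd (f (Suc i)) i)"
  have W: "W i = fst (f n) i" "W' i = snd (f n) i" if "i < m + n" for i n
    using mono[of n "max n (Suc i)" i] mono[of "Suc i" "max n (Suc i)" i] that
    by (auto simp: W_def W'_def)
  have cy: "cyl C W (m + n) = cyl C (fst (f n)) (m + n)" "cyl C W' (m + n) = cyl C (snd (f n)) (m + n)" for n
    using W by (auto simp: cyl_def)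
  have ns': "\<not> separated (?p ` cyl C W (m + n)) (?p ` cyl C W' (m + n))" for n
    using P[of n] cy by simp
  \<comment> \<open>The empty set is separated from everything, by \<open>{}\<close> on the left and
    by \<open>UNIV\<close> on the right; so inseparability keeps every cylinder inhabited.\<close>
  have nonempty: "cyl C W (m + n) \<noteq> {}" "cyl C W' (m + n) \<noteq> {}" for n
    using ns'[of n] baire_UNIV unfolding separated_def by auto
  have branch: "V \<in> C" if V: "\<And>n. cyl C V (m + n) \<noteq> {}" for V
  proof (rule tree_closedD[OF C])
    fix n
    obtain v where "v \<in> cyl C V (m + n)" using V[of n] by blast
    then show "\<exists>v\<in>C. \<forall>i<n. v i = V i" by (intro bexI[of _ v]) (auto simp: cyl_def)
  qed
  have "W \<in> C" "W' \<in> C" using branch nonempty by blast+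
  have "W \<noteq> W'" using ne W[of _ 0] P[of 0] by fastforce
  then have "?p W \<noteq> ?p W'" using inj \<open>W \<in> C\<close> \<open>W' \<in> C\<close> by (auto dest: inj_onD)
  then obtain k where k: "e (W k) \<noteq> e (W' k)" by blast
  \<comment> \<open>Coordinate \<open>k\<close> lies below \<open>m + Suc k\<close>, so it is
    constant on each of the two images.\<close>
  have "separated (?p ` cyl C W (m + Suc k)) (?p ` cyl C W' (m + Suc k))"
    unfolding separated_def
    by (rule bexI[OF _ baire_coordinate_sets[of "\<lambda>x. x = e (W k)" k]]) (use k in \<open>auto simp: cyl_def\<close>)
  with ns' show False by blast
qed

text \<open>By injectivity the images of cylinders over distinct words of equal length are
  separable, so each image can be enlarged to a Borel set \<open>D s\<close> with disjointness kept
  on every level. A point that lies in some \<open>D\<close> on every level then picks a single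
  branch, which turns the image into a countable intersection of countable unions.\<close>

lemma injective_image_tree:
  fixes C :: "(nat \<Rightarrow> 'a::countable) set" and e :: "'a \<Rightarrow> nat"
  assumes C: "tree_closed C" and inj: "inj_on (\<lambda>w n. e (w n)) C"
  shows "(\<lambda>w n. e (w n)) ` C \<in> sets baire"
proof -
  let ?p = "\<lambda>w n. e (w n)"
  let ?c = "\<lambda>s. cyl C (\<lambda>i. s ! i) (length s)"
  have "\<exists>B\<in>sets baire. ?p ` ?c s \<subseteq> B \<and> B \<inter> ?p ` ?c t = {}" if "length s = length t" "s \<noteq> t" for s t
    using separated_cyl[OF C inj, of "length s" "\<lambda>i. s ! i" "\<lambda>i. t ! i"] that
    by (auto simp: separated_def list_eq_iff_nth_eq)
  then obtain B where B: "\<And>s t. length s = length t \<Longrightarrow> s \<noteq> t \<Longrightarrow>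
      B s t \<in> sets baire \<and> ?p ` ?c s \<subseteq> B s t \<and> B s t \<inter> ?p ` ?c t = {}"
    by metis
  \<comment> \<open>Empty cylinders get \<open>{}\<close>, so that membership in \<open>D s\<close>
    guarantees a point of \<open>C\<close> with prefix \<open>s\<close>. The first factor fixes the
    coordinates of \<open>y\<close>; subtracting \<open>B t s\<close> makes the sets of one level
    disjoint.\<close>
  define D where "D s = (if ?c s = {} then {} else {y. \<forall>i<length s. y i = e (s ! i)} \<inter>
      (\<Inter>t\<in>{t. length t = length s \<and> t \<noteq> s}. B s t - B t s))" for s
  have D_sets: "D s \<in> sets baire" for s
  proof -
    have "{y. \<forall>i<length s. y i = e (s ! i)} \<in> sets baire"
    proof -
      have "{y \<in> space baire. \<forall>i<length s. y i = e (s ! i)} \<in> sets baire" by measurable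
      then show ?thesis by (simp add: space_PiM)
    qed
    moreover have "(\<Inter>t\<in>{t. length t = length s \<and> t \<noteq> s}. B s t - B t s) \<in> sets baire"
    \<comment> \<open>The empty word, for instance, is the only word of its length.\<close>
    proof (cases "{t. length t = length s \<and> t \<noteq> s} = {}")
      case True
      then have "(\<Inter>t\<in>{t. length t = length s \<and> t \<noteq> s}. B s t - B t s) = UNIV" by (simp only: INT_empty)
      then show ?thesis by simp
    next
      case False
      then show ?thesis by (intro sets.countable_INT') (use B in auto)
    qed
    ultimately show ?thesis by (auto simp: D_def)
  qed
  have D_sup: "?p w \<in> D s" if "w \<in> ?c s" for w s
  proof -
    have "?p w \<in> B s t - B t s" if "length t = length s" "t \<noteq> s" for t
    proof -
      have "?p w \<in> ?p ` ?c s" using \<open>w \<in> ?c s\<close> by (rule imageI)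
      moreover have "?p ` ?c s \<subseteq> B s t" "B t s \<inter> ?p ` ?c s = {}"
        using B[of s t] B[of t s] that by simp_all
      ultimately show ?thesis by (simp only: Diff_iff) (metis IntI empty_iff subsetD)
    qed
    moreover have "\<forall>i<length s. ?p w i = e (s ! i)" using that by (auto simp: cyl_def)
    moreover have "?c s \<noteq> {}" using that by blast
    ultimately show ?thesis by (simp add: D_def)
  qed
  have D_cyl: "?c s \<noteq> {}" "\<And>i. i < length s \<Longrightarrow> y i = e (s ! i)"
      "\<And>t. length t = length s \<Longrightarrow> t \<noteq> s \<Longrightarrow> y \<in> B s t - B t s" if "y \<in> D s" for s y
    using that by (simp_all add: D_def split: if_splits)
  have D_disj: "s = t" if "length s = length t" "y \<in> D s" "y \<in> D t" for s t y
  proof (rule ccontr)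
    assume "s \<noteq> t"
    then show False using D_cyl(3)[OF that(2), of t] D_cyl(3)[OF that(3), of s] that(1) by simp
  qed
  have eq: "?p ` C = (\<Inter>n. \<Union>s\<in>{s. length s = n}. \<Inter>k\<in>{..n}. D (take k s))" (is "_ = ?R")
  proof
    show "?p ` C \<subseteq> ?R"
    proof clarify
      fix w n assume "w \<in> C"
      have "?p w \<in> D (take k (map w [0..<n]))" if "k \<le> n" for k
        by (rule D_sup) (use \<open>w \<in> C\<close> that in \<open>auto simp: cyl_def\<close>)
      then show "?p w \<in> (\<Union>s\<in>{s. length s = n}. \<Inter>k\<in>{..n}. D (take k s))"
        by (intro UN_I[of "map w [0..<n]"]) auto
    qed
    show "?R \<subseteq> ?p ` C"
    proof
      fix y assume y: "y \<in> ?R"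
      then have y: "y \<in> (\<Union>s\<in>{s. length s = n}. \<Inter>k\<in>{..n}. D (take k s))" for n
        by (rule INT_D) simp
      have "\<forall>n. \<exists>s. length s = n \<and> (\<forall>k\<le>n. y \<in> D (take k s))"
      proof
        fix n show "\<exists>s. length s = n \<and> (\<forall>k\<le>n. y \<in> D (take k s))" using y[of n] by auto
      qed
      from choice[OF this] obtain s where s: "\<And>n. length (s n) = n" "\<And>n k. k \<le> n \<Longrightarrow> y \<in> D (take k (s n))" by blast
      \<comment> \<open>Disjointness on level \<open>k\<close> forces the words chosen for different
        \<open>n\<close> to be prefixes of one sequence.\<close>
      have take: "take k (s n) = s k" if "k \<le> n" for k n
        by (rule D_disj[of _ _ y]) (use s(1) s(2)[OF that] s(2)[of k k] that in simp_all)
      define w where "w i = s (Suc i) ! i" for i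
      have w: "s n ! i = w i" if "i < n" for i n
        using arg_cong[OF take[of "Suc i" n], of "\<lambda>x. x ! i"] that by (simp add: w_def)
      have y_in: "y \<in> D (s n)" for n using s(2)[of n n] s(1)[of n] by simp
      have "w \<in> C"
      proof (rule tree_closedD[OF C])
        fix n
        obtain v where "v \<in> ?c (s n)" using D_cyl(1)[OF y_in[of n]] by blast
        then show "\<exists>v\<in>C. \<forall>i<n. v i = w i" using w s(1) by (intro bexI[of _ v]) (auto simp: cyl_def)
      qed
      moreover have "y = ?p w"
      proof
        fix i show "y i = e (w i)"
          using D_cyl(2)[OF y_in[of "Suc i"], of i] s(1)[of "Suc i"] w[of i "Suc i"] by simp
      qed
      ultimately show "y \<in> ?p ` C" by (intro rev_image_eqI[of w C y ?p])
    qed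
  qed
  have "(\<Inter>k\<in>{..n}. D (take k s)) \<in> sets baire" for n s
    by (rule sets.finite_INT) (use D_sets in auto)
  then have "(\<Union>s\<in>{s. length s = n}. \<Inter>k\<in>{..n}. D (take k s)) \<in> sets baire" for n
    by (intro sets.countable_UN') auto
  then show ?thesis unfolding eq by (intro sets.countable_INT'') auto
qed

text \<open>Injective, rather than merely surjective, parametrizations of Borel sets by closed sets; disjoint unions
  and intersections preserve them, which is why complements are carried along in the induction.\<close>

definition pair_seq :: "(nat \<Rightarrow> 'a) \<Rightarrow> (nat \<Rightarrow> 'b) \<Rightarrow> nat \<Rightarrow> 'a \<times> 'b" where
  "pair_seq y z = (\<lambda>n. (y n, z n))"

locale parametrization =
  fixes C :: "(nat \<Rightarrow> 'a \<times> nat) set" and B :: "(nat \<Rightarrow> 'a) set"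
  assumes closed: "tree_closed C"
    and range: "pair_seq y z \<in> C \<Longrightarrow> y \<in> B"
    and ex: "y \<in> B \<Longrightarrow> \<exists>z. pair_seq y z \<in> C"
    and uniq: "pair_seq y z \<in> C \<Longrightarrow> pair_seq y z' \<in> C \<Longrightarrow> z = z'"

definition parametrized :: "(nat \<Rightarrow> 'a) set \<Rightarrow> bool" where
  "parametrized B \<longleftrightarrow> (\<exists>C. parametrization C B)"

lemma parametrizedI: "parametrization C B \<Longrightarrow> parametrized B"
  unfolding parametrized_def by blast

lemma (in parametrization) bij_betw_fst: "bij_betw (\<lambda>w n. fst (w n)) C B"
proof (rule bij_betw_imageI)
  show "inj_on (\<lambda>w n. fst (w n)) C"
  proof (rule inj_onI)
    fix v w assume vw: "v \<in> C" "w \<in> C" "(\<lambda>n. fst (v n)) = (\<lambda>n. fst (w n))"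
    have fst_eq: "fst (v n) = fst (w n)" for n using fun_cong[OF vw(3), of n] .
    have "pair_seq (\<lambda>n. fst (w n)) (\<lambda>n. snd (v n)) = v"
      by (simp add: pair_seq_def fst_eq[symmetric])
    then have *: "pair_seq (\<lambda>n. fst (w n)) (\<lambda>n. snd (v n)) \<in> C"
        "pair_seq (\<lambda>n. fst (w n)) (\<lambda>n. snd (w n)) \<in> C"
      using vw(1,2) by (simp_all add: pair_seq_def)
    have "(\<lambda>n. snd (v n)) = (\<lambda>n. snd (w n))" by (rule uniq[OF *])
    then show "v = w" using fst_eq by (auto simp: fun_eq_iff prod_eq_iff)
  qed
  show "(\<lambda>w n. fst (w n)) ` C = B"
  proof
    show "(\<lambda>w n. fst (w n)) ` C \<subseteq> B"
      using range[of "\<lambda>n. fst (w n)" "\<lambda>n. snd (w n)" for w] by (auto simp: pair_seq_def)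
    show "B \<subseteq> (\<lambda>w n. fst (w n)) ` C"
    proof
      fix y assume "y \<in> B"
      then obtain z where "pair_seq y z \<in> C" using ex by blast
      then show "y \<in> (\<lambda>w n. fst (w n)) ` C" by (rule rev_image_eqI) (simp add: pair_seq_def)
    qed
  qed
qed

lemma parametrized_coordinate: "parametrized {y. P (y n)}"
\<comment> \<open>The parameter is pinned to the zero sequence to make it unique.\<close>
proof (rule parametrizedI[OF parametrization.intro[where C = "{w. P (fst (w n)) \<and> (\<forall>i. snd (w i) = 0)}"]])
  show "tree_closed {w :: nat \<Rightarrow> 'a \<times> nat. P (fst (w n)) \<and> (\<forall>i. snd (w i) = 0)}"
    unfolding tree_closed_def
  proof (intro allI impI)
    fix w :: "nat \<Rightarrow> 'a \<times> nat"
    assume *: "\<forall>m. \<exists>v\<in>{w. P (fst (w n)) \<and> (\<forall>i. snd (w i) = 0)}. \<forall>i<m. v i = w i"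
    have "P (fst (w n))" using *[rule_format, of "Suc n"] by auto
    moreover have "snd (w i) = 0" for i
    proof -
      obtain v where "v \<in> {w. P (fst (w n)) \<and> (\<forall>i. snd (w i) = 0)}" "\<forall>j<Suc i. v j = w j"
        using *[rule_format, of "Suc i"] by blast
      then show ?thesis by (metis (mono_tags, lifting) lessI mem_Collect_eq)
    qed
    ultimately show "w \<in> {w. P (fst (w n)) \<and> (\<forall>i. snd (w i) = 0)}" by simp
  qed
  fix y assume "y \<in> {y. P (y n)}"
  then show "\<exists>z. pair_seq y z \<in> {w. P (fst (w n)) \<and> (\<forall>i. snd (w i) = 0)}"
    by (intro exI[of _ "\<lambda>_. 0"]) (auto simp: pair_seq_def)
qed (auto simp: pair_seq_def)

text \<open>A single parameter sequence stores countably many: the \<open>k\<close>-th one sits at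
  the positions \<open>prod_encode (k, n)\<close>. Since \<open>prod_encode\<close> is a bijection,
  no position is left free and uniqueness survives.\<close>

lemma parametrized_INT:
  fixes B :: "nat \<Rightarrow> (nat \<Rightarrow> 'a) set"
  assumes "\<And>k. parametrized (B k)"
  shows "parametrized (\<Inter>k. B k)"
proof -
  have "\<forall>k. \<exists>C. parametrization C (B k)"
    using assms unfolding parametrized_def by blast
  from choice[OF this] obtain C where "\<And>k. parametrization (C k) (B k)" by blast
  note C = parametrization.closed[OF this] parametrization.range[OF this]
    parametrization.ex[OF this] parametrization.uniq[OF this]
  define D where "D = {w. \<forall>k. pair_seq (\<lambda>n. fst (w n)) (\<lambda>n. snd (w (prod_encode (k, n)))) \<in> C k}"
  show ?thesis
  proof (rule parametrizedI[OF parametrization.intro[of D]])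
    show "tree_closed D" unfolding tree_closed_def
    proof (intro allI impI)
      fix w assume *: "\<forall>n. \<exists>v\<in>D. \<forall>i<n. v i = w i"
      have "pair_seq (\<lambda>n. fst (w n)) (\<lambda>n. snd (w (prod_encode (k, n)))) \<in> C k" for k
      proof (rule tree_closedD[OF C(1)])
        fix n
        \<comment> \<open>The prefix must reach all positions \<open>prod_encode (k, i)\<close> with
          \<open>i < n\<close>; the sum is a crude common bound.\<close>
        obtain v where v: "v \<in> D" "\<forall>i<n + (\<Sum>i<n. Suc (prod_encode (k, i))). v i = w i" using * by blast
        moreover have "prod_encode (k, i) < n + (\<Sum>i<n. Suc (prod_encode (k, i)))" if "i < n" for i
          using member_le_sum[of i "{..<n}" "\<lambda>i. Suc (prod_encode (k, i))"] that by auto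
        ultimately show "\<exists>u\<in>C k. \<forall>i<n. u i = pair_seq (\<lambda>n. fst (w n)) (\<lambda>n. snd (w (prod_encode (k, n)))) i"
          by (intro bexI[of _ "pair_seq (\<lambda>n. fst (v n)) (\<lambda>n. snd (v (prod_encode (k, n))))"])
              (auto simp: D_def pair_seq_def)
      qed
      then show "w \<in> D" by (simp add: D_def)
    qed
  next
    fix y z assume "pair_seq y z \<in> D"
    then have "pair_seq y (\<lambda>n. z (prod_encode (k, n))) \<in> C k" for k
      by (simp add: D_def) (simp add: pair_seq_def)
    then show "y \<in> (\<Inter>k. B k)" using C(2) by blast
  next
    fix y assume "y \<in> (\<Inter>k. B k)"
    then have "\<forall>k. \<exists>z. pair_seq y z \<in> C k" using C(3) by blast
    from choice[OF this] obtain z where z: "\<And>k. pair_seq y (z k) \<in> C k" by blast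
    show "\<exists>z. pair_seq y z \<in> D"
      by (rule exI[of _ "\<lambda>n. z (fst (prod_decode n)) (snd (prod_decode n))"]) (use z in \<open>simp add: D_def pair_seq_def\<close>)
  next
    fix y z z' assume "pair_seq y z \<in> D" "pair_seq y z' \<in> D"
    then have "pair_seq y (\<lambda>n. z (prod_encode (k, n))) \<in> C k" "pair_seq y (\<lambda>n. z' (prod_encode (k, n))) \<in> C k" for k
      by (simp_all add: D_def) (simp_all add: pair_seq_def)
    from C(4)[OF this] have *: "z (prod_encode (k, i)) = z' (prod_encode (k, i))" for k i by (rule fun_cong)
    show "z = z'"
    proof
      fix n show "z n = z' n" using *[of "fst (prod_decode n)" "snd (prod_decode n)"] by simp
    qed
  qed
qed

text \<open>Every entry of the parameter also carries the index \<open>k\<close> of the piece.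
  Disjointness makes this index, and with it the whole parameter, unique.\<close>

lemma parametrized_UN:
  fixes B :: "nat \<Rightarrow> (nat \<Rightarrow> 'a) set"
  assumes "\<And>k. parametrized (B k)" and disj: "disjoint_family B"
  shows "parametrized (\<Union>k. B k)"
proof -
  have "\<forall>k. \<exists>C. parametrization C (B k)"
    using assms(1) unfolding parametrized_def by blast
  from choice[OF this] obtain C where "\<And>k. parametrization (C k) (B k)" by blast
  note C = parametrization.closed[OF this] parametrization.range[OF this]
    parametrization.ex[OF this] parametrization.uniq[OF this]
  define D where "D = {w. \<exists>k. \<exists>v\<in>C k. \<forall>n. w n = (fst (v n), prod_encode (k, snd (v n)))}"
  have D_E: "\<exists>k u. pair_seq y u \<in> C k \<and> (\<forall>n. z n = prod_encode (k, u n))"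
    if D: "pair_seq y z \<in> D" for y z
  proof -
    obtain k v where v: "v \<in> C k" "\<And>n. y n = fst (v n)" "\<And>n. z n = prod_encode (k, snd (v n))"
      using D by (auto simp: D_def pair_seq_def)
    have "pair_seq y (\<lambda>n. snd (v n)) = v" using v(2) by (simp add: pair_seq_def)
    then have "pair_seq y (\<lambda>n. snd (v n)) \<in> C k" using v(1) by simp
    with v(3) show ?thesis by blast
  qed
  show ?thesis
  proof (rule parametrizedI[OF parametrization.intro[of D]])
    show "tree_closed D" unfolding tree_closed_def
    proof (intro allI impI)
      fix w :: "nat \<Rightarrow> 'a \<times> nat" assume *: "\<forall>n. \<exists>v\<in>D. \<forall>i<n. v i = w i"
      \<comment> \<open>The index is constant along each member of \<open>D\<close>, so it can be
        read off at position 0; this is why prefixes of length \<open>Suc n\<close> are used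
        below.\<close>
      define k where "k = fst (prod_decode (snd (w 0)))"
      have v: "\<exists>v\<in>C k. \<forall>i<n. w i = (fst (v i), prod_encode (k, snd (v i)))" for n
      proof -
        obtain x where x: "x \<in> D" "\<forall>i<Suc n. x i = w i" using *[rule_format, of "Suc n"] by blast
        then obtain l v where v: "v \<in> C l" "\<forall>n. x n = (fst (v n), prod_encode (l, snd (v n)))"
          unfolding D_def by blast
        have w: "w i = (fst (v i), prod_encode (l, snd (v i)))" if "i < Suc n" for i
          using x(2)[rule_format, OF that] v(2)[rule_format, of i] by simp
        have "l = k" using w[of 0] by (simp add: k_def)
        then show ?thesis using v(1) w by (intro bexI[of _ v]) simp_all
      qed
      define u where "u n = (fst (w n), snd (prod_decode (snd (w n))))" for n
      have "u \<in> C k"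
      proof (rule tree_closedD[OF C(1)])
        fix n
        obtain v where "v \<in> C k" "\<forall>i<n. w i = (fst (v i), prod_encode (k, snd (v i)))" using v by blast
        then show "\<exists>v\<in>C k. \<forall>i<n. v i = u i" by (intro bexI[of _ v]) (auto simp: u_def)
      qed
      moreover have "w n = (fst (u n), prod_encode (k, snd (u n)))" for n
      proof -
        obtain v where "\<forall>i<Suc n. w i = (fst (v i), prod_encode (k, snd (v i)))" using v by blast
        then show ?thesis by (simp add: u_def)
      qed
      ultimately show "w \<in> D" unfolding D_def by blast
    qed
  next
    fix y z assume "pair_seq y z \<in> D"
    then obtain k u where "pair_seq y u \<in> C k" using D_E[of y z] by blast
    then show "y \<in> (\<Union>k. B k)" using C(2) by blast
  next
    fix y assume "y \<in> (\<Union>k. B k)"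
    then obtain k z where z: "pair_seq y z \<in> C k" using C(3) by blast
    have "pair_seq y (\<lambda>n. prod_encode (k, z n)) \<in> D"
      unfolding D_def by (rule CollectI, intro exI[of _ k] bexI[OF _ z]) (simp add: pair_seq_def)
    then show "\<exists>z. pair_seq y z \<in> D" by (rule exI[of _ "\<lambda>n. prod_encode (k, z n)"])
  next
    fix y z z' assume "pair_seq y z \<in> D" "pair_seq y z' \<in> D"
    then obtain k u k' u' where u: "pair_seq y u \<in> C k" "\<forall>n. z n = prod_encode (k, u n)"
      and u': "pair_seq y u' \<in> C k'" "\<forall>n. z' n = prod_encode (k', u' n)"
      using D_E[of y z] D_E[of y z'] by blast
    have "k = k'" using C(2)[OF u(1)] C(2)[OF u'(1)] disj by (auto simp: disjoint_family_on_def)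
    moreover from this have "u = u'" using C(4)[OF u(1)] u'(1) by simp
    ultimately show "z = z'" using u(2) u'(2) by (simp add: fun_eq_iff)
  qed
qed

lemma parametrized_baire:
  assumes "B \<in> sets (baire :: (nat \<Rightarrow> 'a) measure)"
  shows "parametrized B"
proof -
  let ?gen = "{{f \<in> UNIV \<rightarrow>\<^sub>E UNIV. f i \<in> A} | i A. True} :: (nat \<Rightarrow> 'a) set set"
  have "B \<in> sigma_sets UNIV ?gen" using assms by (simp add: sets_PiM_single)
  then have "parametrized B \<and> parametrized (- B)"
  proof induction
    case (Basic a)
    then obtain i A where a: "a = {f. f i \<in> A}" by auto
    then have "- a = {f. \<not> f i \<in> A}" by auto
    with a show ?case
      using parametrized_coordinate[of "\<lambda>x. x \<in> A" i]
        parametrized_coordinate[of "\<lambda>x. \<not> x \<in> A" i] by simp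
  next
    case Empty
    then show ?case
      using parametrized_coordinate[of "\<lambda>x. True" 0]
        parametrized_coordinate[of "\<lambda>x. False" 0] by simp
  next
    case (Compl a)
    then show ?case by (simp add: Compl_eq_Diff_UNIV[symmetric])
  next
    case (Union a)
    \<comment> \<open>Disjointification written as a countable intersection; the complements in it
      come from the induction hypothesis.\<close>
    define E where "E n k = (if k < n then - a k else a n)" for n k
    have "disjointed a n = (\<Inter>k. E n k)" for n
    proof
      show "disjointed a n \<subseteq> (\<Inter>k. E n k)" by (auto simp: disjointed_def E_def)
      show "(\<Inter>k. E n k) \<subseteq> disjointed a n"
      proof
        fix x assume "x \<in> (\<Inter>k. E n k)"
        then have x: "x \<in> E n k" for k by blast
        have "x \<notin> a k" if "k < n" for k using x[of k] that by (simp add: E_def)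
        moreover have "x \<in> a n" using x[of n] by (simp add: E_def)
        ultimately show "x \<in> disjointed a n" by (auto simp: disjointed_def)
      qed
    qed
    moreover have "parametrized (\<Inter>k. E n k)" for n
      by (rule parametrized_INT) (use Union in \<open>simp add: E_def\<close>)
    ultimately have "parametrized (\<Union>n. disjointed a n)"
      by (intro parametrized_UN disjoint_family_disjointed) simp
    moreover have "parametrized (\<Inter>n. - a n)"
      by (rule parametrized_INT) (use Union in simp)
    ultimately show ?case by (simp add: UN_disjointed_eq)
  qed
  then show ?thesis by simp
qed

text \<open>Replacing \<open>\<Gamma>\<close> by the closed set of its uniquely parametrized points
  keeps the projection injective, so the case of closed sets applies with
  \<open>fst \<circ> fst\<close>.\<close>

lemma injective_projection_baire:
  fixes \<Gamma> :: "(nat \<Rightarrow> nat \<times> nat) set"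
  assumes "\<Gamma> \<in> sets baire" and inj: "inj_on (\<lambda>w n. fst (w n)) \<Gamma>"
  shows "(\<lambda>w n. fst (w n)) ` \<Gamma> \<in> sets baire"
proof -
  obtain C where "parametrization C \<Gamma>"
    using parametrized_baire[OF assms(1)] unfolding parametrized_def by blast
  note C = parametrization.closed[OF this] parametrization.bij_betw_fst[OF this]
  have im: "\<Gamma> = (\<lambda>w n. fst (w n)) ` C" using C(2) by (simp add: bij_betw_def)
  have "inj_on ((\<lambda>w n. fst (w n)) \<circ> (\<lambda>w n. fst (w n))) C"
    by (rule comp_inj_on) (use C(2) inj im in \<open>auto simp: bij_betw_def\<close>)
  then have "inj_on (\<lambda>w n. (fst \<circ> fst) (w n)) C" by (simp add: comp_def)
  from injective_image_tree[OF C(1) this] show ?thesis by (simp add: im image_image comp_def)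
qed

section \<open>Standard Borel spaces as retracts of sequence space\<close>

lemma baire_measurable_iff:
  "f \<in> M \<rightarrow>\<^sub>M (baire :: (nat \<Rightarrow> 'a) measure) \<longleftrightarrow> (\<forall>n. (\<lambda>x. f x n) \<in> M \<rightarrow>\<^sub>M count_space UNIV)"
proof
  assume f: "f \<in> M \<rightarrow>\<^sub>M baire"
  show "\<forall>n. (\<lambda>x. f x n) \<in> M \<rightarrow>\<^sub>M count_space UNIV"
    using measurable_compose[OF f baire_coordinate_measurable] by blast
qed (auto intro!: measurable_PiM_single')

lemma measurable_pred2_countable:
  fixes f :: "'a \<Rightarrow> 'b::countable" and g :: "'a \<Rightarrow> 'c::countable"
  assumes [measurable]: "f \<in> M \<rightarrow>\<^sub>M count_space UNIV" "g \<in> M \<rightarrow>\<^sub>M count_space UNIV"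
  shows "Measurable.pred M (\<lambda>x. P (f x) (g x))"
proof -
  have "(\<lambda>x. P (f x) (g x)) = (\<lambda>x. \<exists>k l. f x = k \<and> g x = l \<and> P k l)" by blast
  also have "Measurable.pred M \<dots>" by measurable
  finally show ?thesis .
qed

lemma inverse_power2_less: "0 < (r::real) \<Longrightarrow> \<exists>n. C * inverse (2 ^ n) < r"
proof -
  assume "0 < r"
  have "((\<lambda>n. C * inverse (2 ^ n)) \<longlonglongrightarrow> C * 0)"
    by (intro tendsto_mult tendsto_const LIMSEQ_inverse_realpow_zero) simp
  then have "eventually (\<lambda>n. C * inverse (2 ^ n) < r) sequentially"
    using \<open>0 < r\<close> by (intro order_tendstoD) simp_all
  then show ?thesis by (auto simp: eventually_sequentially)
qed

text \<open>A point is coded by the centres of balls of radius \<open>1 / 2 ^ n\<close> around it, and decoded as the limit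
  of these centres.\<close>

lemma standard_borel_retract:
  assumes X: "standard_borel X" and ne: "space X \<noteq> {}"
  obtains c :: "'a \<Rightarrow> nat \<Rightarrow> nat" and g :: "(nat \<Rightarrow> nat) \<Rightarrow> 'a"
  where "c \<in> X \<rightarrow>\<^sub>M baire" "g \<in> baire \<rightarrow>\<^sub>M X" "\<And>x. x \<in> space X \<Longrightarrow> g (c x) = x"
proof -
  obtain T where T: "completely_metrizable_space T" "second_countable T" "topspace T = space X"
    "sets X = sigma_sets (space X) {U. openin T U}"
    using X unfolding standard_borel_def by blast
  then obtain M d where Md: "Metric_space M d" "Metric_space.mcomplete M d" "T = Metric_space.mtopology M d"
    unfolding completely_metrizable_space_def by blast
  interpret Metric_space M d by fact
  have M: "M = space X" using T(3) Md(3) by simp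
  obtain S where S: "countable S" "S \<subseteq> M" "T closure_of S = M"
    using second_countable_imp_separable_space[OF T(2)] T(3) M unfolding separable_space_def by auto
  have "S \<noteq> {}" using S(3) ne M by auto
  then obtain a :: "nat \<Rightarrow> 'a" where a: "range a = S" using S(1) by (metis range_from_nat_into)
  have aM: "a k \<in> M" for k using a S(2) by blast
  have dense: "\<exists>k. d (a k) x < r" if "x \<in> M" "0 < r" for x r
  proof -
    have "x \<in> T closure_of S" using S(3) that by simp
    then have "\<exists>y\<in>S. y \<in> mball x r"
      unfolding Md(3) metric_closure_of using that by blast
    then show ?thesis using a by (auto simp: commute)
  qed
  define c where "c x n = (LEAST k. d (a k) x < inverse (2 ^ n))" for x and n :: nat
  have c: "d (a (c x n)) x < inverse (2 ^ n)" if "x \<in> M" for x n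
    unfolding c_def by (rule LeastI_ex) (use dense[OF that] in simp)
  \<comment> \<open>Codes whose balls are pairwise compatible: their centres form a Cauchy sequence,
    and the condition involves countably many coordinates with countably many values, so
    \<open>K\<close> is Borel.\<close>
  define K where "K = {u :: nat \<Rightarrow> nat. \<forall>n m. d (a (u n)) (a (u m)) < inverse (2 ^ n) + inverse (2 ^ m)}"
  have lim: "\<exists>x\<in>M. \<forall>n. d (a (u n)) x \<le> inverse (2 ^ n)" if u: "u \<in> K" for u
  proof -
    have "MCauchy (\<lambda>n. a (u n))"
      unfolding MCauchy_def
    proof (intro conjI allI impI)
      fix e :: real assume "0 < e"
      then obtain N where N: "2 * inverse (2 ^ N) < e" using inverse_power2_less by blast
      have "d (a (u n)) (a (u m)) < e" if "N \<le> n" "N \<le> m" for n m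
      proof -
        have "inverse (2 ^ n) \<le> (inverse (2 ^ N) :: real)" "inverse (2 ^ m) \<le> (inverse (2 ^ N) :: real)"
          using that by (simp_all add: le_imp_inverse_le power_increasing)
        moreover have "d (a (u n)) (a (u m)) < inverse (2 ^ n) + inverse (2 ^ m)"
          using u by (simp add: K_def)
        ultimately show ?thesis using N by linarith
      qed
      then show "\<exists>N. \<forall>n n'. N \<le> n \<longrightarrow> N \<le> n' \<longrightarrow> d (a (u n)) (a (u n')) < e" by blast
    qed (use aM in auto)
    then obtain x where x: "limitin mtopology (\<lambda>n. a (u n)) x sequentially"
      using Md(2) unfolding mcomplete_def by blast
    then have xM: "x \<in> M" by (simp add: limitin_metric)
    have "d (a (u n)) x \<le> inverse (2 ^ n)" for n
    proof (rule field_le_epsilon)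
      fix e :: real assume "0 < e"
      then obtain N where N: "1 * inverse (2 ^ N) < e / 2" using inverse_power2_less[of "e / 2" 1] by auto
      have "eventually (\<lambda>m. d (a (u m)) x < e / 2) sequentially"
        using x \<open>0 < e\<close> unfolding limitin_metric
        by (auto elim!: allE[of _ "e / 2"] eventually_mono simp: commute)
      then obtain m where m: "m \<ge> N" "d (a (u m)) x < e / 2"
        unfolding eventually_sequentially by (metis nle_le)
      have "inverse (2 ^ m) \<le> (inverse (2 ^ N) :: real)"
        using m(1) by (simp add: le_imp_inverse_le power_increasing)
      moreover have "d (a (u n)) x \<le> d (a (u n)) (a (u m)) + d (a (u m)) x"
        by (intro triangle aM xM)
      moreover have "d (a (u n)) (a (u m)) < inverse (2 ^ n) + inverse (2 ^ m)"
        using u by (simp add: K_def)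
      ultimately show "d (a (u n)) x \<le> inverse (2 ^ n) + e" using N m(2) by linarith
    qed
    with xM show ?thesis by blast
  qed
  define g where "g u = (if u \<in> K then SOME x. x \<in> M \<and> (\<forall>n. d (a (u n)) x \<le> inverse (2 ^ n)) else a 0)" for u
  have g: "g u \<in> M" "d (a (u n)) (g u) \<le> inverse (2 ^ n)" if "u \<in> K" for u n
    using someI_ex[OF lim[OF that, unfolded Bex_def]] that by (simp_all add: g_def)
  have gM: "g u \<in> M" for u using g aM by (cases "u \<in> K") (auto simp: g_def)
  have cK: "c x \<in> K" if x: "x \<in> M" for x
    unfolding K_def
  proof safe
    fix n m
    have "d (a (c x n)) (a (c x m)) \<le> d (a (c x n)) x + d x (a (c x m))" by (intro triangle aM x)
    also have "d x (a (c x m)) = d (a (c x m)) x" by (rule commute)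
    finally show "d (a (c x n)) (a (c x m)) < inverse (2 ^ n) + inverse (2 ^ m)"
      using c[OF x, of n] c[OF x, of m] by simp
  qed
  have gc: "g (c x) = x" if x: "x \<in> M" for x
  proof (rule ccontr)
    assume "g (c x) \<noteq> x"
    then have "0 < d (g (c x)) x" using x gM by (simp add: mdist_pos_less)
    then obtain n where n: "2 * inverse (2 ^ n) < d (g (c x)) x" using inverse_power2_less by blast
    have "d (g (c x)) x \<le> d (g (c x)) (a (c x n)) + d (a (c x n)) x" by (intro triangle aM x gM)
    also have "d (g (c x)) (a (c x n)) = d (a (c x n)) (g (c x))" by (rule commute)
    finally show False using c[OF x, of n] g(2)[OF cK[OF x], of n] n by linarith
  qed
  have cm: "c \<in> X \<rightarrow>\<^sub>M baire"
    unfolding baire_measurable_iff c_def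
  proof (intro allI measurable_Least)
    fix n k
    have "mball (a k) (inverse (2 ^ n)) \<in> sets X"
      unfolding T(4) Md(3) by (rule sigma_sets.Basic) simp
    also have "mball (a k) (inverse (2 ^ n)) = {x \<in> space X. d (a k) x < inverse (2 ^ n)}"
      using aM[of k] by (auto simp flip: M)
    finally show "Measurable.pred X (\<lambda>x. d (a k) x < inverse (2 ^ n))" by (simp add: pred_def)
  qed
  have K_sets: "Measurable.pred baire (\<lambda>u. u \<in> K)"
    unfolding K_def mem_Collect_eq
    by (intro pred_intros_countable(1)
        measurable_pred2_countable[where f = "\<lambda>u. u n" and g = "\<lambda>u. u m" and
          P = "\<lambda>k l. d (a k) (a l) < inverse (2 ^ n) + inverse (2 ^ m)" for n m]
        baire_coordinate_measurable)
  have gm: "g \<in> baire \<rightarrow>\<^sub>M X"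
  proof (rule measurable_sigma_sets[OF T(4)])
    show "{U. openin T U} \<subseteq> Pow (space X)" using openin_subset T(3) by auto
    show "g \<in> space baire \<rightarrow> space X" using gM M by auto
    fix U assume "U \<in> {U. openin T U}"
    then have U: "U \<subseteq> M" "\<And>x. x \<in> U \<Longrightarrow> \<exists>r>0. mball x r \<subseteq> U"
      unfolding Md(3) by (auto simp: openin_mtopology)
    \<comment> \<open>The distance to the limit is bounded only by \<open>\<le>\<close>, hence the
      doubled radius. Conversely, a ball of radius \<open>r\<close> around the limit contains such a
      ball once three times \<open>inverse (2 ^ n)\<close> is below \<open>r\<close>: one for the
      distance of the centre, two for the radius.\<close>
    have "g u \<in> U \<longleftrightarrow> (if u \<in> K then \<exists>n. mball (a (u n)) (2 * inverse (2 ^ n)) \<subseteq> U else a 0 \<in> U)" for u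
    proof (cases "u \<in> K")
      case True
      have "g u \<in> U" if "mball (a (u n)) (2 * inverse (2 ^ n)) \<subseteq> U" for n
      proof -
        have "(0::real) < inverse (2 ^ n)" by simp
        then have "d (a (u n)) (g u) < 2 * inverse (2 ^ n)" using g(2)[OF True, of n] by linarith
        then show ?thesis using aM gM that by auto
      qed
      moreover have "\<exists>n. mball (a (u n)) (2 * inverse (2 ^ n)) \<subseteq> U" if gu: "g u \<in> U"
      proof -
        obtain r where r: "0 < r" "mball (g u) r \<subseteq> U" using U(2)[OF gu] by blast
        then obtain n where n: "3 * inverse (2 ^ n) < r" using inverse_power2_less by blast
        have "mball (a (u n)) (2 * inverse (2 ^ n)) \<subseteq> mball (g u) r"
        proof
          fix y assume y: "y \<in> mball (a (u n)) (2 * inverse (2 ^ n))"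
          then have "d (g u) y \<le> d (g u) (a (u n)) + d (a (u n)) y" by (intro triangle aM gM) simp
          also have "d (g u) (a (u n)) = d (a (u n)) (g u)" by (rule commute)
          finally show "y \<in> mball (g u) r" using y n g(2)[OF True, of n] gM by auto
        qed
        then show ?thesis using r(2) by blast
      qed
      ultimately show ?thesis using True by auto
    qed (simp add: g_def)
    then have "g -` U \<inter> space baire =
       {u \<in> space baire. if u \<in> K then \<exists>n. mball (a (u n)) (2 * inverse (2 ^ n)) \<subseteq> U else a 0 \<in> U}"
      by (intro set_eqI) (simp only: Int_iff vimage_eq mem_Collect_eq conj_commute)
    also have "\<dots> \<in> sets baire"
    proof -
      have [measurable]: "Measurable.pred baire (\<lambda>u. mball (a (u n)) (2 * inverse (2 ^ n)) \<subseteq> U)" for n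
        by (rule measurable_compose[OF baire_coordinate_measurable]) simp
      note K_sets [measurable]
      show ?thesis by measurable
    qed
    finally show "g -` U \<inter> space baire \<in> sets baire" .
  qed
  show thesis using that[OF cm gm] gc M by blast
qed

text \<open>In coded form the graph of \<open>f\<close> on \<open>A\<close> is a Borel set of pairs
  of sequences. Injectivity of \<open>f\<close> makes its projection to the codes of
  \<open>Y\<close> injective, and the image of \<open>A\<close> is the preimage of that projection
  under \<open>c'\<close>.\<close>

theorem injective_image_standard_borel:
  fixes X :: "'a measure" and Y :: "'b measure"
  assumes X: "standard_borel X" and Y: "standard_borel Y" and f [measurable]: "f \<in> X \<rightarrow>\<^sub>M Y"
    and A [measurable]: "A \<in> sets X" and inj: "inj_on f A"
  shows "f ` A \<in> sets Y"
proof (cases "space X = {}")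
  case True
  then show ?thesis using sets.sets_into_space[OF A] by simp
next
  case False
  obtain c :: "'a \<Rightarrow> nat \<Rightarrow> nat" and g :: "(nat \<Rightarrow> nat) \<Rightarrow> 'a" where c [measurable]: "c \<in> X \<rightarrow>\<^sub>M baire" and g [measurable]: "g \<in> baire \<rightarrow>\<^sub>M X"
    and gc: "\<And>x. x \<in> space X \<Longrightarrow> g (c x) = x"
    by (rule standard_borel_retract[OF X False]) (rule that)
  have Y_ne: "space Y \<noteq> {}" using measurable_space[OF f] False by blast
  obtain c' :: "'b \<Rightarrow> nat \<Rightarrow> nat" and g' :: "(nat \<Rightarrow> nat) \<Rightarrow> 'b" where c' [measurable]: "c' \<in> Y \<rightarrow>\<^sub>M baire"
    and g' [measurable]: "g' \<in> baire \<rightarrow>\<^sub>M Y" and gc': "\<And>y. y \<in> space Y \<Longrightarrow> g' (c' y) = y"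
    by (rule standard_borel_retract[OF Y Y_ne]) (rule that)
  have AX: "A \<subseteq> space X" using sets.sets_into_space[OF A] .
  let ?u = "\<lambda>w n. snd (w n :: nat \<times> nat)" and ?v = "\<lambda>w n. fst (w n :: nat \<times> nat)"
  \<comment> \<open>The condition that \<open>c (g u)\<close> equals \<open>u\<close> keeps only
    genuine codes, one for each point; without it several codes of one point could spoil injectivity
    of the projection.\<close>
  define \<Gamma> where "\<Gamma> = {w. c (g (?u w)) = ?u w \<and> g (?u w) \<in> A \<and> c' (f (g (?u w))) = ?v w}"
  have coord: "(\<lambda>w. fst (w n)) \<in> baire \<rightarrow>\<^sub>M count_space UNIV" "(\<lambda>w. snd (w n)) \<in> baire \<rightarrow>\<^sub>M count_space UNIV"
    for n and w :: "nat \<Rightarrow> nat \<times> nat"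
    by (rule measurable_compose[OF baire_coordinate_measurable]; simp)+
  have u [measurable]: "?u \<in> baire \<rightarrow>\<^sub>M baire" and v [measurable]: "?v \<in> baire \<rightarrow>\<^sub>M baire"
    by (simp_all add: baire_measurable_iff coord)
  have eq: "Measurable.pred baire (\<lambda>w :: nat \<Rightarrow> nat \<times> nat. p w = (q w :: nat \<Rightarrow> nat))"
    if "p \<in> baire \<rightarrow>\<^sub>M baire" "q \<in> baire \<rightarrow>\<^sub>M baire" for p q
  proof -
    have "Measurable.pred baire (\<lambda>w. p w n = q w n)" for n
      using that unfolding baire_measurable_iff
      by (intro measurable_pred2_countable[where P = "(=)"]) blast+
    then show ?thesis unfolding fun_eq_iff by (rule pred_intros_countable(1))
  qed
  have "Measurable.pred baire (\<lambda>w. c (g (?u w)) = ?u w)" by (rule eq) measurable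
  moreover have "Measurable.pred baire (\<lambda>w. c' (f (g (?u w))) = ?v w)" by (rule eq) measurable
  moreover have "Measurable.pred baire (\<lambda>w. g (?u w) \<in> A)" by measurable
  ultimately have "Measurable.pred baire
      (\<lambda>w. c (g (?u w)) = ?u w \<and> g (?u w) \<in> A \<and> c' (f (g (?u w))) = ?v w)"
    by (intro pred_intros_logic)
  then have \<Gamma>: "\<Gamma> \<in> sets baire" by (simp add: pred_def \<Gamma>_def space_PiM)
  have "inj_on ?v \<Gamma>"
  proof (rule inj_onI)
    fix w w' assume w: "w \<in> \<Gamma>" "w' \<in> \<Gamma>" "?v w = ?v w'"
    then have "c' (f (g (?u w))) = c' (f (g (?u w')))" by (simp add: \<Gamma>_def)
    moreover have A: "g (?u w) \<in> A" "g (?u w') \<in> A" using w by (simp_all add: \<Gamma>_def)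
    then have "f (g (?u w)) \<in> space Y" "f (g (?u w')) \<in> space Y"
      using AX measurable_space[OF f] by blast+
    ultimately have "f (g (?u w)) = f (g (?u w'))" using gc' by metis
    then have "g (?u w) = g (?u w')" using A inj by (auto dest: inj_onD)
    then have "?u w = ?u w'" using w by (simp add: \<Gamma>_def)
    with w(3) show "w = w'" by (simp add: fun_eq_iff prod_eq_iff)
  qed
  from injective_projection_baire[OF \<Gamma> this]
  have *: "c' -` (?v ` \<Gamma>) \<inter> space Y \<in> sets Y" by (rule measurable_sets[OF c'])
  have "f ` A = c' -` (?v ` \<Gamma>) \<inter> space Y"
  proof (intro equalityI subsetI)
    fix y assume "y \<in> f ` A"
    then obtain x where x: "x \<in> A" "y = f x" by blast
    have "pair_seq (c' y) (c x) \<in> \<Gamma>"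
      using x gc AX by (auto simp: \<Gamma>_def pair_seq_def)
    moreover have "c' y = ?v (pair_seq (c' y) (c x))" by (simp add: pair_seq_def)
    moreover have "y \<in> space Y" using x AX measurable_space[OF f] by blast
    ultimately show "y \<in> c' -` (?v ` \<Gamma>) \<inter> space Y" by blast
  next
    fix y assume "y \<in> c' -` (?v ` \<Gamma>) \<inter> space Y"
    then obtain w where w: "w \<in> \<Gamma>" "c' y = ?v w" "y \<in> space Y" by blast
    then have gA: "g (?u w) \<in> A" and "c' (f (g (?u w))) = c' y" by (simp_all add: \<Gamma>_def)
    moreover from gA have "f (g (?u w)) \<in> space Y" using AX measurable_space[OF f] by blast
    ultimately have "f (g (?u w)) = y" using gc' w(3) by metis
    then show "y \<in> f ` A" using gA by blast
  qed
  with * show ?thesis by simp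
qed

section \<open>Bisections and their action\<close>

context measurable_groupoid
begin

lemma units_measurable_sets: "A \<in> sets (unit_space H) \<longleftrightarrow> A \<in> sets (borel_str H) \<and> A \<subseteq> units H"
proof -
  have "units H \<inter> space (borel_str H) \<in> sets (borel_str H)" using units_sets by simp
  from sets_restrict_space_iff[OF this] show ?thesis unfolding unit_space_def by blast
qed

lemma space_unit_space: "space (unit_space H) = units H"
proof -
  have "units H \<inter> arrows H = units H" using units_subset by blast
  then show ?thesis by (simp only: unit_space_def space_restrict_space space_borel_str)
qed

lemma src_borel: "src H \<in> borel_str H \<rightarrow>\<^sub>M borel_str H"
  and rng_borel: "rng H \<in> borel_str H \<rightarrow>\<^sub>M borel_str H"
  using src_measurable rng_measurable
  unfolding unit_space_def measurable_restrict_space2_iff by simp_all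

lemma arrowsI: "f \<in> sets (borel_str H) \<Longrightarrow> h \<in> f \<Longrightarrow> h \<in> arrows H"
  by (rule subsetD[OF sets.sets_into_space[of f "borel_str H", unfolded space_borel_str]])

lemma image_src_sets:
  assumes "A \<in> sets (borel_str H)" "inj_on (src H) A"
  shows "src H ` A \<in> sets (unit_space H)"
  unfolding units_measurable_sets
  using injective_image_standard_borel[OF standard standard src_borel assms] src_in arrowsI[OF assms(1)]
  by blast

lemma image_rng_sets:
  assumes "A \<in> sets (borel_str H)" "inj_on (rng H) A"
  shows "rng H ` A \<in> sets (unit_space H)"
  unfolding units_measurable_sets
  using injective_image_standard_borel[OF standard standard rng_borel assms] rng_in arrowsI[OF assms(1)]
  by blast

lemma borel_iso_onto_imageI:
  assumes A: "A \<in> sets (borel_str H)" and inj: "inj_on \<phi> A"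
    and \<phi>: "\<phi> \<in> borel_str H \<rightarrow>\<^sub>M unit_space H"
    and im: "\<And>B. B \<in> sets (borel_str H) \<Longrightarrow> inj_on \<phi> B \<Longrightarrow> \<phi> ` B \<in> sets (unit_space H)"
  shows "borel_iso_onto_image (borel_str H) (unit_space H) A \<phi>"
  unfolding borel_iso_onto_image_def
proof (intro conjI inj)
  show "\<phi> \<in> restrict_space (borel_str H) A \<rightarrow>\<^sub>M restrict_space (unit_space H) (\<phi> ` A)"
    by (rule measurable_restrict_space3[OF \<phi>]) auto
  have \<phi>A: "\<phi> ` A \<in> sets (unit_space H)" by (rule im[OF A inj])
  show "inv_into A \<phi> \<in> restrict_space (unit_space H) (\<phi> ` A) \<rightarrow>\<^sub>M restrict_space (borel_str H) A"
  proof (rule measurableI)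
    fix y assume "y \<in> space (restrict_space (unit_space H) (\<phi> ` A))"
    then have "y \<in> \<phi> ` A" by (simp add: space_restrict_space)
    then show "inv_into A \<phi> y \<in> space (restrict_space (borel_str H) A)"
      using arrowsI[OF A] by (auto simp: space_restrict_space space_borel_str inv_into_into)
  next
    fix B assume "B \<in> sets (restrict_space (borel_str H) A)"
    then have B: "B \<in> sets (borel_str H)" "B \<subseteq> A" using A by (auto simp: sets_restrict_space_iff)
    have "inv_into A \<phi> -` B \<inter> \<phi> ` A = \<phi> ` B"
      using B(2) inj by (auto simp: inv_into_f_f subset_iff)
    moreover have "\<phi> ` B \<in> sets (unit_space H)"
      by (rule im[OF B(1) inj_on_subset[OF inj B(2)]])
    moreover have "space (restrict_space (unit_space H) (\<phi> ` A)) = \<phi> ` A"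
      using sets.sets_into_space[OF \<phi>A] by (auto simp: space_restrict_space)
    ultimately show "inv_into A \<phi> -` B \<inter> space (restrict_space (unit_space H) (\<phi> ` A))
        \<in> sets (restrict_space (unit_space H) (\<phi> ` A))"
      using B(2) \<phi>A by (auto simp: sets_restrict_space_iff)
  qed
qed

text \<open>Inverses of injective Borel maps are Borel by the image theorem, so a bisection is
  recognized by injectivity of source and range alone.\<close>

lemma full_semigroup_iff:
  "f \<in> full_semigroup H \<longleftrightarrow> f \<in> sets (borel_str H) \<and> inj_on (src H) f \<and> inj_on (rng H) f"
proof
  show "f \<in> full_semigroup H \<Longrightarrow> f \<in> sets (borel_str H) \<and> inj_on (src H) f \<and> inj_on (rng H) f"
    by (simp add: full_semigroup_def borel_iso_onto_image_def)
  assume "f \<in> sets (borel_str H) \<and> inj_on (src H) f \<and> inj_on (rng H) f"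
  then show "f \<in> full_semigroup H"
    using borel_iso_onto_imageI[OF _ _ src_measurable image_src_sets, of f]
      borel_iso_onto_imageI[OF _ _ rng_measurable image_rng_sets, of f]
    by (simp add: full_semigroup_def)
qed

lemma units_full_semigroup: "units H \<in> full_semigroup H"
  unfolding full_semigroup_iff
  by (intro conjI units_sets inj_onI) (simp_all add: src_unit rng_unit)

lemma inv_mult_cancel:
  assumes "f \<in> arrows H" "g \<in> arrows H" "src H f = rng H g"
  shows "gmult H (ginv H f) (gmult H f g) = g"
  using assms mult_assoc[of "ginv H f" f g] by (simp add: inv_in src_inv inv_mult mult_rng)

lemma mult_inv_cancel:
  assumes "f \<in> arrows H" "h \<in> arrows H" "rng H f = rng H h"
  shows "gmult H f (gmult H (ginv H f) h) = h"
  using assms mult_assoc[of f "ginv H f" h] by (simp add: inv_in src_inv rng_inv mult_inv mult_rng)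

text \<open>An arrow \<open>h\<close> lies in the product iff \<open>\<rho>(h)\<inverse> h \<in> g\<close>, where \<open>\<rho>(h)\<close> is the arrow of \<open>f\<close> with the same range.\<close>

lemma set_mult_full_semigroup:
  assumes f: "f \<in> full_semigroup H" and g: "g \<in> full_semigroup H"
  shows "set_mult H f g \<in> full_semigroup H"
proof -
  note f' = f[unfolded full_semigroup_iff] and g' = g[unfolded full_semigroup_iff]
  have fA: "x \<in> arrows H" if "x \<in> f" for x using arrowsI f' that by blast
  have gA: "x \<in> arrows H" if "x \<in> g" for x using arrowsI g' that by blast
  define \<rho> where "\<rho> h = inv_into f (rng H) (rng H h)" for h
  define R where "R = {h \<in> arrows H. rng H h \<in> rng H ` f}"
  have rf: "rng H ` f \<in> sets (unit_space H)" by (rule image_rng_sets) (use f' in auto)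
  have "R = rng H -` (rng H ` f) \<inter> space (borel_str H)" by (auto simp: R_def space_borel_str)
  then have R: "R \<in> sets (borel_str H)" using measurable_sets[OF rng_measurable rf] by simp
  have \<rho>f: "\<rho> h \<in> f" "rng H (\<rho> h) = rng H h" if "h \<in> R" for h
    using that unfolding R_def \<rho>_def by (auto intro: inv_into_into f_inv_into_f)
  have \<rho>_eq: "\<rho> h = x" if "x \<in> f" "rng H h = rng H x" for h x
    unfolding \<rho>_def using that f' by (simp add: inv_into_f_f)
  let ?MR = "restrict_space (borel_str H) R"
  have sR: "space ?MR = R" using R sets.sets_into_space by (auto simp: space_restrict_space)
  have "rng H \<in> ?MR \<rightarrow>\<^sub>M restrict_space (unit_space H) (rng H ` f)"
    by (rule measurable_restrict_space3[OF rng_measurable]) (auto simp: R_def)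
  moreover have "inv_into f (rng H) \<in> restrict_space (unit_space H) (rng H ` f) \<rightarrow>\<^sub>M restrict_space (borel_str H) f"
    using f by (simp add: full_semigroup_def borel_iso_onto_image_def)
  ultimately have "\<rho> \<in> ?MR \<rightarrow>\<^sub>M restrict_space (borel_str H) f"
    unfolding \<rho>_def by (rule measurable_compose)
  then have "\<rho> \<in> ?MR \<rightarrow>\<^sub>M borel_str H" by (simp add: measurable_restrict_space2_iff)
  from measurable_compose[OF this inv_measurable]
  have "(\<lambda>h. (ginv H (\<rho> h), h)) \<in> ?MR \<rightarrow>\<^sub>M (borel_str H \<Otimes>\<^sub>M borel_str H)"
    by (rule measurable_Pair) (rule measurable_restrict_space1[OF measurable_ident_sets[OF refl]])
  moreover have "(ginv H (\<rho> h), h) \<in> composable H" if "h \<in> R" for h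
    using \<rho>f[OF that] fA[of "\<rho> h"] that by (simp add: composable_def R_def inv_in src_inv)
  ultimately have "(\<lambda>h. (ginv H (\<rho> h), h)) \<in> ?MR \<rightarrow>\<^sub>M restrict_space (borel_str H \<Otimes>\<^sub>M borel_str H) (composable H)"
    using sR by (intro measurable_restrict_space2) auto
  from measurable_compose[OF this mult_measurable]
  have m: "(\<lambda>h. gmult H (ginv H (\<rho> h)) h) \<in> ?MR \<rightarrow>\<^sub>M borel_str H" by simp
  have "set_mult H f g = (\<lambda>h. gmult H (ginv H (\<rho> h)) h) -` g \<inter> space ?MR"
    unfolding sR
  proof (intro equalityI subsetI)
    fix h assume "h \<in> set_mult H f g"
    then obtain x y where xy: "h = gmult H x y" "x \<in> f" "y \<in> g" "src H x = rng H y"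
      unfolding set_mult_def by blast
    have xA: "x \<in> arrows H" "y \<in> arrows H" using xy fA gA by auto
    have "rng H h = rng H x" using xy xA rng_mult by simp
    then have "\<rho> h = x" "h \<in> R" using xy xA mult_in by (auto simp: \<rho>_eq R_def)
    then show "h \<in> (\<lambda>h. gmult H (ginv H (\<rho> h)) h) -` g \<inter> R"
      using inv_mult_cancel[OF xA xy(4)] xy by simp
  next
    fix h assume "h \<in> (\<lambda>h. gmult H (ginv H (\<rho> h)) h) -` g \<inter> R"
    then have h: "gmult H (ginv H (\<rho> h)) h \<in> g" "h \<in> R" "h \<in> arrows H" by (auto simp: R_def)
    have xA: "\<rho> h \<in> arrows H" using \<rho>f(1)[OF h(2)] fA by blast
    have "gmult H (\<rho> h) (gmult H (ginv H (\<rho> h)) h) = h"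
      by (rule mult_inv_cancel[OF xA h(3) \<rho>f(2)[OF h(2)]])
    moreover have "src H (\<rho> h) = rng H (gmult H (ginv H (\<rho> h)) h)"
      using xA h(3) \<rho>f(2)[OF h(2)] inv_in src_inv rng_inv rng_mult by simp
    ultimately show "h \<in> set_mult H f g"
      unfolding set_mult_def using \<rho>f(1)[OF h(2)] h(1) by (metis (mono_tags, lifting) mem_Collect_eq)
  qed
  moreover have "\<dots> \<in> sets ?MR" using measurable_sets[OF m] g' by blast
  ultimately have sets: "set_mult H f g \<in> sets (borel_str H)"
    using R by (auto simp: sets_restrict_space_iff)
  \<comment> \<open>Both injectivity claims at once: equality at either end identifies one factor,
    then the middle unit, then the other factor.\<close>
  have inj: "h = h'" if h: "h \<in> set_mult H f g" "h' \<in> set_mult H f g" and eq: "src H h = src H h' \<or> rng H h = rng H h'"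
    for h h'
  proof -
    obtain x y x' y' where xy: "h = gmult H x y" "x \<in> f" "y \<in> g" "src H x = rng H y"
      "h' = gmult H x' y'" "x' \<in> f" "y' \<in> g" "src H x' = rng H y'"
      using h unfolding set_mult_def by blast
    then have "src H y = src H y' \<or> rng H x = rng H x'" using eq src_mult rng_mult fA gA by simp
    moreover have "y = y'" if "src H y = src H y'"
      by (rule inj_onD[OF conjunct1[OF conjunct2[OF g']] that xy(3,7)])
    moreover have "x = x'" if "rng H x = rng H x'"
      by (rule inj_onD[OF conjunct2[OF conjunct2[OF f']] that xy(2,6)])
    ultimately have "rng H y = rng H y'" using xy(4,8) by metis
    then have y: "y = y'" by (rule inj_onD[OF conjunct2[OF conjunct2[OF g']] _ xy(3,7)])
    have "src H x = src H x'" using xy(4,8) y by (simp only:)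
    then have "x = x'" by (rule inj_onD[OF conjunct1[OF conjunct2[OF f']] _ xy(2,6)])
    with y show ?thesis using xy(1,5) by (simp only:)
  qed
  then have "inj_on (src H) (set_mult H f g)" "inj_on (rng H) (set_mult H f g)"
    by (auto intro!: inj_onI)
  then show ?thesis using sets by (simp add: full_semigroup_iff)
qed

end

section \<open>The action lifted through a class-bijective extension\<close>

locale pmp_extension =
  fixes G :: "'g borel_groupoid" and \<mu> :: "'g measure"
    and H :: "'h borel_groupoid" and \<nu> :: "'h measure" and \<pi> :: "'g \<Rightarrow> 'h"
  assumes extension: "pmp_class_bijective_extension G \<mu> H \<nu> \<pi>"

lemma (in pmp_extension) pmp_G: "discrete_pmp_groupoid G \<mu>"
  and pmp_H: "discrete_pmp_groupoid H \<nu>"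
  using extension unfolding pmp_class_bijective_extension_def by blast+

sublocale pmp_extension \<subseteq> G: measurable_groupoid G
  using pmp_G unfolding discrete_pmp_groupoid_def by (rule conjunct1)

sublocale pmp_extension \<subseteq> H: measurable_groupoid H
  using pmp_H unfolding discrete_pmp_groupoid_def by (rule conjunct1)

sublocale pmp_extension \<subseteq> prob_space \<mu>
  using pmp_G unfolding discrete_pmp_groupoid_def by blast

context pmp_extension
begin

lemma sets_\<mu>: "sets \<mu> = sets (unit_space G)"
  using pmp_G unfolding discrete_pmp_groupoid_def by blast

lemma space_\<mu>: "space \<mu> = units G"
  using sets_eq_imp_space_eq[OF sets_\<mu>] G.space_unit_space by simp

lemma morphism:
  assumes "g \<in> arrows G"
  shows "\<pi> g \<in> arrows H" "src H (\<pi> g) = \<pi> (src G g)" "rng H (\<pi> g) = \<pi> (rng G g)"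
  using extension assms unfolding pmp_class_bijective_extension_def groupoid_morphism_def by blast+

lemma morphism_mult:
  assumes "f \<in> arrows G" "g \<in> arrows G" "src G f = rng G g"
  shows "\<pi> (gmult G f g) = gmult H (\<pi> f) (\<pi> g)"
  using extension assms unfolding pmp_class_bijective_extension_def groupoid_morphism_def by blast

lemma fibre_eq:
  assumes g: "g \<in> arrows G" "g' \<in> arrows G" "\<pi> g = \<pi> g'"
  shows src_fibre_eq: "src G g = src G g' \<Longrightarrow> g = g'" and rng_fibre_eq: "rng G g = rng G g' \<Longrightarrow> g = g'"
proof -
  have "inj_on \<pi> {k \<in> arrows G. src G k = src G g}" "inj_on \<pi> {k \<in> arrows G. rng G k = rng G g}"
    using extension G.src_in[OF g(1)] G.rng_in[OF g(1)]
    unfolding pmp_class_bijective_extension_def class_bijective_def bij_betw_def by blast+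
  then show "src G g = src G g' \<Longrightarrow> g = g'" "rng G g = rng G g' \<Longrightarrow> g = g'"
    using g by (auto dest: inj_onD)
qed

lemma src_fibre_lift:
  assumes "x \<in> units G" "h \<in> arrows H" "src H h = \<pi> x"
  obtains g where "g \<in> arrows G" "src G g = x" "\<pi> g = h"
proof -
  have "\<pi> ` {k \<in> arrows G. src G k = x} = {k \<in> arrows H. src H k = \<pi> x}"
    using extension assms(1)
    unfolding pmp_class_bijective_extension_def class_bijective_def bij_betw_def by blast
  then have "h \<in> \<pi> ` {k \<in> arrows G. src G k = x}" using assms by simp
  then show thesis using that by blast
qed

definition lift_arrows :: "'h set \<Rightarrow> 'g set" where
  "lift_arrows f = {g \<in> arrows G. \<pi> g \<in> f}"

text \<open>\<open>ext_act\<close> without the definite description: its domain condition becomes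
  the existence of a lift. As the range image of a set of arrows it is open to the image
  theorem.\<close>

definition act :: "'h set \<Rightarrow> 'g set \<Rightarrow> 'g set" where
  "act f P = rng G ` {g \<in> lift_arrows f. src G g \<in> P}"

lemma full_semigroupD:
  assumes "f \<in> full_semigroup H"
  shows "f \<in> sets (borel_str H)" "inj_on (src H) f" "inj_on (rng H) f" "\<And>x. x \<in> f \<Longrightarrow> x \<in> arrows H"
  using assms H.arrowsI by (auto simp: H.full_semigroup_iff)

lemma lift_arrows_sets: "f \<in> full_semigroup H \<Longrightarrow> lift_arrows f \<in> sets (borel_str G)"
proof -
  assume f: "f \<in> full_semigroup H"
  have "\<pi> \<in> borel_str G \<rightarrow>\<^sub>M borel_str H"
    using extension by (simp add: pmp_class_bijective_extension_def)
  from measurable_sets[OF this full_semigroupD(1)[OF f]]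
  show ?thesis by (simp add: lift_arrows_def G.space_borel_str vimage_def Int_def conj_commute)
qed

text \<open>Arrows with equal sources project to arrows of \<open>f\<close> with equal sources,
  hence to the same arrow; class-bijectivity leaves only one lift of it. Ranges behave in the same
  way.\<close>

lemma lift_arrows_inj:
  assumes f: "f \<in> full_semigroup H"
  shows "inj_on (src G) (lift_arrows f)" "inj_on (rng G) (lift_arrows f)"
proof -
  show "inj_on (src G) (lift_arrows f)"
  proof (rule inj_onI)
    fix g g' assume g: "g \<in> lift_arrows f" "g' \<in> lift_arrows f" "src G g = src G g'"
    then have gA: "g \<in> arrows G" "\<pi> g \<in> f" "g' \<in> arrows G" "\<pi> g' \<in> f"
      by (simp_all add: lift_arrows_def)
    have "src H (\<pi> g) = src H (\<pi> g')" by (simp only: morphism[OF gA(1)] morphism[OF gA(3)] g(3))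
    then have "\<pi> g = \<pi> g'" by (rule inj_onD[OF full_semigroupD(2)[OF f] _ gA(2,4)])
    then show "g = g'" by (rule src_fibre_eq[OF gA(1) gA(3) _ g(3)])
  qed
  show "inj_on (rng G) (lift_arrows f)"
  proof (rule inj_onI)
    fix g g' assume g: "g \<in> lift_arrows f" "g' \<in> lift_arrows f" "rng G g = rng G g'"
    then have gA: "g \<in> arrows G" "\<pi> g \<in> f" "g' \<in> arrows G" "\<pi> g' \<in> f"
      by (simp_all add: lift_arrows_def)
    have "rng H (\<pi> g) = rng H (\<pi> g')" by (simp only: morphism[OF gA(1)] morphism[OF gA(3)] g(3))
    then have "\<pi> g = \<pi> g'" by (rule inj_onD[OF full_semigroupD(3)[OF f] _ gA(2,4)])
    then show "g = g'" by (rule rng_fibre_eq[OF gA(1) gA(3) _ g(3)])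
  qed
qed

lemma ext_act_eq_act:
  assumes f: "f \<in> full_semigroup H" and P: "P \<subseteq> units G"
  shows "ext_act G H \<pi> f P = act f P"
proof -
  have pt: "ext_act_point G \<pi> f (src G g) = rng G g" if "g \<in> lift_arrows f" for g
  proof -
    have "(THE k. k \<in> arrows G \<and> \<pi> k \<in> f \<and> src G k = src G g) = g"
      using that lift_arrows_inj(1)[OF f] by (intro the_equality) (auto simp: lift_arrows_def dest: inj_onD)
    then show ?thesis by (simp add: ext_act_point_def)
  qed
  show ?thesis
  proof (intro equalityI subsetI)
    fix y assume "y \<in> ext_act G H \<pi> f P"
    then obtain x h where x: "y = ext_act_point G \<pi> f x" "x \<in> P" "h \<in> f" "\<pi> x = src H h"
      unfolding ext_act_def by blast
    have hA: "h \<in> arrows H" using full_semigroupD(4)[OF f x(3)] .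
    have xu: "x \<in> units G" using x(2) P by blast
    obtain g where g: "g \<in> arrows G" "src G g = x" "\<pi> g = h"
      using src_fibre_lift[OF xu hA] x(4) by metis
    then have gl: "g \<in> lift_arrows f" using x(3) by (simp add: lift_arrows_def)
    have "y = rng G g" using pt[OF gl] g x by simp
    then show "y \<in> act f P" unfolding act_def using gl g x by blast
  next
    fix y assume "y \<in> act f P"
    then obtain g where g: "g \<in> lift_arrows f" "src G g \<in> P" "y = rng G g" unfolding act_def by blast
    have "\<pi> g \<in> f" "src H (\<pi> g) = \<pi> (src G g)"
      using g(1) morphism(2)[of g] by (simp_all add: lift_arrows_def)
    then have "\<pi> (src G g) \<in> src H ` f" by (metis imageI)
    moreover have "y = ext_act_point G \<pi> f (src G g)" using pt[OF g(1)] g(3) by simp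
    ultimately show "y \<in> ext_act G H \<pi> f P" unfolding ext_act_def using g(2) by blast
  qed
qed

lemma act_units: "act f P \<subseteq> units G"
  using G.rng_in by (auto simp: act_def lift_arrows_def)

lemma act_Un: "act f (P \<union> Q) = act f P \<union> act f Q"
  and act_empty: "act f {} = {}"
  and act_Union: "act f (\<Union>C) = (\<Union>P\<in>C. act f P)"
  by (auto simp: act_def)

lemma act_Diff:
  assumes "f \<in> full_semigroup H"
  shows "act f (P - Q) = act f P - act f Q"
  using lift_arrows_inj(2)[OF assms] by (auto simp: act_def dest: inj_onD)

text \<open>An arrow over a unit and the source of that arrow have the same image and the same
  source, so they agree. Hence the units of \<open>H\<close> lift exactly to the units of
  \<open>G\<close>.\<close>

lemma act_unit_arrows:
  assumes "P \<subseteq> units G"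
  shows "act (units H) P = P"
proof -
  have unit: "g = src G g" if "g \<in> lift_arrows (units H)" for g
  proof -
    have g: "g \<in> arrows G" "\<pi> g \<in> units H" using that unfolding lift_arrows_def by blast+
    have sg: "src G g \<in> units G" by (rule G.src_in[OF g(1)])
    then have sgA: "src G g \<in> arrows G" using G.units_subset by blast
    have "\<pi> g = \<pi> (src G g)" using H.src_unit[OF g(2)] morphism(2)[OF g(1)] by (simp only:)
    then show ?thesis by (rule src_fibre_eq[OF g(1) sgA _ G.src_unit[OF sg, symmetric]])
  qed
  have "x \<in> lift_arrows (units H)" if "x \<in> units G" for x
  proof -
    have "\<pi> x \<in> units H"
      using extension that unfolding pmp_class_bijective_extension_def groupoid_morphism_def by blast
    then show ?thesis using that G.units_subset by (auto simp: lift_arrows_def)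
  qed
  moreover have "g \<in> units G" if "g \<in> lift_arrows (units H)" for g
    using unit[OF that] that G.src_in[of g] by (simp add: lift_arrows_def)
  ultimately have "lift_arrows (units H) = units G" by blast
  then have "act (units H) P = rng G ` P"
    unfolding act_def using assms G.src_unit by (intro arg_cong[of _ _ "(`) (rng G)"]) auto
  also have "\<dots> = (\<lambda>x. x) ` P" using assms G.rng_unit by (intro image_cong) auto
  finally show ?thesis by simp
qed

text \<open>A factorization of \<open>\<pi> g\<close> lifts from right to left: the right factor
  from the source of \<open>g\<close>, the left one from the range of this lift. Uniqueness of lifts
  identifies the product with \<open>g\<close>.\<close>

lemma act_set_mult:
  assumes f: "f \<in> full_semigroup H" and k: "k \<in> full_semigroup H" and P: "P \<subseteq> units G"
  shows "act (set_mult H f k) P = act f (act k P)"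
proof (intro equalityI subsetI)
  fix y assume "y \<in> act (set_mult H f k) P"
  then obtain g where g: "g \<in> arrows G" "\<pi> g \<in> set_mult H f k" "src G g \<in> P" "y = rng G g"
    unfolding act_def lift_arrows_def by blast
  then obtain a b where ab: "\<pi> g = gmult H a b" "a \<in> f" "b \<in> k" "src H a = rng H b"
    unfolding set_mult_def by blast
  have abA: "a \<in> arrows H" "b \<in> arrows H" using ab full_semigroupD(4) f k by blast+
  have "src H b = \<pi> (src G g)" using H.src_mult[OF abA ab(4)] morphism(2)[OF g(1)] ab(1) by simp
  then obtain b' where b': "b' \<in> arrows G" "src G b' = src G g" "\<pi> b' = b"
    using src_fibre_lift[OF G.src_in[OF g(1)] abA(2)] by metis
  have "src H a = \<pi> (rng G b')" using ab(4) morphism(3)[OF b'(1)] b'(3) by simp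
  then obtain a' where a': "a' \<in> arrows G" "src G a' = rng G b'" "\<pi> a' = a"
    using src_fibre_lift[OF G.rng_in[OF b'(1)] abA(1)] by metis
  have "\<pi> (gmult G a' b') = \<pi> g"
    using morphism_mult[OF a'(1) b'(1) a'(2)] a'(3) b'(3) ab(1) by simp
  moreover have "src G (gmult G a' b') = src G g"
    using G.src_mult[OF a'(1) b'(1) a'(2)] b'(2) by simp
  ultimately have "gmult G a' b' = g"
    by (intro src_fibre_eq[OF G.mult_in[OF a'(1) b'(1) a'(2)] g(1)])
  then have "y = rng G a'" using g(4) G.rng_mult[OF a'(1) b'(1) a'(2)] by simp
  moreover have "a' \<in> lift_arrows f" "b' \<in> lift_arrows k" using a' b' ab by (simp_all add: lift_arrows_def)
  moreover have "src G b' \<in> P" using b'(2) g(3) by simp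
  ultimately show "y \<in> act f (act k P)" unfolding act_def using a'(2) by blast
next
  fix y assume "y \<in> act f (act k P)"
  then obtain a b where a: "a \<in> arrows G" "\<pi> a \<in> f" "y = rng G a" "src G a = rng G b"
    and b: "b \<in> arrows G" "\<pi> b \<in> k" "src G b \<in> P"
    unfolding act_def lift_arrows_def by blast
  have "\<pi> (gmult G a b) \<in> set_mult H f k"
    unfolding set_mult_def mem_Collect_eq
    using a(2,4) b(2) morphism_mult[OF a(1) b(1) a(4)] morphism(2)[OF a(1)] morphism(3)[OF b(1)]
    by metis
  then have "gmult G a b \<in> lift_arrows (set_mult H f k)"
    using G.mult_in[OF a(1) b(1) a(4)] by (simp add: lift_arrows_def)
  moreover have "src G (gmult G a b) \<in> P" "y = rng G (gmult G a b)"
    using G.src_mult[OF a(1) b(1) a(4)] G.rng_mult[OF a(1) b(1) a(4)] a(3) b(3) by simp_all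
  ultimately show "y \<in> act (set_mult H f k) P" unfolding act_def by blast
qed

lemma lift_arrows_restrict_sets:
  assumes f: "f \<in> full_semigroup H" and P: "P \<in> sets \<mu>"
  shows "{g \<in> lift_arrows f. src G g \<in> P} \<in> sets (borel_str G)"
proof -
  have "src G -` P \<inter> space (borel_str G) \<in> sets (borel_str G)"
    by (rule measurable_sets[OF G.src_measurable]) (use P sets_\<mu> in simp)
  from sets.Int[OF this lift_arrows_sets[OF f]]
  show ?thesis
    by (rule back_subst[of "\<lambda>A. A \<in> _"]) (auto simp: G.space_borel_str lift_arrows_def)
qed

lemma act_sets:
  assumes f: "f \<in> full_semigroup H" and P: "P \<in> sets \<mu>"
  shows "act f P \<in> sets \<mu>"
  unfolding act_def sets_\<mu>
  by (intro G.image_rng_sets lift_arrows_restrict_sets[OF f P]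
      inj_on_subset[OF lift_arrows_inj(2)[OF f]]) auto

text \<open>For a bisection, both sides of the pmp identity integrate indicator functions.\<close>

lemma measure_act_le:
  assumes f: "f \<in> full_semigroup H" and P: "P \<in> sets \<mu>"
  shows "measure \<mu> (act f P) \<le> measure \<mu> P"
proof -
  define B where "B = {g \<in> lift_arrows f. src G g \<in> P}"
  have B: "B \<in> sets (borel_str G)" unfolding B_def by (rule lift_arrows_restrict_sets[OF f P])
  have BA: "B \<subseteq> arrows G" by (auto simp: B_def lift_arrows_def)
  have inj: "inj_on (src G) B" "inj_on (rng G) B"
    using lift_arrows_inj[OF f] by (auto simp: B_def intro: inj_on_subset)
  have count: "emeasure (count_space UNIV) {h \<in> arrows G. \<phi> h = x \<and> h \<in> B} = indicator (\<phi> ` B) x"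
    if inj: "inj_on \<phi> B" for \<phi> :: "'g \<Rightarrow> 'g" and x
  proof (cases "x \<in> \<phi> ` B")
    case True
    then obtain h where "h \<in> B" "\<phi> h = x" by blast
    then have "{h \<in> arrows G. \<phi> h = x \<and> h \<in> B} = {h}" using inj BA by (auto dest: inj_onD)
    then show ?thesis using True by simp
  next
    case False
    then have "{h \<in> arrows G. \<phi> h = x \<and> h \<in> B} = {}" by blast
    moreover have "indicator (\<phi> ` B) x = (0 :: ennreal)" using False by simp
    ultimately show ?thesis by (simp only: emeasure_empty)
  qed
  have "src_measure G \<mu> B = emeasure \<mu> (src G ` B)"
    unfolding src_measure_def count[OF inj(1)] using G.image_src_sets[OF B inj(1)] sets_\<mu> by simp
  moreover have "rng_measure G \<mu> B = emeasure \<mu> (rng G ` B)"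
    unfolding rng_measure_def count[OF inj(2)] using G.image_rng_sets[OF B inj(2)] sets_\<mu> by simp
  moreover have "src_measure G \<mu> B = rng_measure G \<mu> B"
    using pmp_G B unfolding discrete_pmp_groupoid_def by blast
  ultimately have "emeasure \<mu> (act f P) = emeasure \<mu> (src G ` B)"
    by (simp add: act_def B_def)
  also have "\<dots> \<le> emeasure \<mu> P" by (rule emeasure_mono[OF _ P]) (auto simp: B_def)
  finally show ?thesis by (simp add: emeasure_eq_measure)
qed

end

section \<open>Finite partitions\<close>

lemma algebra_sigma_sets: "\<S> \<subseteq> Pow X \<Longrightarrow> algebra X (sigma_sets X \<S>)"
  using sigma_algebra.axioms(1)[OF sigma_algebra_sigma_sets] .

lemma coarsest_partition_on:
  assumes "\<S> \<subseteq> Pow X"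
  shows "partition_on X (coarsest_partition X \<S>)"
proof -
  have "equiv X {(x, y). x \<in> X \<and> y \<in> X \<and> (\<forall>S\<in>\<S>. x \<in> S \<longleftrightarrow> y \<in> S)}"
    by (rule equivI) (auto simp: refl_on_def sym_def trans_def)
  from partition_on_quotient[OF this] show ?thesis
    using assms by (subst coarsest_partition_eq) auto
qed

lemma coarsest_partition_atoms:
  assumes "\<S> \<subseteq> Pow X"
  shows "coarsest_partition X \<S> = (\<lambda>x. {y \<in> X. \<forall>S\<in>\<S>. y \<in> S \<longleftrightarrow> x \<in> S}) ` X"
proof -
  have "\<And>S. S \<in> \<S> \<Longrightarrow> S \<subseteq> X" using assms by blast
  from coarsest_partition_eq[OF this] show ?thesis by (auto simp: quotient_def image_iff)
qed

lemma finite_coarsest_partition: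
  assumes "\<S> \<subseteq> Pow X" "finite \<S>"
  shows "finite (coarsest_partition X \<S>)"
proof (rule finite_subset)
  show "coarsest_partition X \<S> \<subseteq> (\<lambda>T. {y \<in> X. \<forall>S\<in>\<S>. y \<in> S \<longleftrightarrow> S \<in> T}) ` Pow \<S>"
  proof
    fix A assume "A \<in> coarsest_partition X \<S>"
    then obtain x where "A = {y \<in> X. \<forall>S\<in>\<S>. y \<in> S \<longleftrightarrow> x \<in> S}"
      unfolding coarsest_partition_atoms[OF assms(1)] by blast
    then have "A = {y \<in> X. \<forall>S\<in>\<S>. y \<in> S \<longleftrightarrow> S \<in> {S \<in> \<S>. x \<in> S}}" by auto
    then show "A \<in> (\<lambda>T. {y \<in> X. \<forall>S\<in>\<S>. y \<in> S \<longleftrightarrow> S \<in> T}) ` Pow \<S>" by blast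
  qed
qed (use assms in simp)

text \<open>With finitely many generators, every atom is the complement of a finite union of
  generators and complements of generators.\<close>

lemma sigma_sets_coarsest_partition:
  assumes S: "\<S> \<subseteq> Pow X" "finite \<S>"
  shows "sigma_sets X (coarsest_partition X \<S>) = sigma_sets X \<S>"
proof (rule sigma_sets_eqI)
  interpret A: algebra X "sigma_sets X \<S>" by (rule algebra_sigma_sets[OF S(1)])
  fix A assume "A \<in> coarsest_partition X \<S>"
  then obtain x where A: "A = {y \<in> X. \<forall>S\<in>\<S>. y \<in> S \<longleftrightarrow> x \<in> S}"
    unfolding coarsest_partition_atoms[OF S(1)] by blast
  have "A = X - \<Union>((\<lambda>S. if x \<in> S then X - S else S) ` \<S>)"
    unfolding A by (auto split: if_splits)
  also have "\<dots> \<in> sigma_sets X \<S>"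
    using S(2) by (intro A.Diff A.top A.finite_Union) auto
  finally show "A \<in> sigma_sets X \<S>" .
next
  let ?Q = "coarsest_partition X \<S>"
  have Q: "partition_on X ?Q" by (rule coarsest_partition_on[OF S(1)])
  then have QX: "?Q \<subseteq> Pow X" by (auto dest: partition_onD1)
  interpret A: algebra X "sigma_sets X ?Q" by (rule algebra_sigma_sets[OF QX])
  fix A assume A: "A \<in> \<S>"
  have "A = \<Union>{B \<in> ?Q. B \<subseteq> A}"
  proof (intro equalityI subsetI)
    fix x assume x: "x \<in> A"
    then have "{y \<in> X. \<forall>S\<in>\<S>. y \<in> S \<longleftrightarrow> x \<in> S} \<in> ?Q" "x \<in> {y \<in> X. \<forall>S\<in>\<S>. y \<in> S \<longleftrightarrow> x \<in> S}"
      using A S(1) unfolding coarsest_partition_atoms[OF S(1)] by blast+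
    moreover have "{y \<in> X. \<forall>S\<in>\<S>. y \<in> S \<longleftrightarrow> x \<in> S} \<subseteq> A" using x A by blast
    ultimately show "x \<in> \<Union>{B \<in> ?Q. B \<subseteq> A}" by blast
  qed blast
  also have "\<dots> \<in> sigma_sets X ?Q"
    using finite_coarsest_partition[OF S] by (intro A.finite_Union) auto
  finally show "A \<in> sigma_sets X ?Q" .
qed

lemma partition_on_disjoint:
  "partition_on X \<R> \<Longrightarrow> A \<in> \<R> \<Longrightarrow> B \<in> \<R> \<Longrightarrow> x \<in> A \<Longrightarrow> x \<in> B \<Longrightarrow> A = B"
  by (metis IntI disjointD empty_iff partition_onD2)

lemma sigma_sets_partition_Union:
  assumes R: "partition_on X \<R>" and A: "A \<in> sigma_sets X \<R>"
  shows "A = \<Union>{B \<in> \<R>. B \<subseteq> A}"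
proof -
  note disj = partition_on_disjoint[OF R]
  have "\<forall>B\<in>\<R>. B \<subseteq> A \<or> B \<inter> A = {}"
    using A
  proof induction
    case (Basic A)
    then show ?case using disj by blast
  next
    case (Compl A)
    have "B \<subseteq> X" if "B \<in> \<R>" for B using partition_onD1[OF R] that by blast
    with Compl show ?case by blast
  next
    case (Union A)
    then show ?case by blast
  qed auto
  moreover have "A \<subseteq> \<Union>\<R>"
    using sigma_sets_into_sp[of \<R> X A] A partition_onD1[OF R] by blast
  ultimately show ?thesis by blast
qed

lemma sigma_sets_partition_iff:
  assumes R: "partition_on X \<R>" and A: "A \<in> sigma_sets X \<R>" and C: "C \<in> \<R>" "x \<in> C"
  shows "x \<in> A \<longleftrightarrow> C \<subseteq> A"
proof
  assume "x \<in> A"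
  then obtain B where "B \<in> \<R>" "B \<subseteq> A" "x \<in> B"
    using sigma_sets_partition_Union[OF R A] by blast
  then show "C \<subseteq> A" using partition_on_disjoint[OF R C(1), of B x] C(2) by blast
qed (use C(2) in blast)

lemma finite_sigma_sets:
  assumes "\<S> \<subseteq> Pow X" "finite \<S>"
  shows "finite (sigma_sets X \<S>)"
proof (rule finite_subset)
  let ?Q = "coarsest_partition X \<S>"
  show "sigma_sets X \<S> \<subseteq> Union ` Pow ?Q"
    unfolding sigma_sets_coarsest_partition[OF assms, symmetric]
    using sigma_sets_partition_Union[OF coarsest_partition_on[OF assms(1)]] by blast
qed (use finite_coarsest_partition[OF assms] in simp)

text \<open>In a finite sigma-algebra countable unions reduce to binary ones. Homomorphisms and
  defects are compatible with finite operations only, so this is the induction they need.\<close>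

lemma finite_sigma_sets_induct [consumes 3, case_names Basic Empty Compl Un]:
  assumes S: "\<S> \<subseteq> Pow X" "finite \<S>" and A: "A \<in> sigma_sets X \<S>"
    and basic: "\<And>A. A \<in> \<S> \<Longrightarrow> P A" and empty: "P {}"
    and compl: "\<And>A. A \<in> sigma_sets X \<S> \<Longrightarrow> P A \<Longrightarrow> P (X - A)"
    and un: "\<And>A B. A \<in> sigma_sets X \<S> \<Longrightarrow> B \<in> sigma_sets X \<S> \<Longrightarrow> P A \<Longrightarrow> P B \<Longrightarrow> P (A \<union> B)"
  shows "P A"
  using A
proof induction
  case (Union a)
  interpret algebra X "sigma_sets X \<S>" by (rule algebra_sigma_sets[OF S(1)])
  have "range a \<subseteq> sigma_sets X \<S>" using Union.hyps by blast
  then have "finite (range a)" by (rule finite_subset[OF _ finite_sigma_sets[OF S]])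
  moreover have "P (\<Union>C)" if "finite C" "C \<subseteq> range a" for C
    using that
  proof (induction C rule: finite_induct)
    case (insert B C)
    have "P (B \<union> \<Union>C)"
    proof (rule un)
      show "B \<in> sigma_sets X \<S>" "P B" using insert Union by auto
      show "\<Union>C \<in> sigma_sets X \<S>" using insert Union.hyps by (intro finite_Union) auto
      show "P (\<Union>C)" using insert by simp
    qed
    then show ?case by simp
  qed (simp add: empty)
  ultimately have "P (\<Union>(range a))" by blast
  then show ?case by simp
qed (use basic empty compl in auto)

text \<open>\<open>c\<close> is a subadditive error attached to sets, so merging cells cannot raise
  the total. Both sums in \<open>Hom\<close> have this form, which lets its bounds pass to coarser
  families.\<close>

lemma sum_coarser_le:
  fixes c :: "'a set \<Rightarrow> real"
  assumes P: "partition_on X \<P>" "finite \<P>" and R: "finite \<R>" "disjoint \<R>"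
    and un: "\<And>A. A \<in> \<R> \<Longrightarrow> A = \<Union>{B \<in> \<P>. B \<subseteq> A}"
    and nonneg: "\<And>B. B \<in> \<P> \<Longrightarrow> 0 \<le> c B"
    and sub: "\<And>\<C>. \<C> \<subseteq> \<P> \<Longrightarrow> c (\<Union>\<C>) \<le> (\<Sum>B\<in>\<C>. c B)"
  shows "(\<Sum>A\<in>\<R>. c A) \<le> (\<Sum>B\<in>\<P>. c B)"
proof -
  have "(\<Sum>A\<in>\<R>. c A) \<le> (\<Sum>A\<in>\<R>. \<Sum>B\<in>{B \<in> \<P>. B \<subseteq> A}. c B)"
  proof (rule sum_mono)
    fix A assume "A \<in> \<R>"
    then show "c A \<le> (\<Sum>B\<in>{B \<in> \<P>. B \<subseteq> A}. c B)" using sub[of "{B \<in> \<P>. B \<subseteq> A}"] un[of A] by simp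
  qed
  also have "\<dots> = (\<Sum>B\<in>(\<Union>A\<in>\<R>. {B \<in> \<P>. B \<subseteq> A}). c B)"
  proof (rule sum.UNION_disjoint[symmetric])
    show "\<forall>i\<in>\<R>. \<forall>j\<in>\<R>. i \<noteq> j \<longrightarrow> {B \<in> \<P>. B \<subseteq> i} \<inter> {B \<in> \<P>. B \<subseteq> j} = {}"
    proof (intro ballI impI)
      fix i j assume "i \<in> \<R>" "j \<in> \<R>" "i \<noteq> j"
      then have "i \<inter> j = {}" using R(2) by (auto dest: disjointD)
      then show "{B \<in> \<P>. B \<subseteq> i} \<inter> {B \<in> \<P>. B \<subseteq> j} = {}"
      proof -
        have "B = {}" if "B \<subseteq> i" "B \<subseteq> j" for B using that \<open>i \<inter> j = {}\<close> by blast
        then show ?thesis using partition_onD3[OF P(1)] by blast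
      qed
    qed
  qed (use P R in auto)
  also have "\<dots> \<le> (\<Sum>B\<in>\<P>. c B)" using P nonneg by (intro sum_mono2) auto
  finally show ?thesis .
qed

lemma refines_Union:
  assumes ref: "refines X \<P> \<Q>" and A: "A \<in> \<Q>"
  shows "A = \<Union>{B \<in> \<P>. B \<subseteq> A}"
proof (intro equalityI subsetI)
  fix x assume x: "x \<in> A"
  then have "x \<in> X" using ref A unfolding refines_def by (auto dest: partition_onD1)
  then have "x \<in> \<Union>\<P>" using ref unfolding refines_def by (auto dest: partition_onD1)
  then obtain B where B: "B \<in> \<P>" "x \<in> B" by blast
  then obtain A' where A': "A' \<in> \<Q>" "B \<subseteq> A'" using ref unfolding refines_def by blast
  then have "A' = A" using partition_on_disjoint[of X \<Q> A' A x] ref A x B unfolding refines_def by blast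
  then show "x \<in> \<Union>{B \<in> \<P>. B \<subseteq> A}" using A' B by blast
qed blast

lemma sigma_sets_refines:
  assumes ref: "refines X \<P> \<Q>" and fin: "finite \<P>"
  shows "sigma_sets X \<Q> \<subseteq> sigma_sets X \<P>"
proof (rule sigma_sets_mono)
  have "\<P> \<subseteq> Pow X" using ref unfolding refines_def by (auto dest: partition_onD1)
  then interpret algebra X "sigma_sets X \<P>" by (rule algebra_sigma_sets)
  show "\<Q> \<subseteq> sigma_sets X \<P>"
  proof
    fix A assume "A \<in> \<Q>"
    moreover have "\<Union>{B \<in> \<P>. B \<subseteq> A} \<in> sigma_sets X \<P>" using fin by (intro finite_Union) auto
    ultimately show "A \<in> sigma_sets X \<P>" using refines_Union[OF ref] by simp
  qed
qed

lemma refines_if_sigma_sets: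
  assumes R: "partition_on X \<R>" and Q: "partition_on X \<Q>" and sub: "\<Q> \<subseteq> sigma_sets X \<R>"
  shows "refines X \<R> \<Q>"
  unfolding refines_def
proof (intro conjI R Q ballI)
  fix A assume A: "A \<in> \<R>"
  then obtain x where x: "x \<in> A" using partition_onD3[OF R] by (metis ex_in_conv)
  then have "x \<in> X" using A partition_onD1[OF R] by blast
  then obtain q where q: "q \<in> \<Q>" "x \<in> q" using partition_onD1[OF Q] by blast
  then have "q = \<Union>{B \<in> \<R>. B \<subseteq> q}" using sub by (intro sigma_sets_partition_Union[OF R]) blast
  then obtain B where B: "B \<in> \<R>" "B \<subseteq> q" "x \<in> B" using q(2) by blast
  have "A = B" by (rule partition_on_disjoint[OF R A B(1) x B(3)])
  then show "\<exists>Y\<in>\<Q>. A \<subseteq> Y" using B(2) q(1) by blast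
qed

lemma sym_diff_UN: "sym_diff (\<Union>i\<in>I. f i) (\<Union>i\<in>I. g i) \<subseteq> (\<Union>i\<in>I. sym_diff (f i) (g i))"
  by blast

lemma common_refinement_algebra:
  assumes "algebra X \<A>" and P: "\<P> \<in> finite_partitions X \<A>" and Q: "\<Q> \<in> finite_partitions X \<A>"
  obtains \<R> where "\<R> \<in> finite_partitions X \<A>" "refines X \<R> \<P>" "refines X \<R> \<Q>"
proof -
  interpret algebra X \<A> by fact
  note p = P[unfolded finite_partitions_def mem_Collect_eq] Q[unfolded finite_partitions_def mem_Collect_eq]
  define \<R> where "\<R> = {A \<inter> B | A B. A \<in> \<P> \<and> B \<in> \<Q> \<and> A \<inter> B \<noteq> {}}"
  have part: "partition_on X \<R>"
  proof (rule partition_onI)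
    show "\<Union>\<R> = X"
    proof (intro equalityI subsetI)
      fix x assume "x \<in> X"
      then obtain A B where "A \<in> \<P>" "x \<in> A" "B \<in> \<Q>" "x \<in> B"
        using p by (metis UnionE partition_onD1)
      then show "x \<in> \<Union>\<R>" unfolding \<R>_def by blast
    qed (use p in \<open>auto simp: \<R>_def dest: partition_onD1\<close>)
    fix C C' assume "C \<in> \<R>" "C' \<in> \<R>" and ne: "C \<noteq> C'"
    then obtain A B A' B' where C: "C = A \<inter> B" "A \<in> \<P>" "B \<in> \<Q>" and C': "C' = A' \<inter> B'" "A' \<in> \<P>" "B' \<in> \<Q>"
      unfolding \<R>_def by blast
    show "disjnt C C'"
    proof (rule ccontr)
      assume "\<not> disjnt C C'"
      then obtain x where "x \<in> A" "x \<in> B" "x \<in> A'" "x \<in> B'" using C C' by (auto simp: disjnt_def)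
      then have "A = A'" "B = B'"
        using partition_on_disjoint[of X \<P> A A' x] partition_on_disjoint[of X \<Q> B B' x] p C C' by blast+
      then show False using ne C C' by simp
    qed
  qed (auto simp: \<R>_def)
  have "\<R> \<subseteq> (\<lambda>(A, B). A \<inter> B) ` (\<P> \<times> \<Q>)" unfolding \<R>_def by auto
  then have "finite \<R>" by (rule finite_subset) (use p in simp)
  moreover have "\<R> \<subseteq> \<A>" unfolding \<R>_def using p by auto
  ultimately have "\<R> \<in> finite_partitions X \<A>" using part by (simp add: finite_partitions_def)
  moreover have "refines X \<R> \<P>" "refines X \<R> \<Q>"
    unfolding refines_def using part p by (auto simp: \<R>_def)
  ultimately show thesis by (rule that)
qed

section \<open>Set homomorphisms\<close>

locale set_hom = algebra X \<A> for X :: "'a set" and \<A> +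
  fixes Y :: "'b set" and \<phi> :: "'a set \<Rightarrow> 'b set"
  assumes hom: "\<phi> \<in> set_homs X \<A> Y"
begin

lemma hom_empty: "\<phi> {} = {}" and hom_top: "\<phi> X = Y"
  and hom_Un: "A \<in> \<A> \<Longrightarrow> B \<in> \<A> \<Longrightarrow> \<phi> (A \<union> B) = \<phi> A \<union> \<phi> B"
  and hom_Int: "A \<in> \<A> \<Longrightarrow> B \<in> \<A> \<Longrightarrow> \<phi> (A \<inter> B) = \<phi> A \<inter> \<phi> B"
  using hom unfolding set_homs_def by blast+

lemma hom_subset: "A \<in> \<A> \<Longrightarrow> \<phi> A \<subseteq> Y"
  using hom unfolding set_homs_def by (auto simp: PiE_iff)

text \<open>Homomorphisms are asked to respect unions and intersections; one identity of each kind
  pins down the relative complement.\<close>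

lemma hom_Diff:
  assumes "A \<in> \<A>" "B \<in> \<A>"
  shows "\<phi> (A - B) = \<phi> A - \<phi> B"
proof -
  have AB: "A - B \<in> \<A>" "A \<inter> B \<in> \<A>" using assms by auto
  have "\<phi> (A - B) \<union> \<phi> A \<inter> \<phi> B = \<phi> A"
  proof -
    have "(A - B) \<union> (A \<inter> B) = A" by blast
    then show ?thesis using hom_Un[OF AB] hom_Int[OF assms] by simp
  qed
  moreover have "\<phi> (A - B) \<inter> \<phi> B = {}"
  proof -
    have "(A - B) \<inter> B = {}" by blast
    then show ?thesis using hom_Int[OF AB(1) assms(2)] hom_empty by simp
  qed
  ultimately show ?thesis by blast
qed

lemma hom_sym_diff: "A \<in> \<A> \<Longrightarrow> B \<in> \<A> \<Longrightarrow> \<phi> (sym_diff A B) = sym_diff (\<phi> A) (\<phi> B)"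
  by (simp add: hom_Un hom_Diff Diff)

lemma hom_Union: "finite \<C> \<Longrightarrow> \<C> \<subseteq> \<A> \<Longrightarrow> \<phi> (\<Union>\<C>) = (\<Union>B\<in>\<C>. \<phi> B)"
proof (induction \<C> rule: finite_induct)
  case (insert B \<C>)
  then have "\<Union>\<C> \<in> \<A>" by (intro finite_Union) auto
  then show ?case using insert hom_Un[of B "\<Union>\<C>"] by simp
qed (simp add: hom_empty)

lemma hom_restrict:
  assumes "algebra X \<B>" "\<B> \<subseteq> \<A>"
  shows "restrict \<phi> \<B> \<in> set_homs X \<B> Y"
proof -
  interpret B: algebra X \<B> by fact
  show ?thesis
    unfolding set_homs_def mem_Collect_eq
  proof (intro conjI ballI)
    show "restrict \<phi> \<B> \<in> \<B> \<rightarrow>\<^sub>E Pow Y" using hom_subset assms(2) by auto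
    fix A B assume "A \<in> \<B>" "B \<in> \<B>"
    then show "restrict \<phi> \<B> (A \<union> B) = restrict \<phi> \<B> A \<union> restrict \<phi> \<B> B"
      "restrict \<phi> \<B> (A \<inter> B) = restrict \<phi> \<B> A \<inter> restrict \<phi> \<B> B"
      using hom_Un[of A B] hom_Int[of A B] assms(2) by auto
  qed (use hom_empty hom_top assms in auto)
qed

text \<open>Preimages under a point map commute with unions and intersections, so an exact
  homomorphism results however far \<open>\<kappa>\<close> is from the identity.\<close>

lemma hom_vimage:
  assumes "algebra X \<B>" and \<kappa>: "\<kappa> \<in> X \<rightarrow> X" and meas: "\<And>B. B \<in> \<B> \<Longrightarrow> \<kappa> -` B \<inter> X \<in> \<A>"
  shows "(\<lambda>B\<in>\<B>. \<phi> (\<kappa> -` B \<inter> X)) \<in> set_homs X \<B> Y"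
proof -
  interpret B: algebra X \<B> by fact
  have "\<kappa> -` X \<inter> X = X" using \<kappa> by auto
  moreover have "\<kappa> -` (A \<union> B) \<inter> X = (\<kappa> -` A \<inter> X) \<union> (\<kappa> -` B \<inter> X)"
    "\<kappa> -` (A \<inter> B) \<inter> X = (\<kappa> -` A \<inter> X) \<inter> (\<kappa> -` B \<inter> X)" for A B by auto
  ultimately show ?thesis
    unfolding set_homs_def using hom_subset meas hom_Un hom_Int hom_empty hom_top by auto
qed

end

lemma set_homI: "algebra X \<A> \<Longrightarrow> \<phi> \<in> set_homs X \<A> Y \<Longrightarrow> set_hom X \<A> Y \<phi>"
  by (simp add: set_hom_def set_hom_axioms_def)

section \<open>Finite partial bijections\<close>

lemma card_norm_mono: "finite B \<Longrightarrow> A \<subseteq> B \<Longrightarrow> card_norm d A \<le> card_norm d B"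
  unfolding card_norm_def by (intro divide_right_mono) (auto intro: card_mono)

lemma card_norm_nonneg: "0 \<le> card_norm d A" and card_norm_empty: "card_norm d {} = 0"
  by (simp_all add: card_norm_def)

lemma card_norm_Un: "card_norm d (A \<union> B) \<le> card_norm d A + card_norm d B"
proof -
  have "card (A \<union> B) \<le> card A + card B" by (rule card_Un_le)
  then have "real (card (A \<union> B)) \<le> real (card A) + real (card B)" by linarith
  then show ?thesis unfolding card_norm_def add_divide_distrib[symmetric] by (intro divide_right_mono) auto
qed

lemma card_norm_UN: "finite I \<Longrightarrow> card_norm d (\<Union>i\<in>I. A i) \<le> (\<Sum>i\<in>I. card_norm d (A i))"
proof (induction I rule: finite_induct)
  case (insert i I)
  then show ?case using card_norm_Un[of d "A i" "\<Union>i\<in>I. A i"] by simp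
qed (simp add: card_norm_empty)

lemma card_norm_disjoint_UN:
  assumes "finite I" "\<And>i. i \<in> I \<Longrightarrow> finite (A i)" "\<And>i j. i \<in> I \<Longrightarrow> j \<in> I \<Longrightarrow> i \<noteq> j \<Longrightarrow> A i \<inter> A j = {}"
  shows "card_norm d (\<Union>i\<in>I. A i) = (\<Sum>i\<in>I. card_norm d (A i))"
proof -
  have "card (\<Union>i\<in>I. A i) = (\<Sum>i\<in>I. card (A i))" using assms by (intro card_UN_disjoint) auto
  then show ?thesis unfolding card_norm_def by (simp add: sum_divide_distrib)
qed

lemma full_semigroup_DeltaD:
  assumes "s \<in> full_semigroup (Delta d)"
  shows "s \<subseteq> {1..d} \<times> {1..d}"
    and "(i, j) \<in> s \<Longrightarrow> (i', j) \<in> s \<Longrightarrow> i = i'"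
    and "(i, j) \<in> s \<Longrightarrow> (i, j') \<in> s \<Longrightarrow> j = j'"
proof -
  have s: "s \<in> sets (borel_str (Delta d))" "inj_on (src (Delta d)) s" "inj_on (rng (Delta d)) s"
    using assms unfolding full_semigroup_def borel_iso_onto_image_def by auto
  show "s \<subseteq> {1..d} \<times> {1..d}" using s(1) by (simp add: Delta_def)
  show "(i, j) \<in> s \<Longrightarrow> (i', j) \<in> s \<Longrightarrow> i = i'" using inj_onD[OF s(2), of "(i, j)" "(i', j)"] by (simp add: Delta_def)
  show "(i, j) \<in> s \<Longrightarrow> (i, j') \<in> s \<Longrightarrow> j = j'" using inj_onD[OF s(3), of "(i, j)" "(i, j')"] by (simp add: Delta_def)
qed

lemma act_d_UN: "act_d s (\<Union>A\<in>I. f A) = (\<Union>A\<in>I. act_d s (f A))"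
  and act_d_Un: "act_d s (A \<union> B) = act_d s A \<union> act_d s B"
  and act_d_empty: "act_d s {} = {}"
  by (auto simp: act_d_def)

lemma act_d_Diff:
  assumes "s \<in> full_semigroup (Delta d)"
  shows "act_d s (A - B) = act_d s A - act_d s B"
  using full_semigroup_DeltaD(3)[OF assms] by (auto simp: act_d_def)

lemma act_d_subset: "s \<in> full_semigroup (Delta d) \<Longrightarrow> act_d s A \<subseteq> {1..d}"
  using full_semigroup_DeltaD(1) by (fastforce simp: act_d_def)

lemma card_norm_act_d:
  assumes s: "s \<in> full_semigroup (Delta d)" and A: "finite A"
  shows "card_norm d (act_d s A) \<le> card_norm d A"
proof -
  define f where "f j = (THE i. (i, j) \<in> s)" for j
  have "f j = i" if "(i, j) \<in> s" for i j
    unfolding f_def using that full_semigroup_DeltaD(2)[OF s] by (intro the_equality) auto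
  then have "act_d s A \<subseteq> f ` A" by (fastforce simp: act_d_def)
  then have "card (act_d s A) \<le> card A" using A by (meson card_image_le card_mono finite_imageI le_trans)
  then show ?thesis unfolding card_norm_def by (intro divide_right_mono) auto
qed

lemma card_norm_act_d_sym_diff:
  assumes s: "s \<in> full_semigroup (Delta d)" and "finite A" "finite B"
  shows "card_norm d (sym_diff (act_d s A) (act_d s B)) \<le> card_norm d (sym_diff A B)"
  using card_norm_act_d[OF s, of "sym_diff A B"] assms by (simp add: act_d_Diff[OF s] act_d_Un)

lemma act_d_set_mult:
  assumes "s \<in> full_semigroup (Delta d)" "t \<in> full_semigroup (Delta d)"
  shows "act_d (set_mult (Delta d) s t) A = act_d s (act_d t A)"
proof -
  have "set_mult (Delta d) s t = s O t"
    by (fastforce simp: set_mult_def Delta_def)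
  then show ?thesis by (auto simp: act_d_def)
qed

text \<open>A point on which the two images differ is the first component of a pair in only one of
  the relations. Thus almost multiplicativity of \<open>\<sigma>\<close> controls the action on all
  sets \<open>A\<close> uniformly.\<close>

lemma card_norm_act_d_sym_diff':
  assumes "finite s" "finite t"
  shows "card_norm d (sym_diff (act_d s A) (act_d t A)) \<le> card_norm d (sym_diff s t)"
proof -
  have "sym_diff (act_d s A) (act_d t A) \<subseteq> fst ` sym_diff s t" by (force simp: act_d_def)
  then have "card (sym_diff (act_d s A) (act_d t A)) \<le> card (sym_diff s t)"
    using assms by (meson card_image_le card_mono finite_Diff finite_UnI finite_imageI le_trans)
  then show ?thesis unfolding card_norm_def by (intro divide_right_mono) auto
qed

section \<open>Limits, norms and counting\<close>

lemma ereal_le_add_iff_minus: "x - ereal e \<le> y \<longleftrightarrow> x \<le> y + ereal e"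
  by (cases x; cases y) auto

text \<open>For a level \<open>c\<close> strictly between lower and upper limit the ultrafilter
  decides whether \<open>\<Phi> j \<le> c\<close>, and either answer is contradictory. Ultralimits
  can thus be treated as upper limits.\<close>

lemma Lim_ultrafilter:
  fixes \<Phi> :: "'j \<Rightarrow> ereal"
  assumes U: "ultrafilter_on J U"
  shows "Lim U \<Phi> = Limsup U \<Phi>"
proof -
  have ne: "U \<noteq> bot" and dec: "eventually P U \<or> eventually (\<lambda>j. \<not> P j) U" for P
    using U by (auto simp: ultrafilter_on_def)
  have "Limsup U \<Phi> \<le> Liminf U \<Phi>"
  proof (rule ccontr)
    assume "\<not> ?thesis"
    then obtain c where c: "Liminf U \<Phi> < c" "c < Limsup U \<Phi>" using dense by (meson not_le)
    from dec[of "\<lambda>j. \<Phi> j \<le> c"] show False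
    proof
      assume "eventually (\<lambda>j. \<Phi> j \<le> c) U"
      then have "Limsup U \<Phi> \<le> c" by (rule Limsup_bounded)
      with c show False by simp
    next
      assume "eventually (\<lambda>j. \<not> \<Phi> j \<le> c) U"
      then have "eventually (\<lambda>j. c \<le> \<Phi> j) U" by (rule eventually_mono) simp
      then have "c \<le> Liminf U \<Phi>" by (rule Liminf_bounded)
      with c show False by simp
    qed
  qed
  then have "Liminf U \<Phi> = Limsup U \<Phi>" using Liminf_le_Limsup[OF ne, of \<Phi>] by simp
  then have "(\<Phi> \<longlongrightarrow> Limsup U \<Phi>) U" by (intro Liminf_eq_Limsup ne) simp_all
  then show ?thesis by (rule tendsto_Lim[OF ne])
qed

text \<open>Every bias amounts to a lower or upper limit along a filter that contains the tails, and
  both kinds of limit commute with adding a finite constant.\<close>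

lemma bias_lim_le:
  assumes J: "directed_set J le" and \<beta>: "bias_for J le \<beta>"
    and ev: "eventually (\<lambda>j. \<Phi> j \<le> \<Psi> j + ereal c) (tails J le)"
  shows "bias_lim J le \<beta> \<Phi> \<le> bias_lim J le \<beta> \<Psi> + ereal c"
proof -
  have tails: "tails J le \<noteq> bot"
    unfolding trivial_limit_def eventually_tails[OF J] using J unfolding directed_set_def by blast
  show ?thesis
  proof (cases \<beta>)
    case Minus
    have "Liminf (tails J le) \<Phi> \<le> Liminf (tails J le) (\<lambda>j. \<Psi> j + ereal c)" by (rule Liminf_mono[OF ev])
    then show ?thesis using Liminf_add_ereal_right[OF tails, of "ereal c" \<Psi>] Minus by (simp add: bias_lim_def)
  next
    case Plus
    have "Limsup (tails J le) \<Phi> \<le> Limsup (tails J le) (\<lambda>j. \<Psi> j + ereal c)" by (rule Limsup_mono[OF ev])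
    then show ?thesis using Limsup_add_ereal_right[OF tails, of "ereal c" \<Psi>] Plus by (simp add: bias_lim_def)
  next
    case (Ultra U)
    then have U: "ultrafilter_on J U" "\<And>j. j \<in> J \<Longrightarrow> eventually (\<lambda>j'. j' \<in> J \<and> le j j') U"
      using \<beta> by (simp_all add: bias_for_def)
    then have ne: "U \<noteq> bot" by (simp add: ultrafilter_on_def)
    obtain j where j: "j \<in> J" "\<And>j'. j' \<in> J \<Longrightarrow> le j j' \<Longrightarrow> \<Phi> j' \<le> \<Psi> j' + ereal c"
      using ev unfolding eventually_tails[OF J] by blast
    have "eventually (\<lambda>j. \<Phi> j \<le> \<Psi> j + ereal c) U"
      using U(2)[OF j(1)] by (rule eventually_mono) (use j(2) in blast)
    then have "Limsup U \<Phi> \<le> Limsup U (\<lambda>j. \<Psi> j + ereal c)" by (rule Limsup_mono)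
    then show ?thesis
      using Limsup_add_ereal_right[OF ne, of "ereal c" \<Psi>] Ultra Lim_ultrafilter[OF U(1)]
      by (simp add: bias_lim_def)
  qed
qed

text \<open>The pointwise bound is asked almost everywhere because multiplicativity of
  \<open>\<sigma>\<close> is available in that form.\<close>

lemma Lp_norm_le_cmult:
  assumes f: "f \<in> borel_measurable M" and g: "g \<in> borel_measurable M"
    and c: "0 < c" and p: "1 \<le> p" and le: "AE x in M. \<bar>f x\<bar> \<le> c * \<bar>g x\<bar>"
  shows "Lp_norm p M f \<le> ennreal c * Lp_norm p M g"
proof (cases "p = \<infinity>")
  case True
  have "AE x in M. ennreal \<bar>f x\<bar> \<le> ennreal c * esssup M (\<lambda>x. ennreal \<bar>g x\<bar>)"
    using le esssup_AE[of "\<lambda>x. ennreal \<bar>g x\<bar>" M]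
  proof eventually_elim
    fix x assume "\<bar>f x\<bar> \<le> c * \<bar>g x\<bar>" "ennreal \<bar>g x\<bar> \<le> esssup M (\<lambda>x. ennreal \<bar>g x\<bar>)"
    then have "ennreal \<bar>f x\<bar> \<le> ennreal c * ennreal \<bar>g x\<bar>"
      using c by (subst ennreal_mult[symmetric]) (auto intro: ennreal_leI)
    also have "\<dots> \<le> ennreal c * esssup M (\<lambda>x. ennreal \<bar>g x\<bar>)" by (rule mult_left_mono) (fact, simp)
    finally show "ennreal \<bar>f x\<bar> \<le> ennreal c * esssup M (\<lambda>x. ennreal \<bar>g x\<bar>)" .
  qed
  moreover have "(\<lambda>x. ennreal \<bar>f x\<bar>) \<in> borel_measurable M" using f by measurable
  ultimately show ?thesis using True by (simp add: Lp_norm_def esssup_I)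
next
  case False
  define q where "q = enn2real p"
  have "p = ennreal q" using False by (simp add: q_def less_top)
  then have "ennreal 1 \<le> ennreal q" using p by simp
  then have q: "1 \<le> q" by (auto simp: ennreal_le_iff2)
  define I where "I h = (\<integral>\<^sup>+ x. ennreal (\<bar>h x\<bar> powr q) \<partial>M)" for h :: "'a \<Rightarrow> real"
  have norm: "Lp_norm p M h = (if I h = \<infinity> then \<infinity> else ennreal (enn2real (I h) powr (1 / q)))" for h
    using False by (simp add: Lp_norm_def I_def q_def Let_def)
  have "I f \<le> (\<integral>\<^sup>+ x. ennreal (c powr q) * ennreal (\<bar>g x\<bar> powr q) \<partial>M)"
    unfolding I_def
  proof (rule nn_integral_mono_AE)
    show "AE x in M. ennreal (\<bar>f x\<bar> powr q) \<le> ennreal (c powr q) * ennreal (\<bar>g x\<bar> powr q)"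
      using le
    proof eventually_elim
      fix x assume "\<bar>f x\<bar> \<le> c * \<bar>g x\<bar>"
      then have "\<bar>f x\<bar> powr q \<le> (c * \<bar>g x\<bar>) powr q" using q by (intro powr_mono2) auto
      also have "\<dots> = c powr q * \<bar>g x\<bar> powr q" using c by (simp add: powr_mult)
      finally show "ennreal (\<bar>f x\<bar> powr q) \<le> ennreal (c powr q) * ennreal (\<bar>g x\<bar> powr q)"
        by (subst ennreal_mult[symmetric]) (auto intro: ennreal_leI)
    qed
  qed
  also have "\<dots> = ennreal (c powr q) * I g"
    unfolding I_def using g by (intro nn_integral_cmult) measurable
  finally have I: "I f \<le> ennreal (c powr q) * I g" .
  show ?thesis
  proof (cases "I g = \<infinity>")
    case True
    then show ?thesis using c unfolding norm by (simp add: ennreal_mult_eq_top_iff)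
  next
    case fin: False
    then have "I f \<noteq> \<infinity>" using I by (auto simp: ennreal_mult_eq_top_iff top_unique)
    have "enn2real (I f) \<le> enn2real (ennreal (c powr q) * I g)"
      using I fin by (intro enn2real_mono) (auto simp: ennreal_mult_less_top less_top)
    also have "\<dots> = c powr q * enn2real (I g)" by (simp add: enn2real_mult)
    finally have "enn2real (I f) powr (1 / q) \<le> (c powr q * enn2real (I g)) powr (1 / q)"
      using q by (intro powr_mono2) auto
    also have "\<dots> = c * enn2real (I g) powr (1 / q)"
      using c q by (simp add: powr_mult powr_powr)
    finally have "ennreal (enn2real (I f) powr (1 / q)) \<le> ennreal c * ennreal (enn2real (I g) powr (1 / q))"
      using c by (subst ennreal_mult[symmetric]) (auto intro: ennreal_leI)
    then show ?thesis using fin \<open>I f \<noteq> \<infinity>\<close> unfolding norm by simp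
  qed
qed

lemma log_ennreal_le:
  assumes "x \<le> ennreal (exp c) * y"
  shows "log_ennreal x \<le> log_ennreal y + ereal c"
proof (cases "x = 0 \<or> y = \<infinity>")
  case True
  then show ?thesis by (auto simp: log_ennreal_def)
next
  case False
  then have x: "x \<noteq> 0" and y: "y \<noteq> \<infinity>" by auto
  have y0: "y \<noteq> 0" using assms x by auto
  have "x \<noteq> \<infinity>" using assms y by (auto simp: ennreal_mult_eq_top_iff top_unique)
  obtain a b where ab: "x = ennreal a" "0 < a" "y = ennreal b" "0 < b"
    using x y y0 \<open>x \<noteq> \<infinity>\<close> by (metis ennreal_cases ennreal_eq_zero_iff infinity_ennreal_def less_eq_real_def)
  then have "a \<le> exp c * b" using assms by (simp add: ennreal_mult[symmetric])
  then have "ln a \<le> ln (exp c * b)" using ab by (simp add: ln_le_cancel_iff)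
  also have "\<dots> = ln b + c" using ab by (simp add: ln_mult)
  finally show ?thesis using ab x y y0 \<open>x \<noteq> \<infinity>\<close> by (simp add: log_ennreal_def)
qed

lemma normalized_log_le:
  assumes "x \<le> ennreal (exp (c * real n)) * y" "0 < n"
  shows "ereal (1 / real n) * log_ennreal x \<le> ereal (1 / real n) * log_ennreal y + ereal c"
proof -
  have "ereal (1 / real n) * log_ennreal x \<le> ereal (1 / real n) * (log_ennreal y + ereal (c * real n))"
    using log_ennreal_le[OF assms(1)] by (intro ereal_mult_left_mono) auto
  also have "\<dots> = ereal (1 / real n) * log_ennreal y + ereal c"
    using assms(2) by (cases "log_ennreal y") (auto simp: field_simps)
  finally show ?thesis .
qed

text \<open>Weight each subset \<open>S\<close> by \<open>x ^ card S\<close>; the total weight is \<open>(1 + x) ^ d\<close>.\<close>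

lemma card_small_subsets:
  assumes x: "0 < x" "x \<le> 1"
  shows "real (card {S \<in> Pow {1..d}. card_norm d S \<le> \<eta>}) \<le> exp ((x + \<eta> * ln (1 / x)) * real d)"
proof (cases "d = 0")
  case True
  have "{S \<in> Pow {1..d}. card_norm d S \<le> \<eta>} \<subseteq> {{}}" using True by auto
  then have "card {S \<in> Pow {1..d}. card_norm d S \<le> \<eta>} \<le> card {{} :: nat set}" by (intro card_mono) auto
  then show ?thesis using True by simp
next
  case False
  let ?S = "{S \<in> Pow {1..d}. card_norm d S \<le> \<eta>}"
  have "real (card ?S) * x powr (\<eta> * real d) = (\<Sum>S\<in>?S. x powr (\<eta> * real d))" by simp
  also have "\<dots> \<le> (\<Sum>S\<in>?S. x ^ card S)"
  proof (rule sum_mono)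
    fix S assume "S \<in> ?S"
    then have "real (card S) \<le> \<eta> * real d" using False by (simp add: card_norm_def field_simps)
    \<comment> \<open>Since \<open>x \<le> 1\<close>, smaller sets carry larger weight.\<close>
    then have "x powr (\<eta> * real d) \<le> x powr real (card S)" using x by (intro powr_mono') auto
    then show "x powr (\<eta> * real d) \<le> x ^ card S" using x by (simp add: powr_realpow)
  qed
  also have "\<dots> \<le> (\<Sum>S\<in>Pow {1..d}. x ^ card S)" using x by (intro sum_mono2) auto
  also have "\<dots> = (1 + x) ^ d"
    using prod_add[of "{1..d}" "\<lambda>_. x" "\<lambda>_. 1"] by (simp add: add.commute)
  also have "\<dots> \<le> exp x ^ d" using x by (intro power_mono exp_ge_add_one_self) auto
  also have "\<dots> = exp (x * real d)" by (simp add: exp_of_nat2_mult)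
  finally have "real (card ?S) * x powr (\<eta> * real d) \<le> exp (x * real d)" .
  then have "real (card ?S) \<le> exp (x * real d) / x powr (\<eta> * real d)"
    using x by (simp add: field_simps)
  also have "\<dots> = exp (x * real d - \<eta> * real d * ln x)"
    using x by (simp add: powr_def exp_diff)
  also have "x * real d - \<eta> * real d * ln x = (x + \<eta> * ln (1 / x)) * real d"
    using x by (simp add: ln_div algebra_simps)
  finally show ?thesis .
qed

lemma card_small_subsets_exp:
  assumes "0 < \<epsilon>"
  obtains \<eta> where "0 < \<eta>" "\<And>d. real (card {S \<in> Pow {1..d}. card_norm d S \<le> \<eta>}) \<le> exp (\<epsilon> * real d)"
proof -
  \<comment> \<open>One half of \<open>\<epsilon>\<close> pays for \<open>x\<close>, the other for
    \<open>\<eta> * ln (1 / x)\<close>; the cap \<open>1 / 2\<close> keeps this logarithm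
    positive.\<close>
  define x where "x = min (1 / 2) (\<epsilon> / 2)"
  have x: "0 < x" "x < 1" "x \<le> \<epsilon> / 2" using assms by (auto simp: x_def)
  have l: "0 < ln (1 / x)" using x by simp
  define \<eta> where "\<eta> = \<epsilon> / 2 / ln (1 / x)"
  have "x + \<eta> * ln (1 / x) \<le> \<epsilon>" using x l by (simp add: \<eta>_def)
  then have "exp ((x + \<eta> * ln (1 / x)) * real d) \<le> exp (\<epsilon> * real d)" for d
    by (simp add: mult_right_mono)
  then have "real (card {S \<in> Pow {1..d}. card_norm d S \<le> \<eta>}) \<le> exp (\<epsilon> * real d)" for d
    using card_small_subsets[of x d \<eta>] x by (meson less_imp_le order_trans)
  moreover have "0 < \<eta>" using assms l by (simp add: \<eta>_def)
  ultimately show thesis using that by blast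
qed

lemma (in prob_space) algebra_dense:
  assumes alg: "algebra (space M) \<A>" and sub: "\<A> \<subseteq> sets M"
    and A: "A \<in> sigma_sets (space M) \<A>"
  shows "0 < \<epsilon> \<Longrightarrow> \<exists>B\<in>\<A>. prob (sym_diff A B) < \<epsilon>"
  using A
proof (induction arbitrary: \<epsilon>)
  case (Basic A)
  then show ?case by (intro bexI[of _ A]) auto
next
  case Empty
  interpret A: algebra "space M" \<A> by fact
  show ?case using Empty by (intro bexI[of _ "{}"]) auto
next
  case (Compl A)
  interpret A: algebra "space M" \<A> by fact
  obtain B where B: "B \<in> \<A>" "prob (sym_diff A B) < \<epsilon>" using Compl by blast
  have AB: "A \<subseteq> space M" "B \<subseteq> space M"
    using sigma_sets_into_sp[OF A.space_closed Compl.hyps] B(1) A.space_closed by auto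
  have "sym_diff (space M - A) (space M - B) = sym_diff A B" using AB by blast
  then show ?case using B by (intro bexI[of _ "space M - B"]) auto
next
  case (Union A)
  interpret A: algebra "space M" \<A> by fact
  have sets: "A n \<in> sets M" for n using Union.hyps sets.sigma_sets_subset[OF sub] by blast
  have "(\<lambda>n. prob (\<Union>i\<le>n. A i)) \<longlonglongrightarrow> prob (\<Union>n. \<Union>i\<le>n. A i)"
    using sets by (intro finite_Lim_measure_incseq) (auto simp: incseq_def intro: order_trans)
  also have "(\<Union>n. \<Union>i\<le>n. A i) = (\<Union>n. A n)" by auto
  finally have "eventually (\<lambda>n. prob (\<Union>n. A n) - \<epsilon> / 2 < prob (\<Union>i\<le>n. A i)) sequentially"
    using Union.prems by (intro order_tendstoD) auto
  then obtain n where n: "prob (\<Union>n. A n) - \<epsilon> / 2 < prob (\<Union>i\<le>n. A i)"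
    by (auto simp: eventually_sequentially)
  \<comment> \<open>Half of \<open>\<epsilon>\<close> is lost by truncating the union; the other
    half is divided among the \<open>n + 1\<close> sets that remain.\<close>
  have "\<forall>i. \<exists>B\<in>\<A>. prob (sym_diff (A i) B) < \<epsilon> / 2 / (real n + 1)"
    using Union.IH Union.prems by simp
  then obtain B where B: "\<And>i. B i \<in> \<A>" "\<And>i. prob (sym_diff (A i) (B i)) < \<epsilon> / 2 / (real n + 1)"
    by metis
  have Bs: "B i \<in> sets M" for i using B(1) sub by blast
  have D: "(\<Union>n. A n) - (\<Union>i\<le>n. A i) \<in> sets M" "sym_diff (A i) (B i) \<in> sets M" for i
    using sets Bs by auto
  have U: "(\<Union>i\<le>n. sym_diff (A i) (B i)) \<in> sets M" using D(2) by (intro sets.finite_UN) auto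
  have "prob (sym_diff (\<Union>n. A n) (\<Union>i\<le>n. B i))
      \<le> prob (((\<Union>n. A n) - (\<Union>i\<le>n. A i)) \<union> (\<Union>i\<le>n. sym_diff (A i) (B i)))"
    by (rule finite_measure_mono) (use D(1) U in auto)
  also have "\<dots> \<le> prob ((\<Union>n. A n) - (\<Union>i\<le>n. A i)) + prob (\<Union>i\<le>n. sym_diff (A i) (B i))"
    using D U by (intro measure_Un_le) auto
  also have "prob ((\<Union>n. A n) - (\<Union>i\<le>n. A i)) = prob (\<Union>n. A n) - prob (\<Union>i\<le>n. A i)"
    using sets by (intro finite_measure_Diff) auto
  also have "prob (\<Union>i\<le>n. sym_diff (A i) (B i)) \<le> (\<Sum>i\<le>n. prob (sym_diff (A i) (B i)))"
    using D(2) by (intro finite_measure_subadditive_finite) auto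
  also have "\<dots> \<le> (\<Sum>i\<le>n. \<epsilon> / 2 / (real n + 1))" by (intro sum_mono less_imp_le B(2))
  also have "\<dots> = \<epsilon> / 2" by (simp add: field_simps)
  finally have "prob (sym_diff (\<Union>n. A n) (\<Union>i\<le>n. B i)) < \<epsilon>" using n by linarith
  moreover have "(\<Union>i\<le>n. B i) \<in> \<A>" using B(1) by (intro A.finite_UN) auto
  ultimately show ?case by blast
qed

lemma finite_full_semigroup_Delta: "finite (full_semigroup (Delta d))"
  by (rule finite_subset[of _ "Pow ({1..d} \<times> {1..d})"]) (use full_semigroup_DeltaD(1) in blast, simp)

lemma space_Map_space: "space (Map_space H d) = Map_set H d"
  unfolding Map_space_def by (rule space_measure_of) auto

text \<open>\<open>full_semigroup (Delta d)\<close> is finite, so there are only finitely many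
  cylinders over \<open>F\<close>, and each preimage under \<open>\<Phi>\<close> is a finite union
  of them, even when \<open>full_semigroup H\<close> is uncountable.\<close>

lemma Map_space_measurable:
  fixes \<Phi> :: "('h set \<Rightarrow> (nat \<times> nat) set) \<Rightarrow> 'c"
  assumes F: "finite F" "F \<subseteq> full_semigroup H"
    and dep: "\<And>\<sigma> \<sigma>'. \<sigma> \<in> Map_set H d \<Longrightarrow> \<sigma>' \<in> Map_set H d \<Longrightarrow> (\<And>f. f \<in> F \<Longrightarrow> \<sigma> f = \<sigma>' f) \<Longrightarrow> \<Phi> \<sigma> = \<Phi> \<sigma>'"
  shows "\<Phi> \<in> Map_space H d \<rightarrow>\<^sub>M count_space UNIV"
proof (rule measurableI)
  fix A :: "'c set"
  let ?cyl = "\<lambda>\<sigma>. {\<sigma>' \<in> Map_set H d. \<forall>f\<in>F. \<sigma>' f = \<sigma> f}"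
  let ?gen = "{{\<sigma>' \<in> Map_set H d. \<forall>f\<in>F. \<sigma>' f = \<sigma> f} | \<sigma> F.
        \<sigma> \<in> Map_set H d \<and> finite F \<and> F \<subseteq> full_semigroup H}"
  have sets: "sets (Map_space H d) = sigma_sets (Map_set H d) ?gen"
    unfolding Map_space_def by (rule sets_measure_of) auto
  define C where "C = ?cyl ` {\<sigma> \<in> Map_set H d. \<Phi> \<sigma> \<in> A}"
  have "C \<subseteq> ?cyl ` (F \<rightarrow>\<^sub>E full_semigroup (Delta d))"
  proof
    fix c assume "c \<in> C"
    then obtain \<sigma> where \<sigma>: "\<sigma> \<in> Map_set H d" "c = ?cyl \<sigma>" unfolding C_def by blast
    then have "c = ?cyl (restrict \<sigma> F)" by auto
    moreover have "restrict \<sigma> F \<in> F \<rightarrow>\<^sub>E full_semigroup (Delta d)"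
      using \<sigma>(1) F(2) unfolding Map_set_def by auto
    ultimately show "c \<in> ?cyl ` (F \<rightarrow>\<^sub>E full_semigroup (Delta d))" by blast
  qed
  then have "finite C"
    by (rule finite_subset) (intro finite_imageI finite_PiE F finite_full_semigroup_Delta)
  moreover have "C \<subseteq> sets (Map_space H d)"
    unfolding sets C_def using F by (auto intro!: sigma_sets.Basic)
  ultimately have "\<Union>C \<in> sets (Map_space H d)" by (rule sets.finite_Union)
  moreover have "\<Union>C = \<Phi> -` A \<inter> space (Map_space H d)"
    unfolding space_Map_space C_def
  proof (intro equalityI subsetI)
    fix \<sigma> assume "\<sigma> \<in> \<Union> (?cyl ` {\<sigma> \<in> Map_set H d. \<Phi> \<sigma> \<in> A})"
    then obtain \<sigma>' where \<sigma>': "\<sigma>' \<in> Map_set H d" "\<Phi> \<sigma>' \<in> A" "\<sigma> \<in> ?cyl \<sigma>'" by blast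
    then show "\<sigma> \<in> \<Phi> -` A \<inter> Map_set H d" using dep[of \<sigma> \<sigma>'] by simp
  qed blast
  ultimately show "\<Phi> -` A \<inter> space (Map_space H d) \<in> sets (Map_space H d)" by simp
qed simp

lemma card_image_fibres_le:
  fixes m :: real
  assumes S: "finite S" and "\<And>x. x \<in> S \<Longrightarrow> real (card (q ` {y \<in> S. r y = r x})) \<le> m"
  shows "real (card (q ` S)) \<le> m * real (card (r ` S))"
proof -
  have "q ` S = (\<Union>u\<in>r ` S. q ` {y \<in> S. r y = u})" by auto
  then have "card (q ` S) \<le> (\<Sum>u\<in>r ` S. card (q ` {y \<in> S. r y = u}))"
    using card_UN_le[of "r ` S" "\<lambda>u. q ` {y \<in> S. r y = u}"] S by simp
  then have "real (card (q ` S)) \<le> (\<Sum>u\<in>r ` S. real (card (q ` {y \<in> S. r y = u})))"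
    by (metis of_nat_le_iff of_nat_sum)
  also have "\<dots> \<le> (\<Sum>u\<in>r ` S. m)" using assms(2) by (intro sum_mono) auto
  finally show ?thesis by (simp add: mult.commute)
qed

section \<open>Almost equivariant homomorphisms\<close>

context pmp_extension
begin

abbreviation "X \<equiv> units G"
abbreviation "atoms \<equiv> join_partition G H \<pi>"
abbreviation "defect \<sigma> \<phi> f A \<equiv> sym_diff (act_d (\<sigma> f) (\<phi> A)) (\<phi> (act f A))"
abbreviation "homs \<equiv> Hom G \<mu> H \<pi>"
abbreviation "hom_count \<equiv> Hom_count G \<mu> H \<pi>"
abbreviation "finer \<A> \<Q> \<equiv> {\<P> \<in> finite_partitions X \<A>. refines X \<P> \<Q>}"

definition admissible :: "'h set set \<Rightarrow> bool" where
  "admissible F \<longleftrightarrow> finite F \<and> F \<subseteq> full_semigroup H \<and> units H \<in> F"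

definition gens :: "'g set set \<Rightarrow> 'h set set \<Rightarrow> 'g set set" where
  "gens \<P> F = {act f A | f A. f \<in> F \<and> A \<in> \<P>}"

text \<open>The sigma-algebra \<open>\<Sigma>(\<P>\<^sup>F)\<close>, without the detour over atoms.\<close>

definition Salg :: "'g set set \<Rightarrow> 'h set set \<Rightarrow> 'g set set" where
  "Salg \<P> F = sigma_sets X (gens \<P> F)"

lemma admissibleD:
  assumes "admissible F"
  shows "finite F" "f \<in> F \<Longrightarrow> f \<in> full_semigroup H" "units H \<in> F"
  using assms unfolding admissible_def by blast+

lemma admissible_Un: "admissible F \<Longrightarrow> admissible F' \<Longrightarrow> admissible (F \<union> F')"
  unfolding admissible_def by blast

lemma gens_subset: "gens \<P> F \<subseteq> Pow X"
  using act_units by (auto simp: gens_def)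

lemma gens_image: "gens \<P> F = (\<lambda>(f, A). act f A) ` (F \<times> \<P>)"
  unfolding gens_def by auto

lemma finite_gens: "finite \<P> \<Longrightarrow> finite F \<Longrightarrow> finite (gens \<P> F)"
  unfolding gens_image by simp

lemma algebra_Salg: "algebra X (Salg \<P> F)"
  unfolding Salg_def by (rule algebra_sigma_sets[OF gens_subset])

lemma Salg_gens: "f \<in> F \<Longrightarrow> A \<in> \<P> \<Longrightarrow> act f A \<in> Salg \<P> F"
  unfolding Salg_def gens_def by (intro sigma_sets.Basic) blast

abbreviation partitions :: "'g set set set" where
  "partitions \<equiv> finite_partitions X (sets \<mu>)"

lemma partitionsD:
  assumes "\<P> \<in> partitions"
  shows "partition_on X \<P>" "finite \<P>" "\<P> \<subseteq> sets \<mu>" "A \<in> \<P> \<Longrightarrow> A \<subseteq> X" "\<P> \<subseteq> Pow X"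
  using assms unfolding finite_partitions_def by (auto dest: partition_onD1)

context
  fixes \<P> :: "'g set set" and F :: "'h set set"
  assumes P: "\<P> \<in> partitions" and F: "admissible F"
begin

lemma atoms_eq: "atoms \<P> F = coarsest_partition X (gens \<P> F)"
proof -
  have "{ext_act G H \<pi> f A | f A. f \<in> F \<and> A \<in> \<P>} = (\<lambda>(f, A). ext_act G H \<pi> f A) ` (F \<times> \<P>)"
    by auto
  also have "\<dots> = gens \<P> F"
    unfolding gens_image
  proof (rule image_cong[OF refl])
    fix x assume "x \<in> F \<times> \<P>"
    then show "(case x of (f, A) \<Rightarrow> ext_act G H \<pi> f A) = (case x of (f, A) \<Rightarrow> act f A)"
      using ext_act_eq_act[OF admissibleD(2)[OF F] partitionsD(4)[OF P]] by auto
  qed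
  finally have "{ext_act G H \<pi> f A | f A. f \<in> F \<and> A \<in> \<P>} = gens \<P> F" .
  then show ?thesis by (simp add: join_partition_def)
qed

lemma finite_gens': "finite (gens \<P> F)"
  using finite_gens partitionsD(2)[OF P] admissibleD(1)[OF F] by blast

lemma atoms_on: "partition_on X (atoms \<P> F)"
  unfolding atoms_eq by (rule coarsest_partition_on[OF gens_subset])

lemma finite_atoms: "finite (atoms \<P> F)"
  unfolding atoms_eq by (rule finite_coarsest_partition[OF gens_subset finite_gens'])

lemma sigma_sets_atoms: "sigma_sets X (atoms \<P> F) = Salg \<P> F"
  unfolding atoms_eq Salg_def by (rule sigma_sets_coarsest_partition[OF gens_subset finite_gens'])

lemma finite_Salg: "finite (Salg \<P> F)"
  unfolding Salg_def by (rule finite_sigma_sets[OF gens_subset finite_gens'])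

lemma Salg_sets: "Salg \<P> F \<subseteq> sets \<mu>"
proof -
  have "gens \<P> F \<subseteq> sets \<mu>"
    unfolding gens_def using act_sets admissibleD(2)[OF F] partitionsD(3)[OF P] by blast
  then have "sigma_sets (space \<mu>) (gens \<P> F) \<subseteq> sets \<mu>" by (rule sets.sigma_sets_subset)
  then show ?thesis by (simp only: Salg_def space_\<mu>)
qed

lemma atoms_Salg: "atoms \<P> F \<subseteq> Salg \<P> F"
  unfolding sigma_sets_atoms[symmetric] by (auto intro: sigma_sets.Basic)

lemma partition_Salg: "\<P> \<subseteq> Salg \<P> F"
  using Salg_gens[OF admissibleD(3)[OF F], of _ \<P>] act_unit_arrows partitionsD(4)[OF P] by auto

lemma sigma_sets_Salg: "sigma_sets X \<P> \<subseteq> Salg \<P> F"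
  using partition_Salg unfolding Salg_def by (rule sigma_sets_mono)

lemma Hom_iff:
  "\<phi> \<in> homs d \<sigma> \<P> F \<delta> \<longleftrightarrow> \<phi> \<in> set_homs X (Salg \<P> F) {1..d} \<and>
     (\<forall>f\<in>F. (\<Sum>A\<in>\<P>. card_norm d (defect \<sigma> \<phi> f A)) < \<delta>) \<and>
     (\<Sum>A\<in>atoms \<P> F. \<bar>card_norm d (\<phi> A) - measure \<mu> A\<bar>) < \<delta>"
proof -
  have "(\<Sum>A\<in>\<P>. card_norm d (sym_diff (act_d (\<sigma> f) (\<phi> A)) (\<phi> (ext_act G H \<pi> f A)))) =
      (\<Sum>A\<in>\<P>. card_norm d (defect \<sigma> \<phi> f A))" if "f \<in> F" for f
  proof (rule sum.cong[OF refl])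
    fix A assume "A \<in> \<P>"
    then have "ext_act G H \<pi> f A = act f A"
      by (intro ext_act_eq_act admissibleD(2)[OF F that] partitionsD(4)[OF P])
    then show "card_norm d (sym_diff (act_d (\<sigma> f) (\<phi> A)) (\<phi> (ext_act G H \<pi> f A))) =
        card_norm d (defect \<sigma> \<phi> f A)" by (simp only:)
  qed
  then show ?thesis unfolding Hom_def sigma_sets_atoms mem_Collect_eq by (simp cong: ball_cong)
qed

lemma Hom_set_hom:
  "\<phi> \<in> homs d \<sigma> \<P> F \<delta> \<Longrightarrow> set_hom X (Salg \<P> F) {1..d} \<phi>"
  unfolding Hom_iff by (intro set_homI algebra_Salg) blast

lemma finite_Hom: "finite (homs d \<sigma> \<P> F \<delta>)"
proof (rule finite_subset)
  show "homs d \<sigma> \<P> F \<delta> \<subseteq> Salg \<P> F \<rightarrow>\<^sub>E Pow {1..d}"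
  proof
    fix \<phi> assume "\<phi> \<in> homs d \<sigma> \<P> F \<delta>"
    then have "\<phi> \<in> set_homs X (Salg \<P> F) {1..d}" unfolding Hom_iff by (rule conjunct1)
    then show "\<phi> \<in> Salg \<P> F \<rightarrow>\<^sub>E Pow {1..d}" unfolding set_homs_def mem_Collect_eq by (rule conjunct1)
  qed
qed (intro finite_PiE finite_Salg, simp)

text \<open>A disjoint family in the algebra groups the atoms. Normalized cardinality and measure
  are both additive over atoms, so the triangle inequality bounds the error by the one over all
  atoms.\<close>

lemma Hom_measure_defect:
  assumes \<phi>: "\<phi> \<in> homs d \<sigma> \<P> F \<delta>"
    and R: "finite \<R>" "disjoint \<R>" "\<R> \<subseteq> Salg \<P> F"
  shows "(\<Sum>A\<in>\<R>. \<bar>card_norm d (\<phi> A) - measure \<mu> A\<bar>) < \<delta>"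
proof -
  let ?J = "atoms \<P> F"
  interpret set_hom "X" "Salg \<P> F" "{1..d}" \<phi> by (rule Hom_set_hom[OF \<phi>])
  have "(\<Sum>A\<in>\<R>. \<bar>card_norm d (\<phi> A) - measure \<mu> A\<bar>) \<le> (\<Sum>A\<in>?J. \<bar>card_norm d (\<phi> A) - measure \<mu> A\<bar>)"
  proof (rule sum_coarser_le[OF atoms_on finite_atoms R(1,2)])
    fix A assume "A \<in> \<R>"
    then show "A = \<Union>{B \<in> ?J. B \<subseteq> A}"
      using R(3) sigma_sets_partition_Union[OF atoms_on, of A] unfolding sigma_sets_atoms
      by (simp only: subset_iff)
  next
    fix \<C> assume C: "\<C> \<subseteq> ?J"
    have CS: "\<C> \<subseteq> Salg \<P> F" by (rule order_trans[OF C atoms_Salg])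
    have fin: "finite \<C>" by (rule finite_subset[OF C finite_atoms])
    have disj: "A \<inter> B = {}" if "A \<in> \<C>" "B \<in> \<C>" "A \<noteq> B" for A B
      using partition_on_disjoint[OF atoms_on, of A B] that C by blast
    have "card_norm d (\<phi> (\<Union>\<C>)) = (\<Sum>A\<in>\<C>. card_norm d (\<phi> A))"
      unfolding hom_Union[OF fin CS]
    proof (rule card_norm_disjoint_UN[OF fin])
      show "finite (\<phi> A)" if "A \<in> \<C>" for A
        using hom_subset[of A] that CS finite_subset[of "\<phi> A" "{1..d}"] by blast
      show "\<phi> A \<inter> \<phi> B = {}" if "A \<in> \<C>" "B \<in> \<C>" "A \<noteq> B" for A B
        using hom_Int[of A B] disj[OF that] that CS hom_empty by auto
    qed
    moreover have "measure \<mu> (\<Union>\<C>) = (\<Sum>A\<in>\<C>. measure \<mu> A)"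
    proof -
      have "measure \<mu> (\<Union>A\<in>\<C>. A) = (\<Sum>A\<in>\<C>. measure \<mu> A)"
        by (rule finite_measure_finite_Union[OF fin])
          (use CS Salg_sets disj in \<open>auto simp: disjoint_family_on_def\<close>)
      then show ?thesis by simp
    qed
    ultimately show "\<bar>card_norm d (\<phi> (\<Union>\<C>)) - measure \<mu> (\<Union>\<C>)\<bar> \<le> (\<Sum>A\<in>\<C>. \<bar>card_norm d (\<phi> A) - measure \<mu> A\<bar>)"
      by (simp add: sum_subtractf[symmetric] sum_abs)
  qed simp
  also have "\<dots> < \<delta>" using \<phi> unfolding Hom_iff by blast
  finally show ?thesis .
qed

lemma Hom_measure:
  assumes "\<phi> \<in> homs d \<sigma> \<P> F \<delta>" "A \<in> Salg \<P> F"
  shows "\<bar>card_norm d (\<phi> A) - measure \<mu> A\<bar> < \<delta>"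
  using Hom_measure_defect[OF assms(1), of "{A}"] assms(2) by (simp add: disjoint_def)

lemma Map_set_Delta: "\<sigma> \<in> Map_set H d \<Longrightarrow> f \<in> full_semigroup H \<Longrightarrow> \<sigma> f \<in> full_semigroup (Delta d)"
  unfolding Map_set_def by blast

text \<open>A member of \<open>sigma_sets X \<P>\<close> is a union of cells, and translates of
  cells are generators. For other members of \<open>Salg \<P> F\<close> the translate may leave the
  algebra.\<close>

lemma sigma_sets_act_Salg:
  assumes f: "f \<in> F" and A: "A \<in> sigma_sets X \<P>"
  shows "act f A \<in> Salg \<P> F"
proof -
  interpret algebra "X" "Salg \<P> F" by (rule algebra_Salg)
  have "act f A = act f (\<Union>{B \<in> \<P>. B \<subseteq> A})"
    using sigma_sets_partition_Union[OF partitionsD(1)[OF P] A] by simp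
  also have "\<dots> = (\<Union>B\<in>{B \<in> \<P>. B \<subseteq> A}. act f B)" by (rule act_Union)
  also have "\<dots> \<in> Salg \<P> F"
    using partitionsD(2)[OF P] Salg_gens[OF f] by (intro finite_UN) auto
  finally show ?thesis .
qed

text \<open>The symmetric difference of two unions lies in the union of the symmetric differences,
  so the defects of the cells dominate those of any disjoint family of unions of cells.\<close>

lemma Hom_act_defect:
  assumes \<phi>: "\<phi> \<in> homs d \<sigma> \<P> F \<delta>" and \<sigma>: "\<sigma> \<in> Map_set H d" and f: "f \<in> F"
    and R: "finite \<R>" "disjoint \<R>" "\<R> \<subseteq> sigma_sets X \<P>"
  shows "(\<Sum>A\<in>\<R>. card_norm d (defect \<sigma> \<phi> f A)) < \<delta>"
proof -
  interpret set_hom "X" "Salg \<P> F" "{1..d}" \<phi> by (rule Hom_set_hom[OF \<phi>])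
  have s: "\<sigma> f \<in> full_semigroup (Delta d)" by (rule Map_set_Delta[OF \<sigma> admissibleD(2)[OF F f]])
  let ?D = "\<lambda>A. defect \<sigma> \<phi> f A"
  have "(\<Sum>A\<in>\<R>. card_norm d (?D A)) \<le> (\<Sum>A\<in>\<P>. card_norm d (?D A))"
  proof (rule sum_coarser_le[OF partitionsD(1,2)[OF P] R(1,2)])
    fix A assume "A \<in> \<R>"
    then show "A = \<Union>{B \<in> \<P>. B \<subseteq> A}"
      by (intro sigma_sets_partition_Union[OF partitionsD(1)[OF P]]) (use R(3) in blast)
  next
    fix \<C> assume C: "\<C> \<subseteq> \<P>"
    have CS: "\<C> \<subseteq> Salg \<P> F" by (rule order_trans[OF C partition_Salg])
    have fin: "finite \<C>" by (rule finite_subset[OF C partitionsD(2)[OF P]])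
    have aC: "act f ` \<C> \<subseteq> Salg \<P> F" using Salg_gens[OF f] C by blast
    have "\<phi> (act f (\<Union>\<C>)) = (\<Union>A\<in>\<C>. \<phi> (act f A))"
      unfolding act_Union using hom_Union[OF finite_imageI[OF fin] aC] by simp
    moreover have "act_d (\<sigma> f) (\<phi> (\<Union>\<C>)) = (\<Union>A\<in>\<C>. act_d (\<sigma> f) (\<phi> A))"
      unfolding hom_Union[OF fin CS] act_d_UN ..
    ultimately have "?D (\<Union>\<C>) \<subseteq> (\<Union>A\<in>\<C>. ?D A)" by (simp only: sym_diff_UN)
    moreover have "finite (\<Union>A\<in>\<C>. ?D A)"
    proof (rule finite_subset[of _ "{1..d}"])
      have "?D A \<subseteq> {1..d}" if "A \<in> \<C>" for A
      proof -
        have "act f A \<in> Salg \<P> F" using aC that by blast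
        from hom_subset[OF this] act_d_subset[OF s, of "\<phi> A"] show ?thesis by blast
      qed
      then show "(\<Union>A\<in>\<C>. ?D A) \<subseteq> {1..d}" by (rule UN_least)
    qed simp
    ultimately have "card_norm d (?D (\<Union>\<C>)) \<le> card_norm d (\<Union>A\<in>\<C>. ?D A)" by (rule card_norm_mono[rotated])
    also have "\<dots> \<le> (\<Sum>A\<in>\<C>. card_norm d (?D A))" by (rule card_norm_UN[OF fin])
    finally show "card_norm d (?D (\<Union>\<C>)) \<le> (\<Sum>A\<in>\<C>. card_norm d (?D A))" .
  qed (rule card_norm_nonneg)
  also have "\<dots> < \<delta>" using \<phi> f unfolding Hom_iff by blast
  finally show ?thesis .
qed

lemma Hom_act:
  assumes "\<phi> \<in> homs d \<sigma> \<P> F \<delta>" "\<sigma> \<in> Map_set H d" "f \<in> F" "A \<in> sigma_sets X \<P>"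
  shows "card_norm d (defect \<sigma> \<phi> f A) < \<delta>"
  using Hom_act_defect[OF assms(1-3), of "{A}"] assms(4) by (simp add: disjoint_def)

end

section \<open>Passage to coarser data\<close>

lemma refines_sigma_sets:
  assumes "\<P> \<in> partitions" "refines X \<P> \<Q>"
  shows "sigma_sets X \<Q> \<subseteq> sigma_sets X \<P>"
  using sigma_sets_refines[OF assms(2) partitionsD(2)[OF assms(1)]] .

lemma refines_sigma_setsI:
  assumes "\<P> \<in> partitions" "refines X \<P> \<Q>" "A \<in> \<Q>"
  shows "A \<in> sigma_sets X \<P>"
  by (rule subsetD[OF refines_sigma_sets[OF assms(1,2)] sigma_sets.Basic[OF assms(3)]])

lemma Salg_mono:
  assumes P': "\<P>' \<in> partitions" and F': "admissible F'" and ref: "refines X \<P>' \<P>" and sub: "F \<subseteq> F'"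
  shows "Salg \<P> F \<subseteq> Salg \<P>' F'"
proof -
  have "gens \<P> F \<subseteq> Salg \<P>' F'"
  proof
    fix B assume "B \<in> gens \<P> F"
    then obtain f A where "B = act f A" "f \<in> F" "A \<in> \<P>" unfolding gens_def by blast
    moreover from this have "A \<in> sigma_sets X \<P>'" by (intro refines_sigma_setsI[OF P' ref])
    ultimately show "B \<in> Salg \<P>' F'" using sigma_sets_act_Salg[OF P' F', of f A] sub by blast
  qed
  then show ?thesis unfolding Salg_def by (rule sigma_sets_mono)
qed

text \<open>The sums for \<open>\<P>\<close> and \<open>F\<close> run over disjoint families inside
  the finer algebras, so they are already below \<open>\<delta>'\<close>.\<close>

lemma Hom_restrict:
  assumes P: "\<P> \<in> partitions" and F: "admissible F"
    and P': "\<P>' \<in> partitions" and F': "admissible F'" and ref: "refines X \<P>' \<P>" and sub: "F \<subseteq> F'"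
    and \<sigma>: "\<sigma> \<in> Map_set H d" and \<delta>: "\<delta>' \<le> \<delta>" and \<phi>: "\<phi> \<in> homs d \<sigma> \<P>' F' \<delta>'"
  shows "restrict \<phi> (Salg \<P> F) \<in> homs d \<sigma> \<P> F \<delta>"
proof -
  have S: "Salg \<P> F \<subseteq> Salg \<P>' F'" by (rule Salg_mono[OF P' F' ref sub])
  interpret set_hom "X" "Salg \<P>' F'" "{1..d}" \<phi> by (rule Hom_set_hom[OF P' F' \<phi>])
  have hom: "restrict \<phi> (Salg \<P> F) \<in> set_homs X (Salg \<P> F) {1..d}"
    by (rule hom_restrict[OF algebra_Salg S])
  have "(\<Sum>A\<in>\<P>. card_norm d (sym_diff (act_d (\<sigma> f) (restrict \<phi> (Salg \<P> F) A)) (restrict \<phi> (Salg \<P> F) (act f A)))) < \<delta>"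
    if f: "f \<in> F" for f
  proof -
    have "(\<Sum>A\<in>\<P>. card_norm d (sym_diff (act_d (\<sigma> f) (restrict \<phi> (Salg \<P> F) A)) (restrict \<phi> (Salg \<P> F) (act f A))))
        = (\<Sum>A\<in>\<P>. card_norm d (defect \<sigma> \<phi> f A))"
      using partition_Salg[OF P F] Salg_gens[OF f, of _ \<P>] by (intro sum.cong) auto
    also have "\<dots> < \<delta>'"
    proof (rule Hom_act_defect[OF P' F' \<phi> \<sigma>])
      show "f \<in> F'" using f sub by blast
      show "\<P> \<subseteq> sigma_sets X \<P>'" using refines_sigma_setsI[OF P' ref] by blast
    qed (rule partitionsD(2)[OF P], rule partition_onD2[OF partitionsD(1)[OF P]])
    finally show ?thesis using \<delta> by simp
  qed
  moreover have "(\<Sum>A\<in>atoms \<P> F. \<bar>card_norm d (restrict \<phi> (Salg \<P> F) A) - measure \<mu> A\<bar>) < \<delta>"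
  proof -
    have "(\<Sum>A\<in>atoms \<P> F. \<bar>card_norm d (restrict \<phi> (Salg \<P> F) A) - measure \<mu> A\<bar>)
        = (\<Sum>A\<in>atoms \<P> F. \<bar>card_norm d (\<phi> A) - measure \<mu> A\<bar>)"
      using atoms_Salg[OF P F] by (intro sum.cong) auto
    also have "\<dots> < \<delta>'"
      by (intro Hom_measure_defect[OF P' F' \<phi>] finite_atoms[OF P F]
          partition_onD2[OF atoms_on[OF P F]] order_trans[OF atoms_Salg[OF P F] S])
    finally show ?thesis using \<delta> by simp
  qed
  ultimately show ?thesis unfolding Hom_iff[OF P F] using hom by blast
qed

text \<open>Given its restriction to \<open>\<Q>'\<close>, a homomorphism is determined on \<open>\<Sigma>(\<Q>'\<^sup>K)\<close>, hence on \<open>\<Q>\<close>,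
  up to a small subset of \<open>{1..d}\<close> for each atom of \<open>\<Q>\<close>.\<close>

lemma Hom_count_le_fibres:
  assumes Q: "\<Q> \<in> partitions" and Q': "\<Q>' \<in> partitions" and K: "admissible K"
    and E: "\<And>A. A \<in> \<Q> \<Longrightarrow> E A \<in> Salg \<Q>' K" "\<And>A. A \<in> \<Q> \<Longrightarrow> measure \<mu> (sym_diff A (E A)) < \<eta>"
    and P': "\<P>' \<in> partitions" "refines X \<P>' \<Q>'" and F': "admissible F'"
    and P: "\<P> \<in> partitions" "refines X \<P> \<P>'" "refines X \<P> \<Q>"
    and \<delta>: "\<delta> \<le> \<delta>'" "(1 + real (card K)) * \<delta> \<le> \<eta>"
    and \<sigma>: "\<sigma> \<in> Map_set H d"
  shows "real (hom_count d \<sigma> \<Q> \<P> (F' \<union> K) \<delta>) \<le>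
     real (card {S \<in> Pow {1..d}. card_norm d S \<le> 4 * \<eta>}) ^ card \<Q> *
     real (hom_count d \<sigma> \<Q>' \<P>' F' \<delta>')"
proof -
  let ?S = "homs d \<sigma> \<P> (F' \<union> K) \<delta>"
  let ?small = "{S \<in> Pow {1..d}. card_norm d S \<le> 4 * \<eta>}"
  define q r where "q \<phi> = restrict \<phi> (sigma_sets X \<Q>)" and "r \<phi> = restrict \<phi> (sigma_sets X \<Q>')"
    for \<phi> :: "'g set \<Rightarrow> nat set"
  have F: "admissible (F' \<union> K)" by (rule admissible_Un[OF F' K])
  have PQ': "refines X \<P> \<Q>'" using P(2) P'(2) by (rule refines_trans)
  have QS: "sigma_sets X \<Q> \<subseteq> Salg \<P> (F' \<union> K)"
    using refines_sigma_sets[OF P(1,3)] sigma_sets_Salg[OF P(1) F] by blast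
  have Q'S: "sigma_sets X \<Q>' \<subseteq> Salg \<P>' F'"
    using refines_sigma_sets[OF P'] sigma_sets_Salg[OF P'(1) F'] by blast
  have KS: "Salg \<Q>' K \<subseteq> Salg \<P> (F' \<union> K)" by (rule Salg_mono[OF P(1) F PQ']) blast
  have rS: "r ` ?S \<subseteq> r ` homs d \<sigma> \<P>' F' \<delta>'"
  proof (rule image_subsetI)
    fix \<phi> assume "\<phi> \<in> ?S"
    then have "restrict \<phi> (Salg \<P>' F') \<in> homs d \<sigma> \<P>' F' \<delta>'"
      by (intro Hom_restrict[OF P'(1) F' P(1) F P(2) _ \<sigma> \<delta>(1)]) auto
    moreover have "r \<phi> = r (restrict \<phi> (Salg \<P>' F'))"
      unfolding r_def restrict_restrict using Q'S by (simp add: Int_absorb1)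
    ultimately show "r \<phi> \<in> r ` homs d \<sigma> \<P>' F' \<delta>'" by blast
  qed
  have card_r: "card (r ` ?S) \<le> hom_count d \<sigma> \<Q>' \<P>' F' \<delta>'"
    unfolding Hom_count_def r_def[symmetric]
    by (rule card_mono[OF finite_imageI[OF finite_Hom[OF P'(1) F']] rS])
  have small: "sym_diff (\<phi> A) (\<psi> A) \<in> ?small"
    if \<phi>: "\<phi> \<in> ?S" and \<psi>: "\<psi> \<in> ?S" and r: "r \<psi> = r \<phi>" and A: "A \<in> \<Q>" for \<phi> \<psi> A
  proof -
    interpret \<phi>: set_hom "X" "Salg \<P> (F' \<union> K)" "{1..d}" \<phi> by (rule Hom_set_hom[OF P(1) F \<phi>])
    interpret \<psi>: set_hom "X" "Salg \<P> (F' \<union> K)" "{1..d}" \<psi> by (rule Hom_set_hom[OF P(1) F \<psi>])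
    define D where "D \<theta> k B = defect \<sigma> \<theta> k B" for \<theta> :: "'g set \<Rightarrow> nat set" and k B
    \<comment> \<open>All places where \<open>\<phi>\<close> or \<open>\<psi>\<close> fails to be
      equivariant under \<open>K\<close> on the cells of \<open>\<Q>'\<close>. Off this set the
      values on \<open>\<Sigma>(\<Q>'^K)\<close> are dictated by the common restriction to
      \<open>\<Q>'\<close>.\<close>
    define Bad where "Bad = (\<Union>k\<in>K. (\<Union>B\<in>\<Q>'. D \<phi> k B) \<union> (\<Union>B\<in>\<Q>'. D \<psi> k B))"
    have Q'sub: "\<Q>' \<subseteq> sigma_sets X \<P>"
      using refines_sigma_setsI[OF P(1) PQ'] by blast
    have D_card: "card_norm d (\<Union>B\<in>\<Q>'. D \<theta> k B) \<le> \<delta>" if "\<theta> \<in> ?S" "k \<in> K" for \<theta> k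
    proof -
      have "card_norm d (\<Union>B\<in>\<Q>'. D \<theta> k B) \<le> (\<Sum>B\<in>\<Q>'. card_norm d (D \<theta> k B))"
        by (rule card_norm_UN[OF partitionsD(2)[OF Q']])
      also have "\<dots> < \<delta>"
        unfolding D_def using that(2)
        by (intro Hom_act_defect[OF P(1) F that(1) \<sigma>] Q'sub partitionsD(2)[OF Q']
            partition_onD2[OF partitionsD(1)[OF Q']]) simp
      finally show ?thesis by simp
    qed
    have "card_norm d Bad \<le> (\<Sum>k\<in>K. card_norm d ((\<Union>B\<in>\<Q>'. D \<phi> k B) \<union> (\<Union>B\<in>\<Q>'. D \<psi> k B)))"
      unfolding Bad_def by (rule card_norm_UN[OF admissibleD(1)[OF K]])
    also have "\<dots> \<le> (\<Sum>k\<in>K. 2 * \<delta>)"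
    proof (rule sum_mono)
      fix k assume "k \<in> K"
      then show "card_norm d ((\<Union>B\<in>\<Q>'. D \<phi> k B) \<union> (\<Union>B\<in>\<Q>'. D \<psi> k B)) \<le> 2 * \<delta>"
        using card_norm_Un[of d "\<Union>B\<in>\<Q>'. D \<phi> k B" "\<Union>B\<in>\<Q>'. D \<psi> k B"] D_card[OF \<phi>, of k] D_card[OF \<psi>, of k]
        by linarith
    qed
    finally have Bad_card: "card_norm d Bad \<le> 2 * real (card K) * \<delta>" by simp
    have eq: "\<phi> B = \<psi> B" if "B \<in> \<Q>'" for B
    proof -
      have "B \<in> sigma_sets X \<Q>'" using that by (rule sigma_sets.Basic)
      then show ?thesis using fun_cong[OF r, of B] by (simp add: r_def)
    qed
    \<comment> \<open>Boolean operations do not enlarge the set on which two homomorphisms differ,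
      so the generators decide.\<close>
    have Bad_sub: "sym_diff (\<phi> C) (\<psi> C) \<subseteq> Bad" if "C \<in> Salg \<Q>' K" for C
      using gens_subset finite_gens'[OF Q' K] that[unfolded Salg_def]
    proof (induction rule: finite_sigma_sets_induct)
      case (Basic C)
      then obtain k B where C: "C = act k B" "k \<in> K" "B \<in> \<Q>'" unfolding gens_def by blast
      then have "sym_diff (\<phi> C) (\<psi> C) \<subseteq> D \<phi> k B \<union> D \<psi> k B" using eq by (auto simp: D_def)
      then show ?case using C unfolding Bad_def by blast
    next
      case (Compl C)
      then have "C \<in> Salg \<P> (F' \<union> K)" using KS by (auto simp: Salg_def)
      then show ?case using Compl.IH by (auto simp: \<phi>.hom_Diff \<psi>.hom_Diff \<phi>.hom_top \<psi>.hom_top)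
    next
      case (Un C C')
      then have "C \<in> Salg \<P> (F' \<union> K)" "C' \<in> Salg \<P> (F' \<union> K)" using KS by (auto simp: Salg_def)
      then show ?case using Un.IH by (auto simp: \<phi>.hom_Un \<psi>.hom_Un)
    qed (simp add: \<phi>.hom_empty \<psi>.hom_empty)
    have AS: "A \<in> Salg \<P> (F' \<union> K)" by (rule subsetD[OF QS sigma_sets.Basic[OF A]])
    have ES: "E A \<in> Salg \<P> (F' \<union> K)" using E(1)[OF A] KS by blast
    let ?N = "sym_diff A (E A)"
    have NS: "?N \<in> Salg \<P> (F' \<union> K)" using AS ES by (intro \<phi>.Un \<phi>.Diff)
    have "sym_diff (\<phi> A) (\<psi> A) \<subseteq> \<phi> ?N \<union> \<psi> ?N \<union> Bad"
      using Bad_sub[OF E(1)[OF A]] unfolding \<phi>.hom_sym_diff[OF AS ES] \<psi>.hom_sym_diff[OF AS ES] by blast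
    moreover have fin: "finite (\<phi> ?N \<union> \<psi> ?N \<union> Bad)"
    proof (rule finite_subset[of _ "{1..d}"])
      have "D \<theta> k B \<subseteq> {1..d}" if "k \<in> K" "B \<in> \<Q>'" "\<theta> = \<phi> \<or> \<theta> = \<psi>" for \<theta> k B
      proof -
        have "act k B \<in> Salg \<P> (F' \<union> K)" using KS Salg_gens[OF that(1,2)] by blast
        then have "\<theta> (act k B) \<subseteq> {1..d}" using that(3) \<phi>.hom_subset \<psi>.hom_subset by blast
        then show ?thesis
          using act_d_subset[OF Map_set_Delta[OF Q' K \<sigma> admissibleD(2)[OF K that(1)]]] by (auto simp: D_def)
      qed
      then show "\<phi> ?N \<union> \<psi> ?N \<union> Bad \<subseteq> {1..d}"
        using \<phi>.hom_subset[OF NS] \<psi>.hom_subset[OF NS] unfolding Bad_def by blast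
    qed simp
    ultimately have "card_norm d (sym_diff (\<phi> A) (\<psi> A)) \<le> card_norm d (\<phi> ?N \<union> \<psi> ?N \<union> Bad)"
      by (rule card_norm_mono[rotated])
    also have "\<dots> \<le> card_norm d (\<phi> ?N) + card_norm d (\<psi> ?N) + card_norm d Bad"
      using card_norm_Un[of d "\<phi> ?N \<union> \<psi> ?N" Bad] card_norm_Un[of d "\<phi> ?N" "\<psi> ?N"] by linarith
    \<comment> \<open>Each of \<open>\<phi> ?N\<close> and \<open>\<psi> ?N\<close> costs at most
      \<open>\<eta> + \<delta>\<close>, and \<open>Bad\<close> costs
      \<open>2 * card K * \<delta>\<close>. The terms with \<open>\<delta>\<close> add up to at most
      \<open>2 * \<eta>\<close>.\<close>
    also have "\<dots> \<le> 4 * \<eta>"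
      using Hom_measure[OF P(1) F \<phi> NS] Hom_measure[OF P(1) F \<psi> NS] E(2)[OF A] Bad_card \<delta>(2)
      by (simp add: algebra_simps abs_less_iff)
    finally show ?thesis
      using \<phi>.hom_subset[OF AS] \<psi>.hom_subset[OF AS] by auto
  qed
  have fibre: "real (card (q ` {\<psi> \<in> ?S. r \<psi> = r \<phi>})) \<le> real (card ?small) ^ card \<Q>" if \<phi>: "\<phi> \<in> ?S" for \<phi>
  proof -
    \<comment> \<open>Differences from a fixed member of the fibre determine a homomorphism on the
      cells of \<open>\<Q>\<close>, hence on \<open>\<Sigma>(\<Q>)\<close>, and each difference is
      one of the small sets.\<close>
    define T where "T \<psi> = (\<lambda>A\<in>\<Q>. sym_diff (\<phi> A) (\<psi> A))" for \<psi> :: "'g set \<Rightarrow> nat set"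
    have QQ: "A \<in> sigma_sets X \<Q>" if "A \<in> \<Q>" for A using that by (rule sigma_sets.Basic)
    have "inj_on T (q ` {\<psi> \<in> ?S. r \<psi> = r \<phi>})"
    proof (rule inj_onI)
      fix a b assume "a \<in> q ` {\<psi> \<in> ?S. r \<psi> = r \<phi>}" "b \<in> q ` {\<psi> \<in> ?S. r \<psi> = r \<phi>}" and T: "T a = T b"
      then obtain \<psi> \<xi> where ab: "a = q \<psi>" "b = q \<xi>" "\<psi> \<in> ?S" "\<xi> \<in> ?S" by blast
      interpret \<psi>: set_hom "X" "Salg \<P> (F' \<union> K)" "{1..d}" \<psi> by (rule Hom_set_hom[OF P(1) F ab(3)])
      interpret \<xi>: set_hom "X" "Salg \<P> (F' \<union> K)" "{1..d}" \<xi> by (rule Hom_set_hom[OF P(1) F ab(4)])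
      have Q_eq: "\<psi> A = \<xi> A" if "A \<in> \<Q>" for A
      proof -
        have "sym_diff (\<phi> A) (\<psi> A) = sym_diff (\<phi> A) (\<xi> A)"
          using fun_cong[OF T, of A] that QQ[OF that] by (simp add: T_def ab q_def)
        then show ?thesis by blast
      qed
      have eq: "\<psi> A = \<xi> A" if "A \<in> sigma_sets X \<Q>" for A
      proof -
        let ?C = "{B \<in> \<Q>. B \<subseteq> A}"
        have A: "A = \<Union>?C" by (rule sigma_sets_partition_Union[OF partitionsD(1)[OF Q] that])
        have C: "finite ?C" "?C \<subseteq> Salg \<P> (F' \<union> K)" using partitionsD(2)[OF Q] QQ QS by auto
        have "\<psi> (\<Union>?C) = \<xi> (\<Union>?C)"
          unfolding \<psi>.hom_Union[OF C] \<xi>.hom_Union[OF C] using Q_eq by auto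
        then show ?thesis using A by simp
      qed
      show "a = b"
      proof
        fix A show "a A = b A"
          using eq[of A] by (cases "A \<in> sigma_sets X \<Q>") (simp_all only: ab q_def restrict_def if_True if_False)
      qed
    qed
    moreover have "T ` (q ` {\<psi> \<in> ?S. r \<psi> = r \<phi>}) \<subseteq> \<Q> \<rightarrow>\<^sub>E ?small"
    proof -
      have "T (q \<psi>) \<in> \<Q> \<rightarrow>\<^sub>E ?small" if "\<psi> \<in> ?S" "r \<psi> = r \<phi>" for \<psi>
      proof (rule PiE_I)
        fix A assume "A \<in> \<Q>"
        then show "T (q \<psi>) A \<in> ?small"
          using small[OF \<phi> that \<open>A \<in> \<Q>\<close>] QQ[OF \<open>A \<in> \<Q>\<close>] by (simp add: T_def q_def)
      qed (simp add: T_def)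
      then show ?thesis by blast
    qed
    moreover have "finite (\<Q> \<rightarrow>\<^sub>E ?small)" using partitionsD(2)[OF Q] by (intro finite_PiE) auto
    ultimately have "card (q ` {\<psi> \<in> ?S. r \<psi> = r \<phi>}) \<le> card (\<Q> \<rightarrow>\<^sub>E ?small)" by (rule card_inj_on_le)
    also have "\<dots> = card ?small ^ card \<Q>" by (rule card_funcsetE[OF partitionsD(2)[OF Q]])
    finally have le: "card (q ` {\<psi> \<in> ?S. r \<psi> = r \<phi>}) \<le> card ?small ^ card \<Q>" .
    show ?thesis using of_nat_mono[OF le, where ?'a = real] by (simp only: of_nat_power)
  qed
  have "real (card (q ` ?S)) \<le> real (card ?small) ^ card \<Q> * real (card (r ` ?S))"
    by (rule card_image_fibres_le[OF finite_Hom[OF P(1) F] fibre])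
  also have "\<dots> \<le> real (card ?small) ^ card \<Q> * real (hom_count d \<sigma> \<Q>' \<P>' F' \<delta>')"
    using card_r by (intro mult_left_mono) auto
  finally show ?thesis by (simp add: Hom_count_def q_def)
qed

section \<open>Transfer of homomorphisms along a point map\<close>

lemma act_Salg:
  assumes P: "\<P> \<in> partitions" and F': "admissible F'" and F'': "admissible F''"
    and f: "f \<in> F''" and mult: "\<And>g. g \<in> F' \<Longrightarrow> set_mult H f g \<in> F''" and A: "A \<in> Salg \<P> F'"
  shows "act f A \<in> Salg \<P> F''"
proof -
  interpret S: algebra "X" "Salg \<P> F''" by (rule algebra_Salg)
  have fH: "f \<in> full_semigroup H" by (rule admissibleD(2)[OF F'' f])
  have top: "act f X \<in> Salg \<P> F''"
    by (rule sigma_sets_act_Salg[OF P F'' f]) (rule sigma_sets_top)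
  show ?thesis
    using gens_subset finite_gens'[OF P F'] A[unfolded Salg_def]
  proof (induction rule: finite_sigma_sets_induct)
    case (Basic A)
    then obtain g B where A: "A = act g B" "g \<in> F'" "B \<in> \<P>" unfolding gens_def by blast
    have "act f A = act (set_mult H f g) B"
      unfolding A(1) by (rule act_set_mult[symmetric, OF fH admissibleD(2)[OF F' A(2)] partitionsD(4)[OF P A(3)]])
    then show ?case using Salg_gens[OF mult[OF A(2)] A(3)] by simp
  next
    case (Compl A)
    then show ?case using top by (simp add: act_Diff[OF fH] S.Diff)
  next
    case (Un A B)
    then have "act f A \<union> act f B \<in> Salg \<P> F''" by (intro S.Un) simp_all
    then show ?case by (simp only: act_Un)
  qed (simp add: act_empty)
qed

text \<open>\<open>\<kappa>\<close> collapses the atoms of \<open>\<P>\<^sup>F\<close>, up to measure \<open>\<eta>\<close>, onto sets in \<open>\<Sigma>(\<P>'\<^sup>F\<^sup>')\<close>; a homomorphism that is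
  almost equivariant on \<open>\<P>'\<close> is so on all of \<open>\<Sigma>(\<P>'\<^sup>F\<^sup>')\<close>, because the defects of the Boolean combinations
  are contained in the union of the defects of the generators.\<close>

lemma Hom_transfer:
  assumes P: "\<P> \<in> partitions" and F: "admissible F"
    and P': "\<P>' \<in> partitions" and F': "admissible F'" and F'': "admissible F''"
    and FF: "F \<subseteq> F''" "F' \<subseteq> F''" and mult: "\<And>f g. f \<in> F \<Longrightarrow> g \<in> F' \<Longrightarrow> set_mult H f g \<in> F''"
    and \<kappa>: "\<kappa> \<in> X \<rightarrow> X" and \<kappa>S: "\<And>B. B \<in> Salg \<P> F \<Longrightarrow> \<kappa> -` B \<inter> X \<in> Salg \<P>' F'"
    and \<kappa>\<eta>: "\<And>B. B \<in> Salg \<P> F \<Longrightarrow> measure \<mu> (sym_diff B (\<kappa> -` B \<inter> X)) \<le> \<eta>"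
    and \<delta>1: "real (card \<P>) * ((3 * real (card F') * real (card \<P>') + 2) * \<delta>' + 2 * \<eta>) < \<delta>"
    and \<delta>2: "real (card (atoms \<P> F)) * (\<delta>' + \<eta>) < \<delta>"
    and \<sigma>: "\<sigma> \<in> Map_set H d" and m\<sigma>: "multiplicative H d (F \<union> F') \<delta>' \<sigma>"
    and \<phi>: "\<phi> \<in> homs d \<sigma> \<P>' F'' \<delta>'"
  shows "(\<lambda>B\<in>Salg \<P> F. \<phi> (\<kappa> -` B \<inter> X)) \<in> homs d \<sigma> \<P> F \<delta>"
proof -
  let ?S = "Salg \<P>' F''"
  interpret set_hom X ?S "{1..d}" \<phi> by (rule Hom_set_hom[OF P' F'' \<phi>])
  define \<psi> where "\<psi> = (\<lambda>B\<in>Salg \<P> F. \<phi> (\<kappa> -` B \<inter> X))"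
  have refl: "refines X \<P>' \<P>'" by (rule refines_refl[OF partitionsD(1)[OF P']])
  have S'S: "Salg \<P>' F' \<subseteq> ?S" by (rule Salg_mono[OF P' F'' refl FF(2)])
  have \<kappa>S'': "\<kappa> -` B \<inter> X \<in> ?S" if "B \<in> Salg \<P> F" for B using \<kappa>S[OF that] S'S by blast
  have hom: "\<psi> \<in> set_homs X (Salg \<P> F) {1..d}"
    unfolding \<psi>_def by (rule hom_vimage[OF algebra_Salg \<kappa> \<kappa>S''])
  define D where "D f B = defect \<sigma> \<phi> f B" for f B
  have s: "\<sigma> f \<in> full_semigroup (Delta d)" if "f \<in> full_semigroup H" for f
    by (rule Map_set_Delta[OF P F \<sigma> that])
  have fin: "finite (\<phi> B)" if "B \<in> ?S" for B by (rule finite_subset[OF hom_subset[OF that]]) simp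
  have actS: "act f B \<in> ?S" if "f \<in> F" "B \<in> Salg \<P>' F'" for f B
    using that by (intro act_Salg[OF P' F' F'']) (use FF mult in auto)
  have D_fin: "D f B \<subseteq> {1..d}" if "f \<in> F" "B \<in> Salg \<P>' F'" for f B
    using act_d_subset[OF s[OF admissibleD(2)[OF F that(1)]]] hom_subset[OF actS[OF that]] by (auto simp: D_def)
  have D_gen: "card_norm d (D f (act g A)) \<le> 3 * \<delta>'" if f: "f \<in> F" and g: "g \<in> F'" and A: "A \<in> \<P>'" for f g A
  proof -
    have fH: "f \<in> full_semigroup H" and gH: "g \<in> full_semigroup H"
      using admissibleD(2)[OF F f] admissibleD(2)[OF F' g] .
    note sf = s[OF fH] and sg = s[OF gH] and sfg = s[OF H.set_mult_full_semigroup[OF fH gH]]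
    have A\<Sigma>: "A \<in> sigma_sets X \<P>'" using A by (rule sigma_sets.Basic)
    have AS: "A \<in> ?S" "act g A \<in> ?S"
      using partition_Salg[OF P' F''] A Salg_gens[OF g A] S'S by blast+
    \<comment> \<open>The distances along \<open>?a\<close>, \<open>?b\<close>, \<open>?c\<close>,
      \<open>?e\<close> come from equivariance under \<open>g\<close>, from multiplicativity of
      \<open>\<sigma>\<close>, and from equivariance under the product of \<open>f\<close> and
      \<open>g\<close>; hence the constant 3.\<close>
    let ?a = "act_d (\<sigma> f) (\<phi> (act g A))" and ?b = "act_d (\<sigma> f) (act_d (\<sigma> g) (\<phi> A))"
    let ?c = "act_d (\<sigma> (set_mult H f g)) (\<phi> A)" and ?e = "\<phi> (act f (act g A))"
    have e: "?e = \<phi> (act (set_mult H f g) A)"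
      using act_set_mult[OF fH gH partitionsD(4)[OF P' A]] by simp
    have fg: "finite (act_d (\<sigma> g) (\<phi> A))" by (rule finite_subset[OF act_d_subset[OF sg]]) simp
    have "card_norm d (sym_diff ?a ?b) \<le> card_norm d (sym_diff (\<phi> (act g A)) (act_d (\<sigma> g) (\<phi> A)))"
      by (rule card_norm_act_d_sym_diff[OF sf fin[OF AS(2)] fg])
    also have "\<dots> = card_norm d (defect \<sigma> \<phi> g A)" by (simp add: Un_commute)
    also have "\<dots> < \<delta>'" using FF(2) g by (intro Hom_act[OF P' F'' \<phi> \<sigma> _ A\<Sigma>]) blast
    finally have 1: "card_norm d (sym_diff ?a ?b) < \<delta>'" .
    have ff: "finite (\<sigma> (set_mult H f g))" "finite (set_mult (Delta d) (\<sigma> f) (\<sigma> g))"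
    proof -
      show "finite (\<sigma> (set_mult H f g))" by (rule finite_subset[OF full_semigroup_DeltaD(1)[OF sfg]]) simp
      have "set_mult (Delta d) (\<sigma> f) (\<sigma> g) \<subseteq> {1..d} \<times> {1..d}"
        using full_semigroup_DeltaD(1)[OF sf] full_semigroup_DeltaD(1)[OF sg] by (fastforce simp: set_mult_def Delta_def)
      then show "finite (set_mult (Delta d) (\<sigma> f) (\<sigma> g))" by (rule finite_subset) simp
    qed
    have "sym_diff ?b ?c = sym_diff ?c ?b" by blast
    then have "card_norm d (sym_diff ?b ?c) \<le>
        card_norm d (sym_diff (\<sigma> (set_mult H f g)) (set_mult (Delta d) (\<sigma> f) (\<sigma> g)))"
      using card_norm_act_d_sym_diff'[OF ff, of d "\<phi> A"] by (simp add: act_d_set_mult[OF sf sg])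
    also have "\<dots> < \<delta>'" using m\<sigma> f g unfolding multiplicative_def by blast
    finally have 2: "card_norm d (sym_diff ?b ?c) < \<delta>'" .
    have 3: "card_norm d (sym_diff ?c ?e) < \<delta>'"
      unfolding e by (rule Hom_act[OF P' F'' \<phi> \<sigma> mult[OF f g] A\<Sigma>])
    have sub: "sym_diff ?a ?e \<subseteq> sym_diff ?a ?b \<union> (sym_diff ?b ?c \<union> sym_diff ?c ?e)" by blast
    have "?a \<subseteq> {1..d}" "?b \<subseteq> {1..d}" "?c \<subseteq> {1..d}" by (rule act_d_subset[OF sf] act_d_subset[OF sfg])+
    moreover have "?e \<subseteq> {1..d}" by (rule hom_subset[OF actS[OF f Salg_gens[OF g A]]])
    ultimately have "sym_diff ?a ?b \<union> (sym_diff ?b ?c \<union> sym_diff ?c ?e) \<subseteq> {1..d}" by blast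
    then have "finite (sym_diff ?a ?b \<union> (sym_diff ?b ?c \<union> sym_diff ?c ?e))" by (rule finite_subset) simp
    from card_norm_mono[OF this sub, of d]
    show ?thesis
      using card_norm_Un[of d "sym_diff ?a ?b" "sym_diff ?b ?c \<union> sym_diff ?c ?e"]
        card_norm_Un[of d "sym_diff ?b ?c" "sym_diff ?c ?e"] 1 2 3 unfolding D_def by linarith
  qed
  \<comment> \<open>The defect at \<open>X\<close> is what complements cost: \<open>f\<close> acts
    partially, so the translate of \<open>X - C\<close> is a complement inside
    \<open>act f X\<close>.\<close>
  define Bad where "Bad f = (\<Union>g\<in>F'. \<Union>A\<in>\<P>'. D f (act g A)) \<union> D f X" for f
  have X\<Sigma>: "X \<in> sigma_sets X \<P>'" by (rule sigma_sets_top)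
  have XS': "X \<in> Salg \<P>' F'" using X\<Sigma> sigma_sets_Salg[OF P' F'] by blast
  have Bad_card: "card_norm d (Bad f) \<le> (3 * real (card F') * real (card \<P>') + 1) * \<delta>'" if f: "f \<in> F" for f
  proof -
    have "card_norm d (\<Union>g\<in>F'. \<Union>A\<in>\<P>'. D f (act g A)) \<le> (\<Sum>g\<in>F'. card_norm d (\<Union>A\<in>\<P>'. D f (act g A)))"
      by (rule card_norm_UN[OF admissibleD(1)[OF F']])
    also have "\<dots> \<le> (\<Sum>g\<in>F'. \<Sum>A\<in>\<P>'. card_norm d (D f (act g A)))"
      by (intro sum_mono card_norm_UN[OF partitionsD(2)[OF P']])
    also have "\<dots> \<le> (\<Sum>g\<in>F'. \<Sum>A\<in>\<P>'. 3 * \<delta>')" by (intro sum_mono D_gen[OF f])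
    finally have "card_norm d (\<Union>g\<in>F'. \<Union>A\<in>\<P>'. D f (act g A)) \<le> 3 * real (card F') * real (card \<P>') * \<delta>'"
      by (simp add: algebra_simps)
    moreover have "card_norm d (D f X) < \<delta>'"
      unfolding D_def using FF(1) f by (intro Hom_act[OF P' F'' \<phi> \<sigma> _ X\<Sigma>]) blast
    ultimately show ?thesis
      using card_norm_Un[of d "\<Union>g\<in>F'. \<Union>A\<in>\<P>'. D f (act g A)" "D f X"]
      unfolding Bad_def by (simp add: algebra_simps)
  qed
  have Bad_fin: "Bad f \<subseteq> {1..d}" if "f \<in> F" for f
    using D_fin[OF that Salg_gens] D_fin[OF that XS'] unfolding Bad_def by blast
  have D_Bad: "D f C \<subseteq> Bad f" if f: "f \<in> F" and C: "C \<in> Salg \<P>' F'" for f C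
    using gens_subset finite_gens'[OF P' F'] C[unfolded Salg_def]
  proof (induction rule: finite_sigma_sets_induct)
    case (Basic C)
    then show ?case unfolding gens_def Bad_def by blast
  next
    case Empty
    then show ?case by (simp add: D_def hom_empty act_d_empty act_empty)
  next
    case (Compl C)
    have fH: "f \<in> full_semigroup H" by (rule admissibleD(2)[OF F f])
    have C: "C \<in> Salg \<P>' F'" "C \<in> ?S" using Compl.hyps S'S by (auto simp: Salg_def)
    have "D f (X - C) = sym_diff (act_d (\<sigma> f) (\<phi> X) - act_d (\<sigma> f) (\<phi> C)) (\<phi> (act f X) - \<phi> (act f C))"
      unfolding D_def act_Diff[OF fH] hom_Diff[OF top C(2)] act_d_Diff[OF s[OF fH]]
        hom_Diff[OF actS[OF f XS'] actS[OF f C(1)]] ..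
    also have "\<dots> \<subseteq> D f X \<union> D f C" unfolding D_def by blast
    also have "\<dots> \<subseteq> Bad f" using Compl.IH unfolding Bad_def by blast
    finally show ?case .
  next
    case (Un C C')
    have C: "C \<in> Salg \<P>' F'" "C \<in> ?S" "C' \<in> Salg \<P>' F'" "C' \<in> ?S" using Un.hyps S'S by (auto simp: Salg_def)
    have "D f (C \<union> C') = sym_diff (act_d (\<sigma> f) (\<phi> C) \<union> act_d (\<sigma> f) (\<phi> C')) (\<phi> (act f C) \<union> \<phi> (act f C'))"
      unfolding D_def act_Un hom_Un[OF C(2,4)] act_d_Un hom_Un[OF actS[OF f C(1)] actS[OF f C(3)]] ..
    also have "\<dots> \<subseteq> D f C \<union> D f C'" unfolding D_def by blast
    also have "\<dots> \<subseteq> Bad f" using Un.IH by blast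
    finally show ?case .
  qed
  have defect: "card_norm d (defect \<sigma> \<psi> f A) \<le>
      (3 * real (card F') * real (card \<P>') + 2) * \<delta>' + 2 * \<eta>" if f: "f \<in> F" and A: "A \<in> \<P>" for f A
  proof -
    have fH: "f \<in> full_semigroup H" by (rule admissibleD(2)[OF F f])
    have AS: "A \<in> Salg \<P> F" "act f A \<in> Salg \<P> F"
      using partition_Salg[OF P F] A Salg_gens[OF f A] by blast+
    let ?K = "\<lambda>B. \<kappa> -` B \<inter> X"
    note K = \<kappa>S[OF AS(1)] and K'' = \<kappa>S''[OF AS(2)]
    have \<psi>: "\<psi> A = \<phi> (?K A)" "\<psi> (act f A) = \<phi> (?K (act f A))" using AS by (simp_all add: \<psi>_def)
    \<comment> \<open>This set measures how far \<open>\<kappa>\<close> is from commuting with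
      \<open>f\<close>. It is covered by the displacement of \<open>A\<close>, transported by
      \<open>f\<close> without gaining measure, and the displacement of \<open>act f A\<close>;
      hence \<open>2 * \<eta>\<close>.\<close>
    let ?U = "sym_diff (act f (?K A)) (?K (act f A))"
    have US: "?U \<in> ?S" using actS[OF f K] K'' by (intro Un Diff)
    note ms = subsetD[OF Salg_sets[OF P F]] subsetD[OF Salg_sets[OF P' F']] subsetD[OF Salg_sets[OF P' F'']]
    have sets: "sym_diff A (?K A) \<in> sets \<mu>" "sym_diff (act f A) (?K (act f A)) \<in> sets \<mu>"
      using ms(1)[OF AS(1)] ms(1)[OF AS(2)] ms(2)[OF K] ms(3)[OF K''] by (intro sets.Un sets.Diff; simp)+
    have "measure \<mu> ?U \<le> measure \<mu> (act f (sym_diff A (?K A)) \<union> sym_diff (act f A) (?K (act f A)))"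
    proof (rule finite_measure_mono)
      show "?U \<subseteq> act f (sym_diff A (?K A)) \<union> sym_diff (act f A) (?K (act f A))"
        unfolding act_Un act_Diff[OF fH] by blast
      show "act f (sym_diff A (?K A)) \<union> sym_diff (act f A) (?K (act f A)) \<in> sets \<mu>"
        using act_sets[OF fH sets(1)] sets(2) by (rule sets.Un)
    qed
    also have "\<dots> \<le> measure \<mu> (act f (sym_diff A (?K A))) + measure \<mu> (sym_diff (act f A) (?K (act f A)))"
      by (rule measure_Un_le[OF act_sets[OF fH sets(1)] sets(2)])
    also have "\<dots> \<le> \<eta> + \<eta>"
      using measure_act_le[OF fH sets(1)] \<kappa>\<eta>[OF AS(1)] \<kappa>\<eta>[OF AS(2)] by linarith
    finally have U: "measure \<mu> ?U \<le> 2 * \<eta>" by simp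
    have sub: "defect \<sigma> \<psi> f A \<subseteq> Bad f \<union> \<phi> ?U"
      using D_Bad[OF f K] unfolding \<psi> hom_sym_diff[OF actS[OF f K] K''] D_def by blast
    have "finite (Bad f \<union> \<phi> ?U)"
      by (rule finite_subset[of _ "{1..d}"]) (use Bad_fin[OF f] hom_subset[OF US] in blast, simp)
    \<comment> \<open>In the summand \<open>2 * \<delta>'\<close> one \<open>\<delta>'\<close> comes
      from the defect at \<open>X\<close>, the other from comparing \<open>\<phi> ?U\<close> with
      the measure of \<open>?U\<close>.\<close>
    from card_norm_mono[OF this sub, of d] card_norm_Un[of d "Bad f" "\<phi> ?U"]
    show ?thesis using Bad_card[OF f] Hom_measure[OF P' F'' \<phi> US] U by (simp add: algebra_simps abs_less_iff)
  qed
  have "(\<Sum>A\<in>\<P>. card_norm d (defect \<sigma> \<psi> f A)) < \<delta>" if f: "f \<in> F" for f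
  proof -
    have "(\<Sum>A\<in>\<P>. card_norm d (defect \<sigma> \<psi> f A))
        \<le> (\<Sum>A\<in>\<P>. (3 * real (card F') * real (card \<P>') + 2) * \<delta>' + 2 * \<eta>)"
      by (intro sum_mono defect[OF f])
    also have "\<dots> < \<delta>" using \<delta>1 by simp
    finally show ?thesis .
  qed
  moreover have "(\<Sum>A\<in>atoms \<P> F. \<bar>card_norm d (\<psi> A) - measure \<mu> A\<bar>) < \<delta>"
  proof -
    have "(\<Sum>A\<in>atoms \<P> F. \<bar>card_norm d (\<psi> A) - measure \<mu> A\<bar>)
        \<le> (\<Sum>A\<in>atoms \<P> F. \<delta>' + \<eta>)"
    proof (rule sum_mono)
      fix A assume "A \<in> atoms \<P> F"
      then have A: "A \<in> Salg \<P> F" using atoms_Salg[OF P F] by blast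
      let ?K = "\<kappa> -` A \<inter> X"
      have \<psi>: "\<psi> A = \<phi> ?K" using A by (simp add: \<psi>_def)
      have sets: "A \<in> sets \<mu>" "?K \<in> sets \<mu>"
        using Salg_sets[OF P F] A Salg_sets[OF P' F''] \<kappa>S''[OF A] by blast+
      have sd: "sym_diff A ?K \<in> sets \<mu>" using sets by (intro sets.Un sets.Diff)
      have "measure \<mu> A \<le> measure \<mu> (?K \<union> sym_diff A ?K)" "measure \<mu> ?K \<le> measure \<mu> (A \<union> sym_diff A ?K)"
        using sets sd by (intro finite_measure_mono sets.Un; blast)+
      then have "\<bar>measure \<mu> ?K - measure \<mu> A\<bar> \<le> \<eta>"
        using measure_Un_le[OF sets(1) sd] measure_Un_le[OF sets(2) sd] \<kappa>\<eta>[OF A] by linarith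
      then show "\<bar>card_norm d (\<psi> A) - measure \<mu> A\<bar> \<le> \<delta>' + \<eta>"
        using Hom_measure[OF P' F'' \<phi> \<kappa>S''[OF A]] unfolding \<psi> by linarith
    qed
    also have "\<dots> < \<delta>" using \<delta>2 by simp
    finally show ?thesis .
  qed
  ultimately show ?thesis unfolding Hom_iff[OF P F] \<psi>_def[symmetric] using hom by blast
qed

text \<open>\<open>\<kappa>\<close> sends a point that lies in exactly one of the approximants of the atoms to a representative of
  this atom, and any other point to a representative of its cell of \<open>\<Q>\<close>.\<close>

lemma collapsing_map:
  assumes alg: "algebra X \<A>" and \<A>\<mu>: "\<A> \<subseteq> sets \<mu>"
    and dense: "\<And>B \<epsilon>. B \<in> sets \<mu> \<Longrightarrow> 0 < \<epsilon> \<Longrightarrow> \<exists>E\<in>\<A>. measure \<mu> (sym_diff B E) < \<epsilon>"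
    and B: "\<B> \<in> partitions" and Q: "\<Q> \<in> finite_partitions X \<A>"
    and ref: "refines X \<B> \<Q>" and \<eta>: "0 < \<eta>"
  obtains \<kappa> where "\<kappa> \<in> X \<rightarrow> X" "\<And>A. \<kappa> -` A \<inter> X \<in> \<A>"
    "\<And>A. A \<in> sigma_sets X \<B> \<Longrightarrow> measure \<mu> (sym_diff A (\<kappa> -` A \<inter> X)) \<le> \<eta>"
    "\<And>A. A \<in> sigma_sets X \<Q> \<Longrightarrow> \<kappa> -` A \<inter> X = A"
proof -
  interpret \<A>: algebra X \<A> by fact
  have Qp: "partition_on X \<Q>" "finite \<Q>" "\<Q> \<subseteq> \<A>" using Q by (auto simp: finite_partitions_def)
  note Bp = partitionsD[OF B]
  have "\<forall>C\<in>\<B>. \<exists>q\<in>\<Q>. C \<subseteq> q" using ref unfolding refines_def by blast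
  then obtain q where q: "\<And>C. C \<in> \<B> \<Longrightarrow> q C \<in> \<Q>" "\<And>C. C \<in> \<B> \<Longrightarrow> C \<subseteq> q C" by metis
  \<comment> \<open>The errors over all cells together must stay within \<open>\<eta>\<close>; the
    \<open>+ 1\<close> avoids a division by zero.\<close>
  have "\<forall>C\<in>\<B>. \<exists>E\<in>\<A>. measure \<mu> (sym_diff C E) < \<eta> / (real (card \<B>) + 1)"
    using dense Bp(3) \<eta> by (intro ballI dense) (auto intro!: divide_pos_pos)
  then obtain E0 where E0: "\<And>C. C \<in> \<B> \<Longrightarrow> E0 C \<in> \<A>"
    "\<And>C. C \<in> \<B> \<Longrightarrow> measure \<mu> (sym_diff C (E0 C)) < \<eta> / (real (card \<B>) + 1)" by metis
  \<comment> \<open>Cutting down to the cell of \<open>\<Q>\<close> around \<open>C\<close> does not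
    raise the error, and confines the points that will be sent into \<open>C\<close> to that
    cell.\<close>
  define E where "E C = E0 C \<inter> q C" for C
  have E\<A>: "E C \<in> \<A>" if "C \<in> \<B>" for C using E0(1)[OF that] q(1)[OF that] Qp(3) by (auto simp: E_def)
  have Eq: "E C \<subseteq> q C" for C by (simp add: E_def)
  have EC_sets: "sym_diff C (E C) \<in> sets \<mu>" if "C \<in> \<B>" for C
    using Bp(3) E\<A>[OF that] \<A>\<mu> that by (intro sets.Un sets.Diff) auto
  have E\<mu>: "measure \<mu> (sym_diff C (E C)) \<le> \<eta> / (real (card \<B>) + 1)" if "C \<in> \<B>" for C
  proof -
    have "measure \<mu> (sym_diff C (E C)) \<le> measure \<mu> (sym_diff C (E0 C))"
    proof (rule finite_measure_mono)
      show "sym_diff C (E C) \<subseteq> sym_diff C (E0 C)" using q(2)[OF that] by (auto simp: E_def)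
      show "sym_diff C (E0 C) \<in> sets \<mu>" using Bp(3) E0(1)[OF that] \<A>\<mu> that by (intro sets.Un sets.Diff) auto
    qed
    then show ?thesis using E0(2)[OF that] by simp
  qed
  \<comment> \<open>Off \<open>N\<close> a point lies in the approximant of its own cell of
    \<open>\<B>\<close> and in no other, so \<open>\<kappa>\<close> keeps it in that cell.\<close>
  define N where "N = (\<Union>C\<in>\<B>. sym_diff C (E C))"
  have N_sets: "N \<in> sets \<mu>" unfolding N_def using Bp(2) EC_sets by (intro sets.finite_UN) auto
  have "measure \<mu> N \<le> (\<Sum>C\<in>\<B>. measure \<mu> (sym_diff C (E C)))"
    unfolding N_def using Bp(2) EC_sets by (intro finite_measure_subadditive_finite) auto
  also have "\<dots> \<le> (\<Sum>C\<in>\<B>. \<eta> / (real (card \<B>) + 1))" by (intro sum_mono E\<mu>)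
  also have "\<dots> = real (card \<B>) / (real (card \<B>) + 1) * \<eta>" by simp
  also have "\<dots> \<le> 1 * \<eta>" using \<eta> by (intro mult_right_mono) auto
  finally have N\<mu>: "measure \<mu> N \<le> \<eta>" by simp
  define U where "U C = E C - \<Union>(E ` (\<B> - {C}))" for C
  have U\<A>: "U C \<in> \<A>" if "C \<in> \<B>" for C
    unfolding U_def using E\<A> that Bp(2) by (intro \<A>.Diff \<A>.finite_Union) auto
  define V where "V = X - \<Union>(U ` \<B>)"
  have V\<A>: "V \<in> \<A>" unfolding V_def using U\<A> Bp(2) by (intro \<A>.Diff \<A>.finite_Union) auto
  have U_disj: "C = C'" if "C \<in> \<B>" "C' \<in> \<B>" "x \<in> U C" "x \<in> U C'" for C C' x
    using that unfolding U_def by blast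
  define rep dflt :: "'g set \<Rightarrow> 'g" where "rep C = (SOME x. x \<in> C)" and "dflt C = (SOME x. x \<in> C)" for C
  have rep: "rep C \<in> C" if "C \<in> \<B>" for C
    unfolding rep_def some_in_eq using partition_onD3[OF Bp(1)] that by blast
  have dflt: "dflt C \<in> C" if "C \<in> \<Q>" for C
    unfolding dflt_def some_in_eq using partition_onD3[OF Qp(1)] that by blast
  define \<kappa> where "\<kappa> x = (if x \<in> V then dflt (THE C. C \<in> \<Q> \<and> x \<in> C) else rep (THE C. C \<in> \<B> \<and> x \<in> U C))" for x
  have \<kappa>U: "\<kappa> x = rep C" if "C \<in> \<B>" "x \<in> U C" for x C
  proof -
    have "(THE C. C \<in> \<B> \<and> x \<in> U C) = C" using that U_disj by (intro the_equality) blast+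
    moreover have "x \<notin> V" using that by (auto simp: V_def)
    ultimately show ?thesis by (simp add: \<kappa>_def)
  qed
  have \<kappa>V: "\<kappa> x = dflt C" if "C \<in> \<Q>" "x \<in> C" "x \<in> V" for x C
  proof -
    have "(THE C. C \<in> \<Q> \<and> x \<in> C) = C"
      using that partition_on_disjoint[OF Qp(1)] by (intro the_equality) blast+
    then show ?thesis using that by (simp add: \<kappa>_def)
  qed
  have cases: "(\<exists>C\<in>\<B>. x \<in> U C) \<or> (\<exists>C\<in>\<Q>. x \<in> C \<and> x \<in> V)" if "x \<in> X" for x
    using that partition_onD1[OF Qp(1)] unfolding V_def by blast
  have UX: "U C \<subseteq> X" if "C \<in> \<B>" for C using U\<A>[OF that] \<A>.space_closed by blast
  have cell: "\<kappa> x \<in> C" if "C \<in> \<Q>" "x \<in> C" for x C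
  proof -
    have "x \<in> X" using that partition_onD1[OF Qp(1)] by blast
    from cases[OF this] show ?thesis
    proof
      assume "\<exists>C'\<in>\<B>. x \<in> U C'"
      then obtain C' where C': "C' \<in> \<B>" "x \<in> U C'" by blast
      then have "x \<in> q C'" using Eq by (auto simp: U_def)
      then have "q C' = C" using partition_on_disjoint[OF Qp(1) q(1)[OF C'(1)] that(1)] that(2) by blast
      then show ?thesis using \<kappa>U[OF C'] rep[OF C'(1)] q(2)[OF C'(1)] by auto
    next
      assume "\<exists>C'\<in>\<Q>. x \<in> C' \<and> x \<in> V"
      then have "x \<in> V" by blast
      then show ?thesis using \<kappa>V[OF that] dflt[OF that(1)] by simp
    qed
  qed
  show thesis
  proof (rule that)
    show "\<kappa> \<in> X \<rightarrow> X"
    proof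
      fix x assume "x \<in> X"
      then obtain C where C: "C \<in> \<Q>" "x \<in> C" using partition_onD1[OF Qp(1)] by blast
      then show "\<kappa> x \<in> X" using cell[OF C] partition_onD1[OF Qp(1)] by blast
    qed
  next
    fix A
    \<comment> \<open>\<open>\<kappa>\<close> is constant on each of finitely many pieces from
      \<open>\<A>\<close>, so preimages of arbitrary sets are finite unions of such pieces.\<close>
    have "\<kappa> -` A \<inter> X = \<Union>(U ` {C \<in> \<B>. rep C \<in> A}) \<union> \<Union>((\<inter>) V ` {C \<in> \<Q>. dflt C \<in> A})"
    proof (intro equalityI subsetI)
      fix x assume x: "x \<in> \<kappa> -` A \<inter> X"
      then have "x \<in> X" by blast
      from cases[OF this] show "x \<in> \<Union>(U ` {C \<in> \<B>. rep C \<in> A}) \<union> \<Union>((\<inter>) V ` {C \<in> \<Q>. dflt C \<in> A})"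
      proof
        assume "\<exists>C\<in>\<B>. x \<in> U C"
        then obtain C where "C \<in> \<B>" "x \<in> U C" by blast
        then show ?thesis using \<kappa>U[of C x] x by auto
      next
        assume "\<exists>C\<in>\<Q>. x \<in> C \<and> x \<in> V"
        then obtain C where "C \<in> \<Q>" "x \<in> C" "x \<in> V" by blast
        then show ?thesis using \<kappa>V[of C x] x by auto
      qed
    next
      fix x assume "x \<in> \<Union>(U ` {C \<in> \<B>. rep C \<in> A}) \<union> \<Union>((\<inter>) V ` {C \<in> \<Q>. dflt C \<in> A})"
      then show "x \<in> \<kappa> -` A \<inter> X"
      proof
        assume "x \<in> \<Union>(U ` {C \<in> \<B>. rep C \<in> A})"
        then obtain C where "C \<in> \<B>" "rep C \<in> A" "x \<in> U C" by blast
        then show ?thesis using \<kappa>U[of C x] UX[of C] by auto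
      next
        assume "x \<in> \<Union>((\<inter>) V ` {C \<in> \<Q>. dflt C \<in> A})"
        then obtain C where "C \<in> \<Q>" "dflt C \<in> A" "x \<in> V" "x \<in> C" by blast
        then show ?thesis using \<kappa>V[of C x] partition_onD1[OF Qp(1)] by auto
      qed
    qed
    also have "\<dots> \<in> \<A>"
      using U\<A> V\<A> Bp(2) Qp by (intro \<A>.Un \<A>.finite_Union) auto
    finally show "\<kappa> -` A \<inter> X \<in> \<A>" .
  next
    fix A assume A: "A \<in> sigma_sets X \<B>"
    have AX: "A \<subseteq> X" using sigma_sets_into_sp[OF Bp(5) A] .
    have "x \<in> A \<longleftrightarrow> \<kappa> x \<in> A" if x: "x \<in> X" "x \<notin> N" for x
    proof -
      obtain C where C: "C \<in> \<B>" "x \<in> C" using x(1) partition_onD1[OF Bp(1)] by blast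
      have in_E: "x \<in> E C' \<longleftrightarrow> x \<in> C'" if "C' \<in> \<B>" for C' using x(2) that unfolding N_def by blast
      have "x \<notin> E C'" if "C' \<in> \<B> - {C}" for C'
        using in_E[of C'] partition_on_disjoint[OF Bp(1) C(1), of C' x] C(2) that by blast
      then have "x \<in> U C" using in_E[OF C(1)] C(2) unfolding U_def by blast
      then have \<kappa>: "\<kappa> x \<in> C" using \<kappa>U[OF C(1)] rep[OF C(1)] by simp
      show ?thesis using sigma_sets_partition_iff[OF Bp(1) A C(1)] C(2) \<kappa> by blast
    qed
    then have "sym_diff A (\<kappa> -` A \<inter> X) \<subseteq> N" using AX by blast
    from finite_measure_mono[OF this N_sets] show "measure \<mu> (sym_diff A (\<kappa> -` A \<inter> X)) \<le> \<eta>"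
      using N\<mu> by simp
  next
    fix A assume A: "A \<in> sigma_sets X \<Q>"
    have QX: "\<Q> \<subseteq> Pow X" using partition_onD1[OF Qp(1)] by blast
    have AX: "A \<subseteq> X" using sigma_sets_into_sp[OF QX A] .
    have "\<kappa> x \<in> A \<longleftrightarrow> x \<in> A" if x: "x \<in> X" for x
    proof -
      obtain C where C: "C \<in> \<Q>" "x \<in> C" using x partition_onD1[OF Qp(1)] by blast
      note \<kappa> = cell[OF C]
      show ?thesis using sigma_sets_partition_iff[OF Qp(1) A C(1)] C(2) \<kappa> by blast
    qed
    then show "\<kappa> -` A \<inter> X = A" using AX by blast
  qed
qed

section \<open>Comparison of the entropies\<close>

text \<open>Only the values of \<open>\<sigma>\<close> on \<open>F\<close> enter \<open>Hom\<close>,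
  so the count is a function of finitely many coordinates.\<close>

lemma Hom_count_measurable:
  assumes P: "\<P> \<in> partitions" and F: "admissible F" and M: "sets M = sets (Map_space H d)"
  shows "(\<lambda>\<sigma>. real (hom_count d \<sigma> \<Q> \<P> F \<delta>)) \<in> borel_measurable M"
proof -
  have "(\<lambda>\<sigma>. hom_count d \<sigma> \<Q> \<P> F \<delta>) \<in> Map_space H d \<rightarrow>\<^sub>M count_space UNIV"
  proof (rule Map_space_measurable)
    show "finite F" "F \<subseteq> full_semigroup H" using F by (auto simp: admissible_def)
    fix \<sigma> \<sigma>' :: "'h set \<Rightarrow> (nat \<times> nat) set" assume eq: "\<And>f. f \<in> F \<Longrightarrow> \<sigma> f = \<sigma>' f"
    have "homs d \<sigma> \<P> F \<delta> = homs d \<sigma>' \<P> F \<delta>"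
      unfolding set_eq_iff Hom_iff[OF P F] by (simp add: eq)
    then show "hom_count d \<sigma> \<Q> \<P> F \<delta> = hom_count d \<sigma>' \<Q> \<P> F \<delta>"
      by (simp only: Hom_count_def)
  qed
  then have "(\<lambda>\<sigma>. real (hom_count d \<sigma> \<Q> \<P> F \<delta>)) \<in> borel_measurable (Map_space H d)"
    by (rule measurable_compose) simp
  then show ?thesis using measurable_cong_sets[OF M refl] by blast
qed

context
  fixes J :: "'j set" and le :: "'j \<Rightarrow> 'j \<Rightarrow> bool" and d :: "'j \<Rightarrow> nat"
    and \<PP> :: "'j \<Rightarrow> ('h set \<Rightarrow> (nat \<times> nat) set) measure"
    and \<beta> :: "'j bias" and p :: ennreal
  assumes sofic: "sofic_approximation H \<nu> J le d \<PP>" and bias: "bias_for J le \<beta>" and p: "1 \<le> p"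
begin

abbreviation rate :: "'g set set \<Rightarrow> 'g set set \<Rightarrow> 'h set set \<Rightarrow> real \<Rightarrow> ereal" where
  "rate \<Q> \<P> F \<delta> \<equiv> bias_lim J le \<beta> (\<lambda>j. ereal (1 / real (d j)) *
     log_ennreal (Lp_norm p (\<PP> j) (\<lambda>\<sigma>. real (hom_count (d j) \<sigma> \<Q> \<P> F \<delta>))))"

abbreviation "h \<equiv> entropy_QP G \<mu> H \<pi> J le d \<PP> \<beta> p"
abbreviation "h_alg \<equiv> entropy_alg G \<mu> H \<pi> J le d \<PP> \<beta> p"
abbreviation "h_borel \<equiv> measure_entropy G \<mu> H \<pi> J le d \<PP> \<beta> p"

lemma directed: "directed_set J le"
  using sofic unfolding sofic_approximation_def by (rule conjunct1)

lemma sofic_j: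
  assumes "j \<in> J"
  shows "0 < d j" "sets (\<PP> j) = sets (Map_space H (d j))" "space (\<PP> j) = Map_set H (d j)"
proof -
  note j = sofic[unfolded sofic_approximation_def, THEN conjunct2, THEN conjunct1, rule_format, OF assms]
  show "0 < d j" by (rule j[THEN conjunct1])
  show sets: "sets (\<PP> j) = sets (Map_space H (d j))" by (rule j[THEN conjunct2, THEN conjunct2])
  show "space (\<PP> j) = Map_set H (d j)" using sets_eq_imp_space_eq[OF sets] by (simp only: space_Map_space)
qed

text \<open>The passage from counts to entropy: under norm, normalized logarithm and limit a factor
  \<open>exp (c * real (d j))\<close> turns into the summand \<open>c\<close>.\<close>

lemma rate_le:
  assumes P1: "\<P>1 \<in> partitions" and F1: "admissible F1" and P2: "\<P>2 \<in> partitions" and F2: "admissible F2"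
    and j0: "j0 \<in> J"
    and le: "\<And>j. j \<in> J \<Longrightarrow> le j0 j \<Longrightarrow> AE \<sigma> in \<PP> j. real (hom_count (d j) \<sigma> \<Q>1 \<P>1 F1 \<delta>1) \<le>
        exp (c * real (d j)) * real (hom_count (d j) \<sigma> \<Q>2 \<P>2 F2 \<delta>2)"
  shows "rate \<Q>1 \<P>1 F1 \<delta>1 \<le> rate \<Q>2 \<P>2 F2 \<delta>2 + ereal c"
proof (rule bias_lim_le[OF directed bias], unfold eventually_tails[OF directed], intro bexI[OF _ j0] ballI impI)
  fix j assume j: "j \<in> J" "le j0 j"
  let ?N1 = "\<lambda>\<sigma>. real (hom_count (d j) \<sigma> \<Q>1 \<P>1 F1 \<delta>1)"
  let ?N2 = "\<lambda>\<sigma>. real (hom_count (d j) \<sigma> \<Q>2 \<P>2 F2 \<delta>2)"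
  show "ereal (1 / real (d j)) * log_ennreal (Lp_norm p (\<PP> j) ?N1)
      \<le> ereal (1 / real (d j)) * log_ennreal (Lp_norm p (\<PP> j) ?N2) + ereal c"
  proof (rule normalized_log_le[OF _ sofic_j(1)[OF j(1)]], rule Lp_norm_le_cmult)
    show "AE \<sigma> in \<PP> j. \<bar>?N1 \<sigma>\<bar> \<le> exp (c * real (d j)) * \<bar>?N2 \<sigma>\<bar>"
      using le[OF j] by simp
  qed (use P1 F1 P2 F2 sofic_j(2)[OF j(1)] p in \<open>auto intro!: Hom_count_measurable\<close>)
qed

lemma h_le_rate:
  assumes "admissible F" "0 < \<delta>"
  shows "h \<Q> \<P> \<le> rate \<Q> \<P> F \<delta>"
  unfolding entropy_QP_def
  by (rule INF_lower2[of F], simp add: assms(1)[unfolded admissible_def], rule INF_lower, simp add: assms(2))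

lemma le_h:
  assumes "\<And>F \<delta>. admissible F \<Longrightarrow> 0 < \<delta> \<Longrightarrow> x \<le> rate \<Q> \<P> F \<delta>"
  shows "x \<le> h \<Q> \<P>"
  unfolding entropy_QP_def by (intro INF_greatest assms) (auto simp: admissible_def)

section \<open>The algebra generated by translates of \<open>\<F>\<close>\<close>

context
  fixes \<F> :: "'g set set"
  assumes alg: "algebra X \<F>" and sub: "\<F> \<subseteq> sets \<mu>" and gen: "pi_generating G \<mu> H \<pi> \<F>"
begin

abbreviation \<F>_partitions :: "'g set set set" where
  "\<F>_partitions \<equiv> finite_partitions X \<F>"

lemma \<F>_borel: "\<P> \<in> \<F>_partitions \<Longrightarrow> \<P> \<in> partitions"
  using sub unfolding finite_partitions_def by blast

text \<open>The algebra \<open>\<A>\<close> of the overview. Each member comes with finite data, so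
  finitely many of them fit under one partition and one set \<open>F\<close>.\<close>

definition orbit_algebra :: "'g set set" where
  "orbit_algebra = {E. \<exists>\<P>\<in>\<F>_partitions. \<exists>F. admissible F \<and> E \<in> Salg \<P> F}"

lemma trivial_partition: "{X} \<in> \<F>_partitions"
proof -
  interpret \<F>: algebra "X" \<F> by (rule alg)
  have "partition_on X {X}" using not_empty unfolding space_\<mu> by (rule partition_on_space)
  then show ?thesis by (simp add: finite_partitions_def)
qed

lemma admissible_units: "admissible {units H}"
  unfolding admissible_def using H.units_full_semigroup by simp

lemma directed_Salg:
  assumes "\<P>1 \<in> \<F>_partitions" "admissible F1" "\<P>2 \<in> \<F>_partitions" "admissible F2"
  obtains \<P> F where "\<P> \<in> \<F>_partitions" "admissible F" "refines X \<P> \<P>1"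
    "Salg \<P>1 F1 \<subseteq> Salg \<P> F" "Salg \<P>2 F2 \<subseteq> Salg \<P> F"
proof -
  obtain \<P> where P: "\<P> \<in> \<F>_partitions" "refines X \<P> \<P>1" "refines X \<P> \<P>2"
    by (rule common_refinement_algebra[OF alg assms(1,3)])
  have F: "admissible (F1 \<union> F2)" by (rule admissible_Un[OF assms(2,4)])
  show thesis
    by (rule that[OF P(1) F P(2) Salg_mono[OF \<F>_borel[OF P(1)] F P(2) Un_upper1]
          Salg_mono[OF \<F>_borel[OF P(1)] F P(3) Un_upper2]])
qed

lemma algebra_orbit_algebra: "algebra X orbit_algebra"
  unfolding algebra_iff_Un
proof (intro conjI ballI)
  have S: "algebra X (Salg \<P> F)" for \<P> F by (rule algebra_Salg)
  note S' = S[unfolded algebra_iff_Un]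
  have "Salg \<P> F \<subseteq> Pow X" for \<P> F using S' by (rule conjunct1)
  then show "orbit_algebra \<subseteq> Pow X" unfolding orbit_algebra_def by blast
  have "{} \<in> Salg {X} {units H}" by (rule S'[THEN conjunct2, THEN conjunct1])
  then show "{} \<in> orbit_algebra"
    using trivial_partition admissible_units unfolding orbit_algebra_def by blast
  fix A assume A: "A \<in> orbit_algebra"
  obtain \<P> F where "\<P> \<in> \<F>_partitions" "admissible F" "A \<in> Salg \<P> F"
    using A unfolding orbit_algebra_def by blast
  moreover from this(3) have "X - A \<in> Salg \<P> F"
    by (rule S'[THEN conjunct2, THEN conjunct2, THEN conjunct1, THEN bspec])
  ultimately show "X - A \<in> orbit_algebra" unfolding orbit_algebra_def by blast
  fix B assume B: "B \<in> orbit_algebra"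
  obtain \<P>1 F1 where 1: "\<P>1 \<in> \<F>_partitions" "admissible F1" "A \<in> Salg \<P>1 F1"
    using A unfolding orbit_algebra_def by blast
  obtain \<P>2 F2 where 2: "\<P>2 \<in> \<F>_partitions" "admissible F2" "B \<in> Salg \<P>2 F2"
    using B unfolding orbit_algebra_def by blast
  obtain \<P> F where P: "\<P> \<in> \<F>_partitions" "admissible F" "Salg \<P>1 F1 \<subseteq> Salg \<P> F" "Salg \<P>2 F2 \<subseteq> Salg \<P> F"
    by (rule directed_Salg[OF 1(1,2) 2(1,2)])
  have "A \<in> Salg \<P> F" "B \<in> Salg \<P> F" using P(3,4) 1(3) 2(3) by blast+
  then have "A \<union> B \<in> Salg \<P> F"
    by (rule S'[THEN conjunct2, THEN conjunct2, THEN conjunct2, THEN bspec, THEN bspec])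
  then show "A \<union> B \<in> orbit_algebra" using P(1,2) unfolding orbit_algebra_def by blast
qed

lemma orbit_algebra_sets: "orbit_algebra \<subseteq> sets \<mu>"
  using Salg_sets[OF \<F>_borel] unfolding orbit_algebra_def by blast

lemma act_orbit_algebra:
  assumes f: "f \<in> full_semigroup H" and A: "A \<in> \<F>"
  shows "act f A \<in> orbit_algebra"
proof (cases "A = {}")
  case True
  interpret algebra "X" orbit_algebra by (rule algebra_orbit_algebra)
  show ?thesis using True by (simp add: act_empty)
next
  case False
  interpret \<F>: algebra "X" \<F> by (rule alg)
  \<comment> \<open>The empty set is removed for the case that \<open>A\<close> is all of
    \<open>X\<close>.\<close>
  have "{A, X - A} - {{}} \<in> \<F>_partitions"
    using False A \<F>.sets_into_space[OF A] unfolding finite_partitions_def partition_on_def disjoint_def by auto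
  moreover have "admissible {units H, f}" using f H.units_full_semigroup by (simp add: admissible_def)
  moreover have "act f A \<in> Salg ({A, X - A} - {{}}) {units H, f}"
    by (rule Salg_gens) (use False in auto)
  ultimately show ?thesis unfolding orbit_algebra_def by blast
qed

text \<open>Being \<open>\<pi>\<close>-generating replaces \<open>B\<close> by a member of
  \<open>Sigma_pi\<close> up to a null set; that sigma-algebra is contained in the one generated by
  the algebra, where approximation in measure applies.\<close>

lemma orbit_algebra_dense:
  assumes B: "B \<in> sets \<mu>" and \<epsilon>: "0 < \<epsilon>"
  shows "\<exists>E\<in>orbit_algebra. measure \<mu> (sym_diff B E) < \<epsilon>"
proof -
  obtain A where A: "A \<in> Sigma_pi G H \<pi> \<F>" "sym_diff A B \<in> null_sets \<mu>"
    using gen B unfolding pi_generating_def sets_\<mu> by blast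
  have "{ext_act G H \<pi> f P | f P. f \<in> full_semigroup H \<and> P \<in> \<F>} \<subseteq> orbit_algebra"
  proof clarify
    interpret \<F>: algebra "X" \<F> by (rule alg)
    fix f P assume f: "f \<in> full_semigroup H" and P: "P \<in> \<F>"
    have "P \<subseteq> X" by (rule \<F>.sets_into_space[OF P])
    then show "ext_act G H \<pi> f P \<in> orbit_algebra"
      using act_orbit_algebra[OF f P] ext_act_eq_act[OF f] by simp
  qed
  then have "Sigma_pi G H \<pi> \<F> \<subseteq> sigma_sets X orbit_algebra"
    unfolding Sigma_pi_def by (intro sigma_sets_mono) (auto intro: sigma_sets.Basic)
  then have A': "A \<in> sigma_sets (space \<mu>) orbit_algebra" using A(1) unfolding space_\<mu> by blast
  obtain E where E: "E \<in> orbit_algebra" "measure \<mu> (sym_diff A E) < \<epsilon>"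
    using algebra_dense[OF _ orbit_algebra_sets A' \<epsilon>] algebra_orbit_algebra unfolding space_\<mu> by blast
  have sets: "A \<in> sets \<mu>" "E \<in> sets \<mu>"
    using sets.sigma_sets_subset[OF orbit_algebra_sets] A' E(1) orbit_algebra_sets by blast+
  have AE_sets: "sym_diff A E \<in> sets \<mu>" "sym_diff A B \<in> sets \<mu>"
    using sets B by (simp_all add: sets.Un sets.Diff)
  have "measure \<mu> (sym_diff B E) \<le> measure \<mu> (sym_diff A E \<union> sym_diff A B)"
    by (rule finite_measure_mono) (use AE_sets in blast)+
  also have "\<dots> = measure \<mu> (sym_diff A E)" by (rule measure_Un_null_set[OF AE_sets(1) A(2)])
  finally show ?thesis by (intro bexI[OF le_less_trans[OF _ E(2)] E(1)])
qed

lemma finite_orbit_algebra: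
  assumes "finite \<C>" "\<C> \<subseteq> orbit_algebra" and Q: "\<Q> \<in> \<F>_partitions"
  shows "\<exists>\<P> F. \<P> \<in> \<F>_partitions \<and> refines X \<P> \<Q> \<and> admissible F \<and> \<C> \<subseteq> Salg \<P> F"
  using assms(1,2)
proof (induction \<C> rule: finite_induct)
  case empty
  have "refines X \<Q> \<Q>" using partitionsD(1)[OF \<F>_borel[OF Q]] by (rule refines_refl)
  then show ?case using Q admissible_units by blast
next
  case (insert C \<C>)
  obtain \<P>1 F1 where 1: "\<P>1 \<in> \<F>_partitions" "refines X \<P>1 \<Q>" "admissible F1" "\<C> \<subseteq> Salg \<P>1 F1"
    using insert.IH insert.prems by blast
  obtain \<P>2 F2 where 2: "\<P>2 \<in> \<F>_partitions" "admissible F2" "C \<in> Salg \<P>2 F2"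
    using insert.prems unfolding orbit_algebra_def by blast
  obtain \<P> F where P: "\<P> \<in> \<F>_partitions" "admissible F" "refines X \<P> \<P>1"
    "Salg \<P>1 F1 \<subseteq> Salg \<P> F" "Salg \<P>2 F2 \<subseteq> Salg \<P> F"
    by (rule directed_Salg[OF 1(1,3) 2(1,2)])
  have "refines X \<P> \<Q>" using P(3) 1(2) by (rule refines_trans)
  moreover have "insert C \<C> \<subseteq> Salg \<P> F" using P(4,5) 1(4) 2(3) by blast
  ultimately show ?case using P(1,2) by blast
qed

section \<open>The two inequalities\<close>

lemma entropy_algebra_le:
  assumes Q: "\<Q> \<in> \<F>_partitions" and P: "\<P> \<in> partitions" and ref: "refines X \<P> \<Q>"
  shows "(INF \<P>'\<in>finer \<F> \<Q>. h \<Q> \<P>') \<le> h \<Q> \<P>"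
proof (rule le_h)
  fix F and \<delta> :: real assume F: "admissible F" and \<delta>: "0 < \<delta>"
  let ?B = "atoms \<P> F"
  define c m where "c = real (card \<P>)" and "m = real (card ?B)"
  have cm: "0 \<le> c" "0 \<le> m" by (simp_all add: c_def m_def)
  \<comment> \<open>\<open>\<eta>\<close> is fixed before \<open>\<P>'\<close> and
    \<open>F'\<close>, which depend on \<open>\<kappa>\<close>; \<open>\<delta>'\<close> is chosen
    afterwards because it depends on \<open>k\<close>. Each choice spends a quarter:
    \<open>c * k * \<delta>' + 2 * c * \<eta>\<close> is at most three quarters of
    \<open>\<delta>\<close>, and \<open>m * (\<delta>' + \<eta>)\<close> at most half.\<close>
  define \<eta> where "\<eta> = \<delta> / (4 * (c + m + 1))"
  have \<eta>: "0 < \<eta>" using \<delta> cm by (simp add: \<eta>_def)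
  have cancel: "x * (\<delta> / (4 * x)) = \<delta> / 4" if "0 < x" for x :: real using that by simp
  have \<eta>_eq: "(c + m + 1) * \<eta> = \<delta> / 4" unfolding \<eta>_def by (rule cancel) (use cm in linarith)
  have "?B \<in> partitions"
    using atoms_on[OF P F] finite_atoms[OF P F] atoms_Salg[OF P F] Salg_sets[OF P F]
    unfolding finite_partitions_def by blast
  note B = this
  have QS: "sigma_sets X \<Q> \<subseteq> Salg \<P> F"
    using refines_sigma_sets[OF P ref] sigma_sets_Salg[OF P F] by (rule order_trans)
  have refB: "refines X ?B \<Q>"
  proof (rule refines_if_sigma_sets[OF atoms_on[OF P F] partitionsD(1)[OF \<F>_borel[OF Q]]])
    show "\<Q> \<subseteq> sigma_sets X ?B"
      unfolding sigma_sets_atoms[OF P F] using QS by (auto intro: sigma_sets.Basic)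
  qed
  have Q': "\<Q> \<in> finite_partitions X orbit_algebra"
  proof -
    have "\<Q> \<subseteq> orbit_algebra"
      using partition_Salg[OF \<F>_borel[OF Q] admissible_units] Q admissible_units unfolding orbit_algebra_def by blast
    then show ?thesis using Q by (simp add: finite_partitions_def)
  qed
  obtain \<kappa> where \<kappa>: "\<kappa> \<in> X \<rightarrow> X" "\<And>A. \<kappa> -` A \<inter> X \<in> orbit_algebra"
    "\<And>A. A \<in> sigma_sets X ?B \<Longrightarrow> measure \<mu> (sym_diff A (\<kappa> -` A \<inter> X)) \<le> \<eta>"
    "\<And>A. A \<in> sigma_sets X \<Q> \<Longrightarrow> \<kappa> -` A \<inter> X = A"
    by (rule collapsing_map[OF algebra_orbit_algebra orbit_algebra_sets orbit_algebra_dense B Q' refB \<eta>])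
      (assumption | rule that)+
  let ?C = "(\<lambda>A. \<kappa> -` A \<inter> X) ` Salg \<P> F"
  have "finite ?C" "?C \<subseteq> orbit_algebra" using finite_Salg[OF P F] \<kappa>(2) by blast+
  from finite_orbit_algebra[OF this Q] obtain \<P>' F' where P': "\<P>' \<in> \<F>_partitions" "refines X \<P>' \<Q>"
    and F': "admissible F'" and C: "?C \<subseteq> Salg \<P>' F'" by blast
  note P'b = \<F>_borel[OF P'(1)]
  define F'' where "F'' = F \<union> F' \<union> (\<lambda>(f, g). set_mult H f g) ` (F \<times> F')"
  have F'': "admissible F''"
    using F F' H.set_mult_full_semigroup unfolding admissible_def F''_def by auto
  define k where "k = 3 * real (card F') * real (card \<P>') + 2"
  have k: "0 < k" by (simp add: k_def add_nonneg_pos)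
  define \<delta>' where "\<delta>' = \<delta> / (4 * (c * k + m + 1))"
  have ckm: "0 < c * k + m + 1" using cm k by (simp add: add_nonneg_pos)
  have \<delta>': "0 < \<delta>'" using \<delta> ckm by (simp add: \<delta>'_def)
  have \<delta>'_eq: "(c * k + m + 1) * \<delta>' = \<delta> / 4" unfolding \<delta>'_def by (rule cancel[OF ckm])
  have nn: "0 \<le> m * \<delta>'" "0 \<le> c * k * \<delta>'" "0 \<le> c * \<eta>" "0 \<le> m * \<eta>"
    using cm k \<delta>' \<eta> by simp_all
  have 1: "c * (k * \<delta>' + 2 * \<eta>) < \<delta>" and 2: "m * (\<delta>' + \<eta>) < \<delta>"
    using \<eta>_eq \<delta>'_eq nn \<delta> \<delta>' \<eta> by (simp_all add: algebra_simps)
  have fin: "finite (F \<union> F')" "F \<union> F' \<subseteq> full_semigroup H" using F F' unfolding admissible_def by blast+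
  obtain j0 where j0: "j0 \<in> J" "\<And>j. j \<in> J \<Longrightarrow> le j0 j \<Longrightarrow> AE \<sigma> in \<PP> j. multiplicative H (d j) (F \<union> F') \<delta>' \<sigma>"
    using sofic[unfolded sofic_approximation_def, THEN conjunct2, THEN conjunct2, THEN conjunct2, THEN conjunct1,
      rule_format, of "F \<union> F'" \<delta>'] fin \<delta>' by blast
  have "rate \<Q> \<P>' F'' \<delta>' \<le> rate \<Q> \<P> F \<delta> + ereal 0"
  proof (rule rate_le[OF P'b F'' P F j0(1)])
    fix j assume j: "j \<in> J" "le j0 j"
    show "AE \<sigma> in \<PP> j. real (hom_count (d j) \<sigma> \<Q> \<P>' F'' \<delta>') \<le>
        exp (0 * real (d j)) * real (hom_count (d j) \<sigma> \<Q> \<P> F \<delta>)" (is "AE \<sigma> in _. ?le \<sigma>")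
      using j0(2)[OF j] AE_space
    proof eventually_elim
      fix \<sigma> assume m: "multiplicative H (d j) (F \<union> F') \<delta>' \<sigma>" and "\<sigma> \<in> space (\<PP> j)"
      then have \<sigma>: "\<sigma> \<in> Map_set H (d j)" using sofic_j(3)[OF j(1)] by simp
      let ?r = "\<lambda>\<phi>. restrict \<phi> (sigma_sets X \<Q>)"
      have "?r ` homs (d j) \<sigma> \<P>' F'' \<delta>' \<subseteq> ?r ` homs (d j) \<sigma> \<P> F \<delta>"
      proof (rule image_subsetI)
        fix \<phi> assume \<phi>: "\<phi> \<in> homs (d j) \<sigma> \<P>' F'' \<delta>'"
        let ?\<psi> = "\<lambda>B\<in>Salg \<P> F. \<phi> (\<kappa> -` B \<inter> X)"
        have "?\<psi> \<in> homs (d j) \<sigma> \<P> F \<delta>"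
        proof (rule Hom_transfer[OF P F P'b F' F'' _ _ _ \<kappa>(1) _ _ _ _ \<sigma> m \<phi>])
          show "F \<subseteq> F''" "F' \<subseteq> F''" by (auto simp: F''_def)
          show "set_mult H f g \<in> F''" if "f \<in> F" "g \<in> F'" for f g using that by (auto simp: F''_def)
          show "\<kappa> -` B \<inter> X \<in> Salg \<P>' F'" if "B \<in> Salg \<P> F" for B using C that by blast
          show "measure \<mu> (sym_diff B (\<kappa> -` B \<inter> X)) \<le> \<eta>" if "B \<in> Salg \<P> F" for B
            using that \<kappa>(3) unfolding sigma_sets_atoms[OF P F] by blast
          show "real (card \<P>) * ((3 * real (card F') * real (card \<P>') + 2) * \<delta>' + 2 * \<eta>) < \<delta>"
            using 1 by (simp only: c_def k_def)
          show "real (card ?B) * (\<delta>' + \<eta>) < \<delta>" using 2 by (simp only: m_def)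
        qed
        moreover have "?r \<phi> = ?r ?\<psi>"
        proof
          fix A show "?r \<phi> A = ?r ?\<psi> A"
            using \<kappa>(4)[of A] QS by (cases "A \<in> sigma_sets X \<Q>") auto
        qed
        ultimately show "?r \<phi> \<in> ?r ` homs (d j) \<sigma> \<P> F \<delta>"
          by (intro image_eqI[of "?r \<phi>" ?r ?\<psi>])
      qed
      then have "hom_count (d j) \<sigma> \<Q> \<P>' F'' \<delta>' \<le> hom_count (d j) \<sigma> \<Q> \<P> F \<delta>"
        unfolding Hom_count_def by (intro card_mono finite_imageI finite_Hom[OF P F])
      then show "?le \<sigma>" by simp
    qed
  qed
  also have "\<dots> = rate \<Q> \<P> F \<delta>" by simp
  finally have "rate \<Q> \<P>' F'' \<delta>' \<le> rate \<Q> \<P> F \<delta>" .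
  moreover have "h \<Q> \<P>' \<le> rate \<Q> \<P>' F'' \<delta>'" by (rule h_le_rate[OF F'' \<delta>'])
  moreover have "(INF \<P>'\<in>finer \<F> \<Q>. h \<Q> \<P>') \<le> h \<Q> \<P>'"
    using P' by (intro INF_lower) simp
  ultimately show "(INF \<P>'\<in>finer \<F> \<Q>. h \<Q> \<P>') \<le> rate \<Q> \<P> F \<delta>"
    by (meson order_trans)
qed

text \<open>\<open>\<Q>'\<close> depends on \<open>\<Q>\<close> and \<open>\<epsilon>\<close> only,
  whereas the \<open>\<F>\<close>-partition \<open>\<P>'\<close> above it is arbitrary, which
  matches the order of supremum and infimum on the right. A common refinement of
  \<open>\<P>'\<close> and \<open>\<Q>\<close> competes in the infimum on the left.\<close>

lemma entropy_borel_le: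
  assumes Q: "\<Q> \<in> partitions" and \<epsilon>: "0 < \<epsilon>"
  shows "(INF \<P>\<in>finer (sets \<mu>) \<Q>. h \<Q> \<P>) \<le>
     h_alg \<F> + ereal \<epsilon>" (is "?L \<le> _")
proof -
  define n where "n = card \<Q>"
  \<comment> \<open>The bound on small sets is raised to the power \<open>n\<close>, so its exponent
    is divided accordingly; the \<open>+ 1\<close> covers \<open>n = 0\<close>.\<close>
  have "0 < \<epsilon> / (real n + 1)" using \<epsilon> by simp
  then obtain \<eta>4 where \<eta>4: "0 < \<eta>4"
    "\<And>d. real (card {S \<in> Pow {1..d}. card_norm d S \<le> \<eta>4}) \<le> exp (\<epsilon> / (real n + 1) * real d)"
    using card_small_subsets_exp by blast
  \<comment> \<open>Members of one fibre may differ by sets of norm up to \<open>4 * \<eta>\<close>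
    on each cell.\<close>
  define \<eta> where "\<eta> = \<eta>4 / 4"
  have \<eta>: "0 < \<eta>" "4 * \<eta> = \<eta>4" using \<eta>4(1) by (simp_all add: \<eta>_def)
  have "\<forall>A\<in>\<Q>. \<exists>E\<in>orbit_algebra. measure \<mu> (sym_diff A E) < \<eta>"
    using partitionsD(3)[OF Q] by (intro ballI orbit_algebra_dense \<eta>(1)) blast
  from bchoice[OF this[unfolded Bex_def]] obtain E where
    E: "\<forall>A\<in>\<Q>. E A \<in> orbit_algebra \<and> measure \<mu> (sym_diff A (E A)) < \<eta>" by blast
  have "finite (E ` \<Q>)" "E ` \<Q> \<subseteq> orbit_algebra" using partitionsD(2)[OF Q] E by blast+
  from finite_orbit_algebra[OF this trivial_partition] obtain \<Q>' K
    where Q': "\<Q>' \<in> \<F>_partitions" and K: "admissible K" and EK: "E ` \<Q> \<subseteq> Salg \<Q>' K" by blast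
  have "?L - ereal \<epsilon> \<le> h \<Q>' \<P>'" if P': "\<P>' \<in> \<F>_partitions" and ref: "refines X \<P>' \<Q>'" for \<P>'
  proof (rule le_h)
    fix F' and \<delta>' :: real assume F': "admissible F'" and \<delta>': "0 < \<delta>'"
    have algb: "algebra X (sets \<mu>)"
      using sets.algebra_axioms[of \<mu>] unfolding space_\<mu> .
    obtain \<P> where P: "\<P> \<in> partitions" "refines X \<P> \<P>'" "refines X \<P> \<Q>"
      by (rule common_refinement_algebra[OF algb \<F>_borel[OF P'] Q])
    define \<delta> where "\<delta> = min \<delta>' (\<eta> / (1 + real (card K)))"
    have \<delta>: "0 < \<delta>" "\<delta> \<le> \<delta>'" "(1 + real (card K)) * \<delta> \<le> \<eta>"
    proof -
      show "0 < \<delta>" "\<delta> \<le> \<delta>'" using \<delta>' \<eta>(1) by (simp_all add: \<delta>_def add_pos_nonneg)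
      have "(1 + real (card K)) * \<delta> \<le> (1 + real (card K)) * (\<eta> / (1 + real (card K)))"
        by (intro mult_left_mono) (simp_all add: \<delta>_def)
      also have "\<dots> = \<eta>" by simp
      finally show "(1 + real (card K)) * \<delta> \<le> \<eta>" .
    qed
    have F: "admissible (F' \<union> K)" by (rule admissible_Un[OF F' K])
    obtain j0 where j0: "j0 \<in> J" using directed unfolding directed_set_def by blast
    have "rate \<Q> \<P> (F' \<union> K) \<delta> \<le> rate \<Q>' \<P>' F' \<delta>' + ereal \<epsilon>"
    proof (rule rate_le[OF P(1) F \<F>_borel[OF P'] F' j0])
      fix j assume j: "j \<in> J"
      show "AE \<sigma> in \<PP> j. real (hom_count (d j) \<sigma> \<Q> \<P> (F' \<union> K) \<delta>) \<le>
          exp (\<epsilon> * real (d j)) * real (hom_count (d j) \<sigma> \<Q>' \<P>' F' \<delta>')" (is "AE \<sigma> in _. ?le \<sigma>")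
        using AE_space
      proof eventually_elim
        fix \<sigma> assume "\<sigma> \<in> space (\<PP> j)"
        then have \<sigma>: "\<sigma> \<in> Map_set H (d j)" using sofic_j(3)[OF j] by simp
        let ?b = "real (card {S \<in> Pow {1..d j}. card_norm (d j) S \<le> 4 * \<eta>})"
        have "?b ^ n \<le> exp (\<epsilon> / (real n + 1) * real (d j)) ^ n"
          using \<eta>4(2)[of "d j"] unfolding \<eta>(2) by (intro power_mono) simp_all
        also have "\<dots> = exp (real n * (\<epsilon> / (real n + 1) * real (d j)))" by (rule exp_of_nat_mult[symmetric])
        also have "\<dots> \<le> exp (\<epsilon> * real (d j))"
        proof -
          have "real n * (\<epsilon> / (real n + 1)) \<le> \<epsilon>" using \<epsilon> by (simp add: field_simps)
          then have "real n * (\<epsilon> / (real n + 1)) * real (d j) \<le> \<epsilon> * real (d j)" by (intro mult_right_mono) simp_all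
          then show ?thesis by (simp only: exp_le_cancel_iff mult.assoc)
        qed
        finally have b: "?b ^ n \<le> exp (\<epsilon> * real (d j))" .
        have EQ: "\<And>A. A \<in> \<Q> \<Longrightarrow> E A \<in> Salg \<Q>' K" "\<And>A. A \<in> \<Q> \<Longrightarrow> measure \<mu> (sym_diff A (E A)) < \<eta>"
          using EK E by blast+
        have "real (hom_count (d j) \<sigma> \<Q> \<P> (F' \<union> K) \<delta>) \<le>
            ?b ^ n * real (hom_count (d j) \<sigma> \<Q>' \<P>' F' \<delta>')"
          unfolding n_def
          by (rule Hom_count_le_fibres[OF Q \<F>_borel[OF Q'] K EQ \<F>_borel[OF P'] ref F' P \<delta>(2,3) \<sigma>])
        also have "\<dots> \<le> exp (\<epsilon> * real (d j)) * real (hom_count (d j) \<sigma> \<Q>' \<P>' F' \<delta>')"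
          using b by (intro mult_right_mono) simp_all
        finally show "?le \<sigma>" .
      qed
    qed
    moreover have "h \<Q> \<P> \<le> rate \<Q> \<P> (F' \<union> K) \<delta>" by (rule h_le_rate[OF F \<delta>(1)])
    moreover have "?L \<le> h \<Q> \<P>" using P by (intro INF_lower) simp
    ultimately have "?L \<le> rate \<Q>' \<P>' F' \<delta>' + ereal \<epsilon>" by (meson order_trans)
    then show "?L - ereal \<epsilon> \<le> rate \<Q>' \<P>' F' \<delta>'" unfolding ereal_le_add_iff_minus .
  qed
  then have "?L - ereal \<epsilon> \<le> (INF \<P>'\<in>finer \<F> \<Q>'. h \<Q>' \<P>')"
    by (intro INF_greatest) blast
  also have "\<dots> \<le> h_alg \<F>"
    unfolding entropy_alg_def by (rule SUP_upper[OF Q'])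
  finally show ?thesis unfolding ereal_le_add_iff_minus .
qed

lemma measure_entropy_eq:
  "h_borel = h_alg \<F>"
proof (rule antisym)
  have ME: "h_borel =
      (SUP \<Q>\<in>partitions. INF \<P>\<in>finer (sets \<mu>) \<Q>. h \<Q> \<P>)"
    unfolding measure_entropy_def entropy_alg_def sets_\<mu> ..
  show "h_borel \<le> h_alg \<F>"
    unfolding ME
  proof (rule SUP_least)
    fix \<Q> assume Q: "\<Q> \<in> partitions"
    show "(INF \<P>\<in>finer (sets \<mu>) \<Q>. h \<Q> \<P>) \<le>
        h_alg \<F>"
      using entropy_borel_le[OF Q] by (rule ereal_le_epsilon2)
  qed
  show "h_alg \<F> \<le> h_borel"
    unfolding entropy_alg_def
  proof (rule SUP_least)
    fix \<Q> assume Q: "\<Q> \<in> \<F>_partitions"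
    have "(INF \<P>\<in>finer \<F> \<Q>. h \<Q> \<P>) \<le>
        (INF \<P>\<in>finer (sets \<mu>) \<Q>. h \<Q> \<P>)"
      by (intro INF_greatest) (use entropy_algebra_le[OF Q] in blast)
    also have "\<dots> \<le> h_borel"
      unfolding ME by (rule SUP_upper[OF \<F>_borel[OF Q]])
    finally show "(INF \<P>\<in>finer \<F> \<Q>. h \<Q> \<P>) \<le>
        h_borel" .
  qed
qed

end

end

end

theorem theorem7p5:
  fixes G :: "'g borel_groupoid" and \<mu> :: "'g measure"
    and H :: "'h borel_groupoid" and \<nu> :: "'h measure"
    and \<pi> :: "'g \<Rightarrow> 'h"
    and J :: "'j set" and le :: "'j \<Rightarrow> 'j \<Rightarrow> bool" and d :: "'j \<Rightarrow> nat"
    and \<PP> :: "'j \<Rightarrow> ('h set \<Rightarrow> (nat \<times> nat) set) measure"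
    and \<beta> :: "'j bias" and p :: ennreal
    and \<F> :: "'g set set"
  assumes "pmp_class_bijective_extension G \<mu> H \<nu> \<pi>"
    and "sofic_approximation H \<nu> J le d \<PP>"
    and "bias_for J le \<beta>"
    and "1 \<le> p"
    and "algebra (units G) \<F>" and "\<F> \<subseteq> sets (unit_space G)"
    and "pi_generating G \<mu> H \<pi> \<F>"
  shows "measure_entropy G \<mu> H \<pi> J le d \<PP> \<beta> p = entropy_alg G \<mu> H \<pi> J le d \<PP> \<beta> p \<F>"
proof -
  interpret pmp_extension G \<mu> H \<nu> \<pi> by unfold_locales (rule assms(1))
  have "\<F> \<subseteq> sets \<mu>" using assms(6) unfolding sets_\<mu> .
  from measure_entropy_eq[OF assms(2-5) this assms(7)] show ?thesis .
qed

end
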